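(* Let $T_n^{\rm sp}$ be a random split tree with $n$ balls and parameters $b,s,s_0,s_1,\mathcal V$, and let $N$ be its number of vertices. Suppose that $\mathbb P(V_1=1)=\mathbb P(V_1=0)=0$, that $\ln V_1$ is non-lattice, and that for some $\alpha>0$ and $\varepsilon>0$, $\mathbb E[N]=\alpha n+O(n(\ln n)^{-1-\varepsilon})$. Fix $c>0$ and perform Bernoulli bond percolation on $T_n^{\rm sp}$ with parameter $p_n=1-\frac{c}{\ln n}$. Let $G_n$ be the number of vertices in the percolation cluster containing the root. Then $$\lim_{n\to\infty}n^{-1}G_n=\alpha e^{-\frac{c}{\mu}}\quad\text{in probability}.$$ Moreover, the root cluster is the unique giant component, i.e., $\lim_{n\to\infty}n^{-1}G_n^{2\mathrm{nd}}=0$ in probability, where $G_n^{2\mathrm{nd}}$ denotes the number of vertices of the second largest percolation cluster.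
   Context: Split trees. Let $b,s,s_0,s_1$ be integers with $b\ge 2$, $0<s$, $0\le s_0\le s$, $0\le bs_1\le s+1-s_0$, and let $\mathcal V=(V_1,\dots,V_b)$ be a random vector with $V_i\ge0$, $\sum_i V_i=1$, whose components are (standing assumption) identically distributed, so $\mathbb E[V_1]=1/b$. Let $\mathbb T$ be the infinite rooted $b$-ary tree; each vertex $u$ carries an independent copy $\mathcal V_u=(V_{u,1},\dots,V_{u,b})$ of $\mathcal V$. Place $n$ balls at the root and let $n_u$ denote the number of balls in the sub-tree rooted at $u$ (root: $n$). Recursively, given $n_u$ and $\mathcal V_u$: if $n_u\le s$ all $n_u$ balls are stored at $u$ and $n_{u_i}=0$ for all children $u_1,\dots,u_b$; if $n_u>s$, then $s_0$ balls are stored at $u$ and $(n_{u_1},\dots,n_{u_b})$ is distributed as $\mathrm{Mult}(n_u-s_0-bs_1,V_{u,1},\dots,V_{u,b})+(s_1,\dots,s_1)$. The split tree $T_n^{\rm sp}$ consists of all $u$ with $n_u>0$. Constant: $\mu=b\,\mathbb E[-V_1\ln V_1]$. $\ln V_1$ is non-lattice if there is no $a\in\mathbb R$ with $\ln V_1\in a\mathbb Z$ almost surely. Bernoulli bond percolation with parameter $p$: given the tree, each edge is removed with probability $1-p$, independently of the other edges; clusters are the resulting connected components ($n$ is taken large enough that $p_n\in[0,1]$). The size of a cluster is here its number of vertices. *)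

theory Defs
  imports
    "HOL-Probability.Probability"
    "HOL-Library.Sublist"
    "HOL-Library.Landau_Symbols"
    "HOL-Library.Multiset"
begin

text \<open>
  Vertices of the infinite \<open>b\<close>-ary tree are words over \<open>{..<b}\<close>: the root is \<open>[]\<close>, the children
  of \<open>u\<close> are \<open>u @ [i]\<close>, and \<open>strict_prefix u w\<close> says that \<open>w\<close> is a proper descendant of \<open>u\<close>.
  Components of vectors are indexed from \<open>0\<close>, so \<open>V\<^sub>1\<close> becomes \<open>v 0\<close>.
\<close>

abbreviation vertices :: "nat \<Rightarrow> nat list set" where
  "vertices b \<equiv> lists {..<b}"

abbreviation vec_space :: "nat \<Rightarrow> (nat \<Rightarrow> real) measure" where
  "vec_space b \<equiv> Pi\<^sub>M {..<b} (\<lambda>_. borel)"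


section \<open>The split vector\<close>

definition split_vector_law :: "nat \<Rightarrow> (nat \<Rightarrow> real) measure \<Rightarrow> bool" where
  "split_vector_law b D \<longleftrightarrow>
     prob_space D \<and> sets D = sets (vec_space b) \<and>
     (AE v in D. (\<forall>i<b. 0 \<le> v i) \<and> (\<Sum>i<b. v i) = 1) \<and>
     (\<forall>i<b. \<forall>j<b. distr D borel (\<lambda>v. v i) = distr D borel (\<lambda>v. v j))"

definition split_mu :: "nat \<Rightarrow> (nat \<Rightarrow> real) measure \<Rightarrow> real" where
  "split_mu b D = real b * (\<integral>v. - v 0 * ln (v 0) \<partial>D)"

definition log_non_lattice :: "(nat \<Rightarrow> real) measure \<Rightarrow> bool" where
  "log_non_lattice D \<longleftrightarrow> \<not> (\<exists>a::real. AE v in D. \<exists>k::int. ln (v 0) = a * of_int k)"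


section \<open>Random split trees\<close>

definition multinomial_prob :: "nat \<Rightarrow> nat \<Rightarrow> (nat \<Rightarrow> real) \<Rightarrow> (nat \<Rightarrow> nat) \<Rightarrow> real" where
  "multinomial_prob b m p a =
     (if (\<Sum>i<b. a i) = m then fact m / (\<Prod>i<b. fact (a i)) * (\<Prod>i<b. p i ^ a i) else 0)"

text \<open>
  The probability that the \<open>b\<close> children of a vertex with \<open>m\<close> balls in its sub-tree and split
  vector \<open>v\<close> receive \<open>a 0, \<dots>, a (b - 1)\<close> balls.  Under the standing constraints on \<open>s\<close>, \<open>s0\<close>,
  \<open>s1\<close> the natural-number subtractions do not truncate.
\<close>

definition children_prob ::
  "nat \<Rightarrow> nat \<Rightarrow> nat \<Rightarrow> nat \<Rightarrow> nat \<Rightarrow> (nat \<Rightarrow> real) \<Rightarrow> (nat \<Rightarrow> nat) \<Rightarrow> real" where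
  "children_prob b s s0 s1 m v a =
     (if m \<le> s then (if \<forall>i<b. a i = 0 then 1 else 0)
      else (if \<forall>i<b. s1 \<le> a i
            then multinomial_prob b (m - s0 - b * s1) v (\<lambda>i. a i - s1) else 0))"

text \<open>
  The information available when the balls of \<open>u\<close> are distributed among its children: all split
  vectors, and the ball counts of all vertices that are not proper descendants of \<open>u\<close>.
\<close>

definition past_of ::
  "'w measure \<Rightarrow> nat \<Rightarrow> (nat list \<Rightarrow> 'w \<Rightarrow> nat \<Rightarrow> real) \<Rightarrow> (nat list \<Rightarrow> 'w \<Rightarrow> nat) \<Rightarrow>
   nat list \<Rightarrow> 'w measure" where
  "past_of M b V balls u =
     sigma (space M)
       ({V w -` A \<inter> space M | w A. w \<in> vertices b \<and> A \<in> sets (vec_space b)} \<union>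
        {balls w -` B \<inter> space M | w B. w \<in> vertices b \<and> \<not> strict_prefix u w})"

text \<open>
  \<open>balls u\<close> is the number of balls in the sub-tree rooted at \<open>u\<close>.  In \<open>balls_split\<close>, conditioning
  on the whole past rather than on \<open>balls u\<close> and \<open>V u\<close> alone expresses that the splits at different
  vertices use independent randomness.
\<close>

locale random_split_tree = prob_space M
  for M :: "'w measure" +
  fixes b s s0 s1 :: nat
    and D :: "(nat \<Rightarrow> real) measure"
    and n :: nat
    and V :: "nat list \<Rightarrow> 'w \<Rightarrow> nat \<Rightarrow> real"
    and balls :: "nat list \<Rightarrow> 'w \<Rightarrow> nat"
  assumes V_indep: "indep_vars (\<lambda>_. vec_space b) V (vertices b)"
    and V_law: "\<And>u. u \<in> vertices b \<Longrightarrow> distr M (vec_space b) (V u) = D"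
    and balls_measurable: "\<And>u. u \<in> vertices b \<Longrightarrow> balls u \<in> measurable M (count_space UNIV)"
    and balls_root: "AE \<omega> in M. balls [] \<omega> = n"
    and balls_split: "\<And>u a. u \<in> vertices b \<Longrightarrow>
          AE \<omega> in M.
            real_cond_exp M (past_of M b V balls u)
              (indicator {\<omega> \<in> space M. \<forall>i<b. balls (u @ [i]) \<omega> = a i}) \<omega> =
            children_prob b s s0 s1 (balls u \<omega>) (V u \<omega>) a"

definition split_tree :: "nat \<Rightarrow> (nat list \<Rightarrow> 'w \<Rightarrow> nat) \<Rightarrow> 'w \<Rightarrow> nat list set" where
  "split_tree b balls \<omega> = {u \<in> vertices b. 0 < balls u \<omega>}"


section \<open>Bernoulli bond percolation\<close>

text \<open>
  Each non-root vertex of the infinite tree stands for the edge to its parent, and all these edges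
  carry independent marks, independent of the split tree; the percolated tree keeps the edges of
  the split tree with mark \<open>True\<close>.
\<close>

abbreviation tree_edges :: "nat \<Rightarrow> nat list set" where
  "tree_edges b \<equiv> vertices b - {[]}"

locale percolated_split_tree = random_split_tree M b s s0 s1 D n V balls
  for M :: "'w measure" and b s s0 s1 D n V balls +
  fixes p :: real
    and keep :: "nat list \<Rightarrow> 'w \<Rightarrow> bool"
  assumes keep_indep: "indep_vars (\<lambda>_. count_space UNIV) keep (tree_edges b)"
    and keep_prob: "\<And>e. e \<in> tree_edges b \<Longrightarrow> prob {\<omega> \<in> space M. keep e \<omega>} = p"
    and keep_tree_indep:
      "indep_var
         (Pi\<^sub>M (vertices b) (\<lambda>_. count_space UNIV)) (\<lambda>\<omega>. \<lambda>u\<in>vertices b. u \<in> split_tree b balls \<omega>)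
         (Pi\<^sub>M (tree_edges b) (\<lambda>_. count_space UNIV)) (\<lambda>\<omega>. \<lambda>e\<in>tree_edges b. keep e \<omega>)"

definition open_edges :: "nat list set \<Rightarrow> (nat list \<Rightarrow> bool) \<Rightarrow> (nat list \<times> nat list) set" where
  "open_edges T k = {(u, u @ [i]) | u i. u \<in> T \<and> u @ [i] \<in> T \<and> k (u @ [i])}"

definition same_cluster :: "nat list set \<Rightarrow> (nat list \<Rightarrow> bool) \<Rightarrow> (nat list \<times> nat list) set" where
  "same_cluster T k = (open_edges T k \<union> (open_edges T k)\<inverse>)\<^sup>* \<inter> T \<times> T"

definition clusters :: "nat list set \<Rightarrow> (nat list \<Rightarrow> bool) \<Rightarrow> nat list set set" where
  "clusters T k = T // same_cluster T k"

definition root_cluster_size :: "nat list set \<Rightarrow> (nat list \<Rightarrow> bool) \<Rightarrow> nat" where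
  "root_cluster_size T k = card (same_cluster T k `` {[]})"

text \<open>
  Cluster sizes, with multiplicity and in decreasing order; the second largest size is \<open>0\<close> if there
  is only one cluster.  Split trees are almost surely finite, so the conventions for
  infinite sets do not matter.
\<close>

definition cluster_sizes :: "nat list set \<Rightarrow> (nat list \<Rightarrow> bool) \<Rightarrow> nat list" where
  "cluster_sizes T k = rev (sorted_list_of_multiset (image_mset card (mset_set (clusters T k))))"

definition second_cluster_size :: "nat list set \<Rightarrow> (nat list \<Rightarrow> bool) \<Rightarrow> nat" where
  "second_cluster_size T k =
     (if 2 \<le> length (cluster_sizes T k) then cluster_sizes T k ! 1 else 0)"


section \<open>Convergence in probability\<close>

text \<open>
  The variables may live on different probability spaces; measurability for large \<open>n\<close> is
  demanded because \<open>measure\<close> assigns the value \<open>0\<close> to non-measurable sets.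
\<close>

definition tendsto_in_prob ::
  "(nat \<Rightarrow> 'w measure) \<Rightarrow> (nat \<Rightarrow> 'w \<Rightarrow> real) \<Rightarrow> real \<Rightarrow> bool" where
  "tendsto_in_prob M X l \<longleftrightarrow>
     (\<forall>\<^sub>F n in sequentially. X n \<in> borel_measurable (M n)) \<and>
     (\<forall>\<delta>>0. (\<lambda>n. measure (M n) {\<omega> \<in> space (M n). \<delta> < \<bar>X n \<omega> - l\<bar>}) \<longlonglongrightarrow> 0)"

end

theory Submission
  imports Defs "HOL-Real_Asymp.Real_Asymp"
begin

text \<open>
The proof is a second-moment computation.  Write \<open>T\<close> for the split tree, \<open>n\<^sub>u\<close> for the number of balls
below \<open>u\<close> and \<open>\<delta> = 1 - p\<^sub>n = c / ln n\<close>.  Since the marks are independent of the tree,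

  \<open>E G = E (\<Sum>u\<in>T. p ^ |u|)\<close>  and  \<open>E G\<^sup>2 = E (\<Sum>u,w\<in>T. p ^ (|u| + |w| - |u \<and> w|))\<close>,

where \<open>u \<and> w\<close> is the last common ancestor.  Both need only the joint law of two ball counts.
A split vector is independent of the ball counts of all vertices that do not lie strictly below its
vertex, so these laws are governed by the averaged kernel \<open>children_law\<close>, and the two moments become
sums over powers of the operator \<open>(P \<phi>) m = E (\<Sum>i. \<phi> (m\<^sub>i))\<close>, where \<open>m\<^sub>1, \<dots>, m\<^sub>b\<close> are the counts of
the children of a vertex with \<open>m\<close> balls.  Three facts about \<open>P\<close> carry the argument: it contracts
squares (\<open>P_sq_le\<close>), which makes every sum below finite and lets pairs with a deep common ancestor be
ignored; it lowers \<open>m ln m\<close> by about \<open>\<mu> m\<close> (\<open>P_xlnx_le\<close>), which bounds the mean depth of a ball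
by about \<open>ln n / \<mu>\<close>; and it almost preserves \<open>m powr (1 - \<theta>)\<close> up to the factor \<open>1 + \<theta> \<mu>\<close>
(\<open>P_powr_le\<close>, \<open>moment_le\<close>).

First moment.  Write the expected number of vertices as \<open>\<alpha> m + R m\<close> with \<open>R m = o(m)\<close>.  Summation by
parts along the tree (\<open>visits_decomp\<close>) replaces vertices by balls: \<open>E G\<close> is \<open>\<alpha>\<close> times
\<open>E (\<Sum> balls. p ^ depth)\<close>, up to \<open>o(n)\<close>, because \<open>R\<close> enters the sum over all vertices only with
the factor \<open>\<delta>\<close>, while that sum is of order \<open>n ln n\<close>.  The weighted sum over balls is about
\<open>n exp (- c / \<mu>)\<close>: from below by Jensen's inequality and the bound on the mean depth
(\<open>potential_own_ge\<close>), from above by comparison with the supersolution \<open>m powr (1 - \<theta>)\<close>, where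
\<open>\<theta> < \<delta> / \<mu>\<close> (\<open>potential_own_powr_le\<close>).

Second moment.  Grouping pairs by their last common ancestor bounds \<open>E G\<^sup>2\<close> by a sum of products of
first moments over pairs of distinct children (\<open>root_count_square\<close>).  Inserting \<open>h m = m powr (1 - \<theta>)\<close> for
these first moments, the sum telescopes to \<open>(h n)\<^sup>2\<close> up to an error that vanishes with \<open>\<theta>\<close>, since
\<open>(\<Sum>i. h (m\<^sub>i))\<^sup>2 \<le> b powr (2 \<theta>) * (h m)\<^sup>2\<close> (\<open>sum_P2_powr_le\<close>).  Hence
\<open>E (G - \<alpha> n exp (- c / \<mu>))\<^sup>2 = o(n\<^sup>2)\<close>, and Chebyshev's inequality gives the first claim.

Second cluster.  At least one of the two largest clusters misses the root.  Two vertices of such a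
cluster share the top of the cluster as an ancestor, and the edge above the top is closed.  So the square of the
second largest size is at most the number of pairs of vertices with a closed edge above
both (\<open>second_cluster_le_pairs\<close>).  Its expectation is at most
\<open>\<delta> E (\<Sum>u,w\<in>T. |u \<and> w|) = O(\<delta> n\<^sup>2)\<close>, which is \<open>o(n\<^sup>2)\<close>.
\<close>

section \<open>Multinomial moments\<close>

definition compositions :: "nat \<Rightarrow> nat \<Rightarrow> (nat \<Rightarrow> nat) set" where
  "compositions b m = {x \<in> {..<b} \<rightarrow>\<^sub>E UNIV. (\<Sum>i<b. x i) = m}"

definition multinomial_mean :: "nat \<Rightarrow> nat \<Rightarrow> (nat \<Rightarrow> real) \<Rightarrow> ((nat \<Rightarrow> nat) \<Rightarrow> real) \<Rightarrow> real" where
  "multinomial_mean b m v \<Phi> = (\<Sum>x\<in>compositions b m. multinomial_prob b m v x * \<Phi> x)"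

lemma compositions_le: "x \<in> compositions b m \<Longrightarrow> i < b \<Longrightarrow> x i \<le> m"
  unfolding compositions_def by (auto intro: member_le_sum)

lemma finite_compositions [simp]: "finite (compositions b m)"
proof (rule finite_subset)
  show "compositions b m \<subseteq> {..<b} \<rightarrow>\<^sub>E {..m}"
  proof
    fix x assume x: "x \<in> compositions b m"
    then have "x \<in> extensional {..<b}" by (simp add: compositions_def PiE_iff)
    then show "x \<in> {..<b} \<rightarrow>\<^sub>E {..m}" using compositions_le[OF x] by (simp add: PiE_iff)
  qed
qed (auto intro: finite_PiE)

lemma compositions_0: "compositions b 0 = {\<lambda>i\<in>{..<b}. 0}"
  unfolding compositions_def by (auto simp: PiE_iff extensional_def restrict_def)

lemma multinomial_mean_0: "multinomial_mean b 0 v \<Phi> = \<Phi> (\<lambda>i\<in>{..<b}. 0)"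
  by (simp add: multinomial_mean_def compositions_0 multinomial_prob_def)

lemma multinomial_mean_cong:
  "(\<And>x. x \<in> compositions b m \<Longrightarrow> \<Phi> x = \<Psi> x) \<Longrightarrow>
    multinomial_mean b m v \<Phi> = multinomial_mean b m v \<Psi>"
  unfolding multinomial_mean_def by (intro sum.cong) auto

lemma multinomial_prob_nonneg: "(\<And>i. i < b \<Longrightarrow> 0 \<le> v i) \<Longrightarrow> 0 \<le> multinomial_prob b m v x"
  unfolding multinomial_prob_def by (auto intro!: mult_nonneg_nonneg prod_nonneg divide_nonneg_nonneg)

lemma multinomial_mean_mono:
  assumes "\<And>i. i < b \<Longrightarrow> 0 \<le> v i" and "\<And>x. x \<in> compositions b m \<Longrightarrow> \<Phi> x \<le> \<Psi> x"
  shows "multinomial_mean b m v \<Phi> \<le> multinomial_mean b m v \<Psi>"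
  unfolding multinomial_mean_def by (intro sum_mono mult_left_mono multinomial_prob_nonneg assms)

lemma multinomial_prob_Suc:
  assumes x: "x \<in> compositions b (Suc m)"
  shows "multinomial_prob b (Suc m) v x =
    (\<Sum>i<b. if x i = 0 then 0 else v i * multinomial_prob b m v (x(i := x i - 1)))"
proof -
  have sx: "(\<Sum>i<b. x i) = Suc m" using x by (simp add: compositions_def)
  let ?F = "\<Prod>i<b. fact (x i) :: real" and ?W = "\<Prod>i<b. v i ^ x i"
  have eq: "(if x i = 0 then 0 else v i * multinomial_prob b m v (x(i := x i - 1)))
      = real (x i) * (fact m / ?F * ?W)" if i: "i < b" for i
  proof (cases "x i = 0")
    case False
    let ?y = "x(i := x i - 1)"
    have "(\<Sum>j<b. ?y j) = (\<Sum>j\<in>{..<b}-{i}. x j) + (x i - 1)"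
      using i by (subst sum.remove[of _ i]) (auto intro!: sum.cong)
    moreover have "(\<Sum>j<b. x j) = x i + (\<Sum>j\<in>{..<b}-{i}. x j)"
      using i by (subst sum.remove[of _ i]) auto
    ultimately have sy: "(\<Sum>j<b. ?y j) = m" using sx False by simp
    have F: "?F = real (x i) * (\<Prod>j<b. fact (?y j))"
    proof -
      have "?F = fact (x i) * (\<Prod>j\<in>{..<b}-{i}. fact (x j))"
        using i by (subst prod.remove[of _ i]) auto
      also have "(\<Prod>j\<in>{..<b}-{i}. fact (x j) :: real) = (\<Prod>j\<in>{..<b}-{i}. fact (?y j))"
        by (intro prod.cong) auto
      also have "(fact (x i) :: real) = real (x i) * fact (?y i)"
        using False by (simp add: fact_reduce)
      finally show ?thesis
        using i by (subst prod.remove[of "{..<b}" i "\<lambda>j. fact (?y j) :: real"]) auto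
    qed
    have W: "?W = v i * (\<Prod>j<b. v j ^ ?y j)"
    proof -
      have "?W = v i ^ x i * (\<Prod>j\<in>{..<b}-{i}. v j ^ x j)"
        using i by (subst prod.remove[of _ i]) auto
      also have "(\<Prod>j\<in>{..<b}-{i}. v j ^ x j) = (\<Prod>j\<in>{..<b}-{i}. v j ^ ?y j)"
        by (intro prod.cong) auto
      also have "v i ^ x i = v i * v i ^ ?y i"
        using False by (simp add: power_eq_if)
      finally show ?thesis
        using i by (subst prod.remove[of "{..<b}" i "\<lambda>j. v j ^ ?y j"]) auto
    qed
    have nz: "(\<Prod>j<b. fact (?y j) :: real) \<noteq> 0" by (simp add: prod_zero_iff)
    show ?thesis
      using False sy nz unfolding multinomial_prob_def F W by simp
  qed simp
  have "multinomial_prob b (Suc m) v x = real (\<Sum>i<b. x i) * (fact m / ?F * ?W)"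
    unfolding multinomial_prob_def sx by simp
  also have "\<dots> = (\<Sum>i<b. real (x i) * (fact m / ?F * ?W))"
    by (simp only: of_nat_sum sum_distrib_right)
  also have "\<dots> = (\<Sum>i<b. if x i = 0 then 0 else v i * multinomial_prob b m v (x(i := x i - 1)))"
    using eq by (intro sum.cong) auto
  finally show ?thesis .
qed

text \<open>
A multinomial sample of size \<open>m + 1\<close> is one of size \<open>m\<close> with a further ball thrown into box \<open>i\<close> with
probability \<open>v i\<close>.  All moments below follow from this recursion.
\<close>

lemma multinomial_mean_Suc:
  "multinomial_mean b (Suc m) v \<Phi> =
    (\<Sum>i<b. v i * multinomial_mean b m v (\<lambda>x. \<Phi> (x(i := Suc (x i)))))"
proof -
  have "multinomial_mean b (Suc m) v \<Phi> =
    (\<Sum>x\<in>compositions b (Suc m). \<Sum>i<b.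
       (if x i = 0 then 0 else v i * multinomial_prob b m v (x(i := x i - 1)) * \<Phi> x))"
    unfolding multinomial_mean_def
    by (intro sum.cong refl) (auto simp: multinomial_prob_Suc sum_distrib_right intro!: sum.cong)
  also have "\<dots> = (\<Sum>i<b. \<Sum>x\<in>compositions b (Suc m).
       (if x i = 0 then 0 else v i * multinomial_prob b m v (x(i := x i - 1)) * \<Phi> x))"
    by (rule sum.swap)
  also have "\<dots> = (\<Sum>i<b. v i * multinomial_mean b m v (\<lambda>x. \<Phi> (x(i := Suc (x i)))))"
  proof (intro sum.cong refl)
    fix i assume i: "i \<in> {..<b}"
    have upd: "(\<Sum>j<b. (x(i := k)) j) + x i = (\<Sum>j<b. x j) + k" for x :: "nat \<Rightarrow> nat" and k
    proof -
      have "(\<Sum>j<b. (x(i := k)) j) = k + (\<Sum>j\<in>{..<b}-{i}. x j)"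
        using i by (subst sum.remove[of _ i]) (auto intro!: sum.cong)
      moreover have "(\<Sum>j<b. x j) = x i + (\<Sum>j\<in>{..<b}-{i}. x j)"
        using i by (subst sum.remove[of _ i]) auto
      ultimately show ?thesis by simp
    qed
    have "(\<Sum>x\<in>compositions b (Suc m).
       (if x i = 0 then 0 else v i * multinomial_prob b m v (x(i := x i - 1)) * \<Phi> x)) =
       (\<Sum>x\<in>{x \<in> compositions b (Suc m). x i \<noteq> 0}.
          v i * multinomial_prob b m v (x(i := x i - 1)) * \<Phi> x)"
      by (intro sum.mono_neutral_cong_right) auto
    also have "\<dots> = (\<Sum>y\<in>compositions b m.
          v i * multinomial_prob b m v y * \<Phi> (y(i := Suc (y i))))"
    proof (rule sum.reindex_bij_witness[where i = "\<lambda>y. y(i := Suc (y i))" and j = "\<lambda>x. x(i := x i - 1)"])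
      fix x assume x: "x \<in> {x \<in> compositions b (Suc m). x i \<noteq> 0}"
      show "x(i := x i - 1) \<in> compositions b m"
        using x i upd[of x "x i - 1"] by (auto simp: compositions_def PiE_iff extensional_def)
    next
      fix y assume y: "y \<in> compositions b m"
      show "y(i := Suc (y i)) \<in> {x \<in> compositions b (Suc m). x i \<noteq> 0}"
        using y i upd[of y "Suc (y i)"] by (auto simp: compositions_def PiE_iff extensional_def)
    qed auto
    finally show "(\<Sum>x\<in>compositions b (Suc m).
       (if x i = 0 then 0 else v i * multinomial_prob b m v (x(i := x i - 1)) * \<Phi> x)) =
       v i * multinomial_mean b m v (\<lambda>x. \<Phi> (x(i := Suc (x i))))"
      unfolding multinomial_mean_def by (simp add: sum_distrib_left mult.assoc)
  qed
  finally show ?thesis .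
qed

lemma multinomial_mean_add:
  "multinomial_mean b m v (\<lambda>x. \<Phi> x + \<Psi> x) = multinomial_mean b m v \<Phi> + multinomial_mean b m v \<Psi>"
  by (simp add: multinomial_mean_def sum.distrib algebra_simps)

lemma multinomial_mean_cmult:
  "multinomial_mean b m v (\<lambda>x. c * \<Phi> x) = c * multinomial_mean b m v \<Phi>"
  by (simp add: multinomial_mean_def sum_distrib_left algebra_simps)

context
  fixes b :: nat and v :: "nat \<Rightarrow> real"
  assumes sum_v: "(\<Sum>i<b. v i) = 1"
begin

lemma multinomial_mean_const: "multinomial_mean b m v (\<lambda>_. c) = c"
  by (induction m) (simp_all add: multinomial_mean_0 multinomial_mean_Suc sum_v flip: sum_distrib_right)

lemma sum_v_split: "i < b \<Longrightarrow> (\<Sum>j<b. v j * (if j = i then x else y)) = v i * x + (1 - v i) * (y::real)"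
proof -
  assume i: "i < b"
  have "(\<Sum>j\<in>{..<b}-{i}. v j) = 1 - v i"
    using i sum.remove[of "{..<b}" i v] sum_v by simp
  moreover have "(\<Sum>j<b. v j * (if j = i then x else y)) = v i * x + (\<Sum>j\<in>{..<b}-{i}. v j * y)"
    using i by (subst sum.remove[of _ i]) (auto intro!: sum.cong)
  ultimately show ?thesis by (simp flip: sum_distrib_right)
qed

lemma multinomial_mean_coord:
  assumes i: "i < b"
  shows "multinomial_mean b m v (\<lambda>x. real (x i)) = real m * v i"
proof (induction m)
  case 0 show ?case using i by (simp add: multinomial_mean_0)
next
  case (Suc m)
  have "multinomial_mean b m v (\<lambda>x. real ((x(j := Suc (x j))) i)) =
      (if j = i then real m * v i + 1 else real m * v i)" for j
  proof (cases "j = i")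
    case True
    have "multinomial_mean b m v (\<lambda>x. real ((x(j := Suc (x j))) i)) =
       multinomial_mean b m v (\<lambda>x. real (x i) + 1)"
      using True by (simp add: add.commute)
    then show ?thesis using True Suc by (simp only: multinomial_mean_add multinomial_mean_const) simp
  qed (use Suc in simp)
  then show ?case
    unfolding multinomial_mean_Suc using i by (simp add: sum_v_split algebra_simps)
qed

lemma multinomial_mean_coord_sq:
  assumes i: "i < b"
  shows "multinomial_mean b m v (\<lambda>x. real (x i) ^ 2) =
    real m * v i + real m * (real m - 1) * (v i)\<^sup>2"
proof (induction m)
  case 0 show ?case using i by (simp add: multinomial_mean_0)
next
  case (Suc m)
  let ?Q = "real m * v i + real m * (real m - 1) * (v i)\<^sup>2"
  have "multinomial_mean b m v (\<lambda>x. real ((x(j := Suc (x j))) i) ^ 2) =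
      (if j = i then ?Q + 2 * (real m * v i) + 1 else ?Q)" for j
  proof (cases "j = i")
    case True
    have "multinomial_mean b m v (\<lambda>x. real ((x(j := Suc (x j))) i) ^ 2) =
       multinomial_mean b m v (\<lambda>x. (real (x i) ^ 2 + 2 * real (x i)) + 1)"
      using True by (simp add: power2_eq_square algebra_simps)
    then show ?thesis using True Suc
      by (simp only: multinomial_mean_add multinomial_mean_const multinomial_mean_cmult
          multinomial_mean_coord[OF i]) simp
  qed (use Suc in simp)
  then show ?case
    unfolding multinomial_mean_Suc using i by (simp add: sum_v_split) (simp add: power2_eq_square algebra_simps)
qed

end

abbreviation profiles :: "nat \<Rightarrow> nat \<Rightarrow> (nat \<Rightarrow> nat) set" where
  "profiles b m \<equiv> {..<b} \<rightarrow>\<^sub>E {..m}"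

lemma finite_profiles [simp]: "finite (profiles b m)" by (simp add: finite_PiE)

text \<open>
The mean of \<open>\<Phi>\<close> over the ball counts of the children for a fixed split vector: beyond the threshold
\<open>s\<close> these counts are a multinomial sample shifted by \<open>s1\<close>.
\<close>

lemma children_mean_eq_multinomial:
  assumes m: "s < m" and le: "s0 + b * s1 \<le> m"
  shows "(\<Sum>a\<in>profiles b m. children_prob b s s0 s1 m v a * \<Phi> a) =
    multinomial_mean b (m - s0 - b * s1) v (\<lambda>x. \<Phi> (\<lambda>i\<in>{..<b}. x i + s1))"
proof -
  let ?m = "m - s0 - b * s1"
  let ?A = "{a \<in> profiles b m. (\<forall>i<b. s1 \<le> a i) \<and> (\<Sum>i<b. a i - s1) = ?m}"
  have "(\<Sum>a\<in>profiles b m. children_prob b s s0 s1 m v a * \<Phi> a) =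
    (\<Sum>a\<in>?A. multinomial_prob b ?m v (\<lambda>i. a i - s1) * \<Phi> a)"
    using m by (intro sum.mono_neutral_cong_right) (auto simp: children_prob_def multinomial_prob_def)
  also have "\<dots> = (\<Sum>x\<in>compositions b ?m. multinomial_prob b ?m v x * \<Phi> (\<lambda>i\<in>{..<b}. x i + s1))"
  proof (rule sum.reindex_bij_witness[where j = "\<lambda>a. \<lambda>i\<in>{..<b}. a i - s1" and i = "\<lambda>x. \<lambda>i\<in>{..<b}. x i + s1"])
    fix a assume a: "a \<in> ?A"
    show "(\<lambda>i\<in>{..<b}. (\<lambda>i\<in>{..<b}. a i - s1) i + s1) = a"
      using a by (auto simp: PiE_iff extensional_def fun_eq_iff)
    show "(\<lambda>i\<in>{..<b}. a i - s1) \<in> compositions b ?m"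
      using a by (auto simp: compositions_def)
    show "multinomial_prob b ?m v (\<lambda>i\<in>{..<b}. a i - s1) * \<Phi> (\<lambda>i\<in>{..<b}. (\<lambda>i\<in>{..<b}. a i - s1) i + s1)
      = multinomial_prob b ?m v (\<lambda>i. a i - s1) * \<Phi> a"
      unfolding \<open>(\<lambda>i\<in>{..<b}. (\<lambda>i\<in>{..<b}. a i - s1) i + s1) = a\<close>
      by (simp add: multinomial_prob_def)
  next
    fix x assume x: "x \<in> compositions b ?m"
    show "(\<lambda>i\<in>{..<b}. (\<lambda>i\<in>{..<b}. x i + s1) i - s1) = x"
      using x by (auto simp: compositions_def PiE_iff extensional_def fun_eq_iff)
    have "x i + s1 \<le> m" if "i < b" for i
    proof -
      have "x i \<le> ?m" using compositions_le[OF x that] .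
      moreover have "s1 \<le> b * s1" using that by (cases b) auto
      ultimately show ?thesis using le by linarith
    qed
    then show "(\<lambda>i\<in>{..<b}. x i + s1) \<in> ?A"
      using x by (auto simp: compositions_def)
  qed
  finally show ?thesis unfolding multinomial_mean_def .
qed

section \<open>The averaged splitting kernel\<close>

text \<open>
Concavity in the form of a tangent line.  Taking means of both sides yields Jensen's inequality from
the first moment alone.
\<close>

lemma powr_le_tangent:
  fixes A Y \<beta> :: real
  assumes "0 < A" "0 \<le> Y" "0 < \<beta>" "\<beta> \<le> 1"
  shows "Y powr \<beta> \<le> A powr \<beta> + \<beta> * A powr (\<beta> - 1) * (Y - A)"
proof (cases "Y = 0")
  case True
  then show ?thesis using assms by (simp add: powr_diff)
next
  case False
  then have "Y > 0" using assms by simp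
  have "(Y / A) powr \<beta> * 1 powr (1 - \<beta>) \<le> \<beta> * (Y / A) + (1 - \<beta>) * 1"
    using assms \<open>Y > 0\<close> by (intro Youngs_inequality_0) auto
  then have "A powr \<beta> * (Y / A) powr \<beta> \<le> A powr \<beta> * (\<beta> * (Y / A) + (1 - \<beta>))"
    by (intro mult_left_mono) auto
  then show ?thesis using assms \<open>Y > 0\<close>
    by (simp add: powr_divide powr_diff field_simps)
qed

locale split_kernel =
  fixes b s s0 s1 :: nat and D :: "(nat \<Rightarrow> real) measure"
  assumes b_ge_2: "2 \<le> b" and s_pos: "0 < s" and s0_le: "s0 \<le> s" and s1_le: "b * s1 \<le> s + 1 - s0"
    and law: "split_vector_law b D"
    and not_one: "measure D {v \<in> space D. v 0 = 1} = 0"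
    and not_zero: "measure D {v \<in> space D. v 0 = 0} = 0"
begin

sublocale D: prob_space D
  using law by (simp add: split_vector_law_def)

lemma b_pos: "0 < b" using b_ge_2 by simp

lemma sets_D [measurable_cong]: "sets D = sets (vec_space b)"
  using law by (simp add: split_vector_law_def)

lemma coord_measurable [measurable]: "i < b \<Longrightarrow> (\<lambda>v. v i) \<in> borel_measurable D"
  by measurable

lemma AE_simplex: "AE v in D. (\<forall>i<b. 0 \<le> v i) \<and> (\<Sum>i<b. v i) = 1"
  using law by (simp add: split_vector_law_def)

lemma distr_coord: "i < b \<Longrightarrow> distr D borel (\<lambda>v. v i) = distr D borel (\<lambda>v. v 0)"
  using law b_pos unfolding split_vector_law_def by blast

lemma AE_coord_0: "AE v in D. 0 < v 0 \<and> v 0 < 1"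
proof -
  have "AE v in D. v 0 \<noteq> 1"
    using not_one b_pos by (subst (asm) D.prob_eq_0) auto
  moreover have "AE v in D. v 0 \<noteq> 0"
    using not_zero b_pos by (subst (asm) D.prob_eq_0) auto
  ultimately show ?thesis using AE_simplex
  proof eventually_elim
    case (elim v)
    have "v 0 \<le> (\<Sum>i<b. v i)" using elim b_pos by (intro member_le_sum) auto
    moreover have "0 \<le> v 0" using elim b_pos by auto
    ultimately show ?case using elim by linarith
  qed
qed

lemma AE_coord: 
  assumes "i < b" shows "AE v in D. 0 < v i \<and> v i < 1"
proof -
  have "AE x in distr D borel (\<lambda>v. v 0). 0 < x \<and> x < 1"
    using b_pos AE_coord_0 by (subst AE_distr_iff) auto
  then have "AE x in distr D borel (\<lambda>v. v i). 0 < x \<and> x < 1"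
    by (simp only: distr_coord[OF assms])
  then show ?thesis using assms by (subst (asm) AE_distr_iff) auto
qed

lemma AE_split: "AE v in D. (\<forall>i<b. 0 < v i \<and> v i < 1) \<and> (\<Sum>i<b. v i) = 1"
proof -
  have "AE v in D. \<forall>i\<in>{..<b}. 0 < v i \<and> v i < 1" using AE_coord by (intro AE_finite_allI) auto
  then show ?thesis using AE_simplex by eventually_elim auto
qed

text \<open>
The components of the split vector are identically distributed, so integrals of one component can be
computed with component \<open>0\<close>.
\<close>

lemma integral_coord:
  fixes f :: "real \<Rightarrow> real"
  assumes "i < b" and [measurable]: "f \<in> borel_measurable borel"
  shows "(\<integral>v. f (v i) \<partial>D) = (\<integral>v. f (v 0) \<partial>D)"
    and "integrable D (\<lambda>v. f (v i)) \<longleftrightarrow> integrable D (\<lambda>v. f (v 0))"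
proof -
  have "(\<integral>v. f (v i) \<partial>D) = (\<integral>x. f x \<partial>distr D borel (\<lambda>v. v i))" using assms by (subst integral_distr) auto
  also have "\<dots> = (\<integral>x. f x \<partial>distr D borel (\<lambda>v. v 0))" using distr_coord[OF assms(1)] by simp
  also have "\<dots> = (\<integral>v. f (v 0) \<partial>D)" using b_pos by (subst integral_distr) auto
  finally show "(\<integral>v. f (v i) \<partial>D) = (\<integral>v. f (v 0) \<partial>D)" .
  have "integrable D (\<lambda>v. f (v i)) \<longleftrightarrow> integrable (distr D borel (\<lambda>v. v i)) f"
    using assms by (subst integrable_distr_eq) auto
  also have "\<dots> \<longleftrightarrow> integrable (distr D borel (\<lambda>v. v 0)) f" using distr_coord[OF assms(1)] by simp
  also have "\<dots> \<longleftrightarrow> integrable D (\<lambda>v. f (v 0))" using b_pos by (subst integrable_distr_eq) auto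
  finally show "integrable D (\<lambda>v. f (v i)) \<longleftrightarrow> integrable D (\<lambda>v. f (v 0))" .
qed

lemma integrable_coord_bounded:
  fixes f :: "real \<Rightarrow> real"
  assumes [measurable]: "f \<in> borel_measurable borel" and "\<And>x. 0 < x \<Longrightarrow> x < 1 \<Longrightarrow> \<bar>f x\<bar> \<le> B"
  shows "integrable D (\<lambda>v. f (v 0))"
proof (rule D.integrable_const_bound)
  show "AE v in D. norm (f (v 0)) \<le> B" using AE_coord_0 by eventually_elim (use assms in auto)
qed (use b_pos in measurable)

lemma mean_coord: "(\<integral>v. v 0 \<partial>D) = 1 / real b"
proof -
  have int: "integrable D (\<lambda>v. v i)" if "i < b" for i
  proof -
    have "integrable D (\<lambda>v. v 0)" by (rule integrable_coord_bounded[of "\<lambda>x. x" 1]) auto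
    then show ?thesis by (subst integral_coord(2)[OF that, of "\<lambda>x. x"]) simp_all
  qed
  have "(\<integral>v. (\<Sum>i<b. v i) \<partial>D) = (\<integral>v. 1 \<partial>D)"
  proof (rule integral_cong_AE)
    show "AE v in D. (\<Sum>i<b. v i) = 1" using AE_simplex by eventually_elim simp
  qed (auto intro!: borel_measurable_sum)
  then have "(\<integral>v. (\<Sum>i<b. v i) \<partial>D) = 1" by (simp add: D.prob_space)
  moreover have "(\<integral>v. (\<Sum>i<b. v i) \<partial>D) = (\<Sum>i<b. \<integral>v. v i \<partial>D)"
    by (rule Bochner_Integration.integral_sum) (use int in simp)
  moreover have "\<dots> = (\<Sum>i<b. \<integral>v. v 0 \<partial>D)"
    by (intro sum.cong refl integral_coord(1)[of _ "\<lambda>x. x"]) simp_all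
  ultimately have "real b * (\<integral>v. v 0 \<partial>D) = 1" by simp
  then show ?thesis using b_pos by (simp add: field_simps)
qed

text \<open>
The transition law of the ball counts after averaging over the split vector.  This is the law that
governs the tree, since the vector at a vertex is independent of the number of balls there.
\<close>

definition children_law :: "nat \<Rightarrow> (nat \<Rightarrow> nat) \<Rightarrow> real" where
  "children_law m a = (\<integral>v. children_prob b s s0 s1 m v a \<partial>D)"

text \<open>
\<open>K \<Phi> m\<close> is the expectation of \<open>\<Phi>\<close> over the counts of the children of a vertex with \<open>m\<close> balls, and
\<open>P\<close> is its restriction to additive functionals: the mean operator of the branching process whose
individuals are vertices with their ball counts as types.
\<close>

definition K :: "((nat \<Rightarrow> nat) \<Rightarrow> real) \<Rightarrow> nat \<Rightarrow> real" where
  "K \<Phi> m = (\<Sum>a\<in>profiles b m. children_law m a * \<Phi> a)"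

definition P :: "(nat \<Rightarrow> real) \<Rightarrow> nat \<Rightarrow> real" where
  "P \<phi> m = K (\<lambda>a. \<Sum>i<b. \<phi> (a i)) m"

abbreviation rest :: "nat \<Rightarrow> nat" where "rest m \<equiv> m - s0 - b * s1"

lemma fits: "s < m \<Longrightarrow> s0 + b * s1 \<le> m" using s0_le s1_le by linarith

lemma children_prob_measurable [measurable]: "(\<lambda>v. children_prob b s s0 s1 m v a) \<in> borel_measurable D"
  unfolding children_prob_def multinomial_prob_def by measurable

lemma children_mean_const:
  assumes "(\<Sum>i<b. v i) = 1"
  shows "(\<Sum>a\<in>profiles b m. children_prob b s s0 s1 m v a) = 1"
proof (cases "s < m")
  case True
  then show ?thesis
    using children_mean_eq_multinomial[OF True fits[OF True], where \<Phi> = "\<lambda>_. 1" and v = v]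
    by (simp add: multinomial_mean_const[OF assms])
next
  case False
  have "(\<Sum>a\<in>profiles b m. children_prob b s s0 s1 m v a)
     = (\<Sum>a\<in>{\<lambda>i\<in>{..<b}. 0}. children_prob b s s0 s1 m v a)"
    using False by (intro sum.mono_neutral_right)
      (auto simp: children_prob_def PiE_iff extensional_def restrict_def fun_eq_iff)
  then show ?thesis using False by (simp add: children_prob_def)
qed

lemma children_prob_nonneg: "\<forall>i<b. 0 \<le> v i \<Longrightarrow> 0 \<le> children_prob b s s0 s1 m v a"
  unfolding children_prob_def using multinomial_prob_nonneg by auto

lemma children_prob_support:
  assumes "children_prob b s s0 s1 m v a \<noteq> 0"
  shows "(\<Sum>i<b. a i) = (if s < m then m - s0 else 0)" and "s < m \<Longrightarrow> i < b \<Longrightarrow> s1 \<le> a i"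
    and "i < b \<Longrightarrow> a i \<le> m"
proof -
  show *: "(\<Sum>i<b. a i) = (if s < m then m - s0 else 0)"
  proof (cases "s < m")
    case True
    then have ge: "\<forall>i<b. s1 \<le> a i" and "(\<Sum>i<b. a i - s1) = rest m"
      using assms by (auto simp: children_prob_def multinomial_prob_def split: if_splits)
    then have "(\<Sum>i<b. (a i - s1) + s1) = rest m + b * s1" by (subst sum.distrib) auto
    also have "(\<Sum>i<b. (a i - s1) + s1) = (\<Sum>i<b. a i)" using ge by (intro sum.cong) auto
    finally show ?thesis using True fits[OF True] by simp
  qed (use assms in \<open>auto simp: children_prob_def split: if_splits\<close>)
  show "s < m \<Longrightarrow> i < b \<Longrightarrow> s1 \<le> a i"
    using assms by (auto simp: children_prob_def split: if_splits)
  show "a i \<le> m" if "i < b"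
  proof -
    have "a i \<le> (\<Sum>i<b. a i)" using that by (intro member_le_sum) auto
    then show ?thesis using * by (auto split: if_splits)
  qed
qed

lemma children_prob_le_1:
  assumes "\<forall>i<b. 0 \<le> v i" "(\<Sum>i<b. v i) = 1"
  shows "children_prob b s s0 s1 m v a \<le> 1"
proof (cases "children_prob b s s0 s1 m v a = 0")
  case False
  let ?a = "restrict a {..<b}"
  have "?a \<in> profiles b m" using children_prob_support(3)[OF False] by auto
  then have "children_prob b s s0 s1 m v ?a \<le> (\<Sum>a\<in>profiles b m. children_prob b s s0 s1 m v a)"
    by (rule member_le_sum) (use assms children_prob_nonneg in auto)
  moreover have "children_prob b s s0 s1 m v ?a = children_prob b s s0 s1 m v a"
    by (auto simp: children_prob_def multinomial_prob_def)
  ultimately show ?thesis using children_mean_const[OF assms(2), of m] by simp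
qed simp

lemma AE_children_prob: "AE v in D. 0 \<le> children_prob b s s0 s1 m v a \<and> children_prob b s s0 s1 m v a \<le> 1"
  using AE_simplex by eventually_elim (intro conjI children_prob_nonneg children_prob_le_1; simp)

lemma integrable_children_prob [simp]: "integrable D (\<lambda>v. children_prob b s s0 s1 m v a)"
proof (rule D.integrable_const_bound)
  show "AE v in D. norm (children_prob b s s0 s1 m v a) \<le> 1"
    using AE_children_prob[of m a] by eventually_elim simp
qed simp

lemma children_law_nonneg: "0 \<le> children_law m a"
proof -
  have "AE v in D. 0 \<le> children_prob b s s0 s1 m v a"
    using AE_children_prob[of m a] by eventually_elim simp
  then show ?thesis unfolding children_law_def by (rule integral_nonneg_AE)
qed

lemma children_law_support:
  assumes "children_law m a \<noteq> 0"
  shows "(\<Sum>i<b. a i) = (if s < m then m - s0 else 0)" and "s < m \<Longrightarrow> i < b \<Longrightarrow> s1 \<le> a i"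
    and "i < b \<Longrightarrow> a i \<le> m"
proof -
  obtain v where "children_prob b s s0 s1 m v a \<noteq> 0"
    using assms unfolding children_law_def by fastforce
  from children_prob_support[OF this]
  show "(\<Sum>i<b. a i) = (if s < m then m - s0 else 0)" "s < m \<Longrightarrow> i < b \<Longrightarrow> s1 \<le> a i"
    "i < b \<Longrightarrow> a i \<le> m" by auto
qed

lemma K_eq_integral: "K \<Phi> m = (\<integral>v. (\<Sum>a\<in>profiles b m. children_prob b s s0 s1 m v a * \<Phi> a) \<partial>D)"
  unfolding K_def children_law_def by (subst Bochner_Integration.integral_sum) auto

lemma K_internal:
  assumes "s < m"
  shows "K \<Phi> m = (\<integral>v. multinomial_mean b (rest m) v (\<lambda>x. \<Phi> (\<lambda>i\<in>{..<b}. x i + s1)) \<partial>D)"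
    and "integrable D (\<lambda>v. multinomial_mean b (rest m) v (\<lambda>x. \<Phi> (\<lambda>i\<in>{..<b}. x i + s1)))"
  unfolding K_eq_integral children_mean_eq_multinomial[OF assms fits[OF assms], symmetric] by auto

lemma K_const [simp]: "K (\<lambda>_. c) m = c"
proof -
  have "AE v in D. (\<Sum>a\<in>profiles b m. children_prob b s s0 s1 m v a * c) = c"
    using AE_simplex by eventually_elim (simp add: children_mean_const flip: sum_distrib_right)
  then have "K (\<lambda>_. c) m = (\<integral>v. c \<partial>D)"
    unfolding K_eq_integral by (intro integral_cong_AE) auto
  then show ?thesis by (simp add: D.prob_space)
qed

text \<open>
Comparison is only required on profiles that have positive probability: the children together
receive \<open>m - s0\<close> balls at an internal vertex and none at a leaf.
\<close>

lemma K_mono: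
  assumes "\<And>a. a \<in> profiles b m \<Longrightarrow> (\<Sum>i<b. a i) \<le> m \<Longrightarrow> (s < m \<Longrightarrow> (\<Sum>i<b. a i) = m - s0) \<Longrightarrow> \<Phi> a \<le> \<Psi> a"
  shows "K \<Phi> m \<le> K \<Psi> m"
  unfolding K_def
proof (intro sum_mono)
  fix a assume a: "a \<in> profiles b m"
  show "children_law m a * \<Phi> a \<le> children_law m a * \<Psi> a"
  proof (cases "children_law m a = 0")
    case False
    then show ?thesis
      using assms[OF a] children_law_support(1)[OF False] children_law_nonneg[of m a]
      by (intro mult_left_mono) (auto split: if_splits)
  qed simp
qed

lemma K_cong:
  assumes "\<And>a. a \<in> profiles b m \<Longrightarrow> (\<Sum>i<b. a i) \<le> m \<Longrightarrow> (s < m \<Longrightarrow> (\<Sum>i<b. a i) = m - s0) \<Longrightarrow> \<Phi> a = \<Psi> a"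
  shows "K \<Phi> m = K \<Psi> m"
  by (intro antisym K_mono) (auto simp: assms)

lemma K_add: "K (\<lambda>a. \<Phi> a + \<Psi> a) m = K \<Phi> m + K \<Psi> m"
  by (simp add: K_def sum.distrib algebra_simps)

lemma K_cmult: "K (\<lambda>a. c * \<Phi> a) m = c * K \<Phi> m"
  by (simp add: K_def sum_distrib_left algebra_simps)

lemma K_leaf: 
  assumes "m \<le> s" shows "K \<Phi> m = \<Phi> (\<lambda>i\<in>{..<b}. 0)"
proof -
  have "K \<Phi> m = K (\<lambda>_. \<Phi> (\<lambda>i\<in>{..<b}. 0)) m"
    unfolding K_def
  proof (intro sum.cong refl)
    fix a assume a: "a \<in> profiles b m"
    show "children_law m a * \<Phi> a = children_law m a * \<Phi> (\<lambda>i\<in>{..<b}. 0)"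
    proof (cases "children_law m a = 0")
      case False
      then have "(\<Sum>i<b. a i) = 0" using children_law_support(1)[OF False] assms by simp
      then have "a = (\<lambda>i\<in>{..<b}. 0)" using a by (auto simp: PiE_iff extensional_def fun_eq_iff)
      then show ?thesis by simp
    qed simp
  qed
  then show ?thesis by simp
qed

lemma P_mono:
  assumes "\<And>j. j \<le> m \<Longrightarrow> \<phi> j \<le> \<psi> j"
  shows "P \<phi> m \<le> P \<psi> m"
  unfolding P_def by (intro K_mono sum_mono assms) auto

lemma P_add: "P (\<lambda>m. \<phi> m + \<psi> m) m = P \<phi> m + P \<psi> m"
  unfolding P_def by (simp add: sum.distrib K_add)

lemma P_cmult: "P (\<lambda>m. c * \<phi> m) m = c * P \<phi> m"
  unfolding P_def by (simp add: K_cmult flip: sum_distrib_left)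

lemma P_zero [simp]: "P (\<lambda>_. 0) m = 0" unfolding P_def by simp

lemma P_nonneg: "(\<And>j. j \<le> m \<Longrightarrow> 0 \<le> \<phi> j) \<Longrightarrow> 0 \<le> P \<phi> m"
  using P_mono[of m "\<lambda>_. 0" \<phi>] by simp

lemma P_leaf: "m \<le> s \<Longrightarrow> P \<phi> m = real b * \<phi> 0"
  by (simp add: P_def K_leaf)

lemma P_id: "P real m = (if s < m then real m - real s0 else 0)"
proof (cases "s < m")
  case True
  have "P real m = K (\<lambda>_. real (m - s0)) m"
    unfolding P_def by (intro K_cong) (use True in \<open>simp flip: of_nat_sum\<close>)
  then show ?thesis using True s0_le by simp
qed (simp add: P_leaf)

lemma multinomial_mean_sum:
  "multinomial_mean b m v (\<lambda>x. \<Sum>i\<in>I. \<Phi> i x) = (\<Sum>i\<in>I. multinomial_mean b m v (\<Phi> i))"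
  unfolding multinomial_mean_def by (simp add: sum_distrib_left) (rule sum.swap)

text \<open>
Bounds \<open>P \<phi>\<close> by bounding the conditional mean of \<open>\<phi>\<close> in each child by a function of the weight of
that child alone.
\<close>

lemma P_le_integral:
  fixes f :: "real \<Rightarrow> real"
  assumes m: "s < m" and f [measurable]: "f \<in> borel_measurable borel" and int: "integrable D (\<lambda>v. f (v 0))"
    and le: "\<And>v i. \<forall>i<b. 0 < v i \<and> v i < 1 \<Longrightarrow> (\<Sum>i<b. v i) = 1 \<Longrightarrow> i < b \<Longrightarrow>
      multinomial_mean b (rest m) v (\<lambda>x. \<phi> (x i + s1)) \<le> f (v i)"
  shows "P \<phi> m \<le> real b * (\<integral>v. f (v 0) \<partial>D)"
proof -
  have intf: "integrable D (\<lambda>v. f (v i))" if "i < b" for i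
    using integral_coord(2)[OF that f] int by blast
  have "P \<phi> m = (\<integral>v. (\<Sum>i<b. multinomial_mean b (rest m) v (\<lambda>x. \<phi> (x i + s1))) \<partial>D)"
    unfolding P_def K_internal(1)[OF m] by (simp flip: multinomial_mean_sum)
  also have "\<dots> \<le> (\<integral>v. (\<Sum>i<b. f (v i)) \<partial>D)"
  proof (rule integral_mono_AE)
    show "integrable D (\<lambda>v. \<Sum>i<b. multinomial_mean b (rest m) v (\<lambda>x. \<phi> (x i + s1)))"
      using K_internal(2)[OF m, of "\<lambda>a. \<Sum>i<b. \<phi> (a i)"] by (simp flip: multinomial_mean_sum)
    show "integrable D (\<lambda>v. \<Sum>i<b. f (v i))"
      using intf by (intro Bochner_Integration.integrable_sum) auto
    show "AE v in D. (\<Sum>i<b. multinomial_mean b (rest m) v (\<lambda>x. \<phi> (x i + s1))) \<le> (\<Sum>i<b. f (v i))"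
      using AE_split
    proof eventually_elim
      case (elim v)
      then show ?case by (intro sum_mono le) simp_all
    qed
  qed
  also have "\<dots> = (\<Sum>i<b. \<integral>v. f (v i) \<partial>D)"
    by (rule Bochner_Integration.integral_sum) (use intf in simp)
  also have "\<dots> = (\<Sum>i<b. \<integral>v. f (v 0) \<partial>D)"
  proof (rule sum.cong[OF refl])
    fix i assume "i \<in> {..<b}"
    then show "(\<integral>v. f (v i) \<partial>D) = (\<integral>v. f (v 0) \<partial>D)" 
      by (intro integral_coord(1) f) simp
  qed
  finally show ?thesis by (simp only: sum_constant card_lessThan)
qed

end

section \<open>Moment, entropy and power bounds for one split\<close>

context split_kernel
begin

abbreviation sq :: "nat \<Rightarrow> real" where "sq m \<equiv> (real m)\<^sup>2"

text \<open>
\<open>\<rho>\<close> is the expected sum of the squared weights; \<open>\<rho> < 1\<close> expresses that no child takes everything.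
\<close>

definition \<rho> :: real where "\<rho> = real b * (\<integral>v. (v 0)\<^sup>2 \<partial>D)"

lemma rho_nonneg: "0 \<le> \<rho>" unfolding \<rho>_def by simp

lemma rho_less_1: "\<rho> < 1"
proof -
  have int2: "integrable D (\<lambda>v. (v 0)\<^sup>2)"
    by (rule integrable_coord_bounded[of _ 1]) (auto simp: abs_square_le_1)
  have int1: "integrable D (\<lambda>v. v 0)" 
    using integrable_coord_bounded[of "\<lambda>x. x" 1] by auto
  have "(\<integral>v. (v 0)\<^sup>2 \<partial>D) < (\<integral>v. v 0 \<partial>D)"
  proof (rule D.integral_less_AE_space[OF int2 int1])
    show "AE v in D. (v 0)\<^sup>2 < v 0"
      using AE_coord_0 by eventually_elim (simp add: power2_eq_square)
  qed (simp add: D.emeasure_space_1)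
  then show ?thesis using b_pos by (simp add: \<rho>_def mean_coord field_simps)
qed

text \<open>
An explicit contraction rate for squares.  The first term takes care of the balls that are split
at random, the second one of those that are placed deterministically (\<open>s0\<close> and \<open>s1\<close>).
\<close>

definition \<gamma> :: real where "\<gamma> = min ((1 - \<rho>) / 4) (1 / (8 * (real b)\<^sup>2))"

lemma gamma_pos: "0 < \<gamma>" using rho_less_1 b_pos by (simp add: \<gamma>_def)

lemma gamma_le: "\<gamma> \<le> 1/4" using rho_nonneg by (simp add: \<gamma>_def min_def)

lemma multinomial_mean_shift_sq:
  assumes "(\<Sum>i<b. v i) = 1" "i < b"
  shows "multinomial_mean b k v (\<lambda>x. (real (x i + s1))\<^sup>2) =
    real k * v i + real k * (real k - 1) * (v i)\<^sup>2 + 2 * real s1 * real k * v i + (real s1)\<^sup>2"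
proof -
  have "multinomial_mean b k v (\<lambda>x. (real (x i + s1))\<^sup>2) =
    multinomial_mean b k v (\<lambda>x. (real (x i) ^ 2 + (2 * real s1) * real (x i)) + (real s1)\<^sup>2)"
    by (intro multinomial_mean_cong) (simp add: power2_sum algebra_simps)
  then show ?thesis
    by (simp only: multinomial_mean_add multinomial_mean_cmult multinomial_mean_const[OF assms(1)]
      multinomial_mean_coord[OF assms] multinomial_mean_coord_sq[OF assms])
qed

lemma multinomial_mean_shift:
  assumes "(\<Sum>i<b. v i) = 1" "i < b"
  shows "multinomial_mean b k v (\<lambda>x. real (x i + s1)) = real k * v i + real s1"
  by (simp add: multinomial_mean_add[of b k v "\<lambda>x. real (x i)" "\<lambda>_. real s1"] multinomial_mean_const[OF assms(1)] multinomial_mean_coord[OF assms])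

text \<open>
The elementary inequality behind the contraction, with \<open>k\<close> randomly placed balls and \<open>t\<close>
deterministic ones.  If \<open>k\<close> is at least \<open>2\<close>, the random part alone separates enough balls; if not,
the deterministic part is not empty.
\<close>

lemma gain_bound:
  fixes k t u w B r :: real
  assumes "0 \<le> k" "k = 0 \<or> k = 1 \<or> 2 \<le> k" "0 \<le> u" "0 \<le> w" "1 \<le> B" "t = u + B * w"
    "1 \<le> t \<or> t = 0 \<and> 2 \<le> k" "0 < r" "r \<le> 1"
    and g: "g = min (r / 4) (1 / (8 * B\<^sup>2))"
  shows "g * (k + t)\<^sup>2 \<le> r * (k * (k - 1)) + u\<^sup>2 + w\<^sup>2"
proof -
  have g1: "g \<le> r / 4" and g2: "g \<le> 1 / (8 * B\<^sup>2)" unfolding g by auto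
  have g0: "0 \<le> g" unfolding g using assms by simp
  have B2: "1 \<le> B\<^sup>2" using assms by simp
  have "t\<^sup>2 \<le> 2 * u\<^sup>2 + 2 * (B * w)\<^sup>2" unfolding \<open>t = _\<close>
    using sum_squares_bound[of u "B * w"] by (simp add: power2_sum)
  also have "\<dots> \<le> 2 * B\<^sup>2 * (u\<^sup>2 + w\<^sup>2)"
    using mult_right_mono[OF B2, of "u\<^sup>2"] by (simp add: power_mult_distrib algebra_simps)
  finally have t2: "t\<^sup>2 \<le> 2 * B\<^sup>2 * (u\<^sup>2 + w\<^sup>2)" .
  have gt: "g * (4 * t\<^sup>2) \<le> u\<^sup>2 + w\<^sup>2"
  proof -
    have "g * (4 * t\<^sup>2) \<le> (1 / (8 * B\<^sup>2)) * (4 * (2 * B\<^sup>2 * (u\<^sup>2 + w\<^sup>2)))"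
      using g2 t2 B2 by (intro mult_mono) auto
    also have "\<dots> = u\<^sup>2 + w\<^sup>2" using B2 by (auto simp: divide_simps)
    finally show ?thesis .
  qed
  show ?thesis
  proof (cases "2 \<le> k")
    case True
    have "(k + t)\<^sup>2 \<le> 2 * k\<^sup>2 + 2 * t\<^sup>2" 
      using sum_squares_bound[of k t] by (simp add: power2_sum)
    then have "g * (k + t)\<^sup>2 \<le> g * (2 * k\<^sup>2 + 2 * t\<^sup>2)" using g0 by (rule mult_left_mono)
    also have "\<dots> = 2 * (g * k\<^sup>2) + g * (2 * t\<^sup>2)" by (simp add: algebra_simps)
    also have "g * k\<^sup>2 \<le> r / 4 * k\<^sup>2" using g1 by (intro mult_right_mono) auto
    also have "r / 4 * k\<^sup>2 \<le> r / 4 * (2 * (k * (k - 1)))"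
      using True assms by (intro mult_left_mono) (auto simp: power2_eq_square algebra_simps)
    also have "g * (2 * t\<^sup>2) \<le> g * (4 * t\<^sup>2)" using g0 by (intro mult_left_mono) auto
    also note gt
    finally show ?thesis by (simp add: algebra_simps)
  next
    case False
    then have t1: "1 \<le> t" "k \<le> t" "k * (k - 1) = 0" using assms by auto
    then have "(k + t)\<^sup>2 \<le> (2 * t)\<^sup>2" using assms by (intro power_mono) auto
    then have "g * (k + t)\<^sup>2 \<le> g * (4 * t\<^sup>2)" using g0 by (intro mult_left_mono) (auto simp: power2_eq_square)
    then have "g * (k + t)\<^sup>2 \<le> u\<^sup>2 + w\<^sup>2" using gt by linarith
    moreover have "r * (k * (k - 1)) = 0" by (simp only: t1(3) mult_zero_right)
    ultimately show ?thesis by linarith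
  qed
qed

text \<open>
Squares contract at every size.  For large \<open>m\<close> this is \<open>\<rho> < 1\<close>; for small \<open>m\<close> it says that some ball
is stored or some pair of balls is separated with positive probability.  In particular it
excludes infinite paths when \<open>s0 = s1 = 0\<close>.
\<close>

lemma P_sq_le: "P sq m \<le> (1 - \<gamma>) * sq m"
proof (cases "s < m")
  case False
  then show ?thesis using gamma_le by (simp add: P_leaf)
next
  case True
  let ?k = "real (rest m)"
  let ?f = "\<lambda>x::real. ?k * x + ?k * (?k - 1) * x\<^sup>2 + 2 * real s1 * ?k * x + (real s1)\<^sup>2"
  have int2: "integrable D (\<lambda>v. (v 0)\<^sup>2)"
    by (rule integrable_coord_bounded[of _ 1]) (auto simp: abs_square_le_1)
  have int1: "integrable D (\<lambda>v. v 0)" 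
    using integrable_coord_bounded[of "\<lambda>x. x" 1] by auto
  have "P sq m \<le> real b * (\<integral>v. ?f (v 0) \<partial>D)"
  proof (rule P_le_integral[OF True])
    show "integrable D (\<lambda>v. ?f (v 0))" using int1 int2 by auto
  qed (auto simp: multinomial_mean_shift_sq simp del: of_nat_add)
  also have "(\<integral>v. ?f (v 0) \<partial>D) = ?k * (1 / b) + ?k * (?k - 1) * (\<integral>v. (v 0)\<^sup>2 \<partial>D)
      + 2 * real s1 * ?k * (1 / b) + (real s1)\<^sup>2"
    using int1 int2 D.prob_space by (simp add: mean_coord)
  also have "real b * \<dots> = ?k + ?k * (?k - 1) * \<rho> + 2 * s1 * ?k + b * (real s1)\<^sup>2"
    using b_pos unfolding \<rho>_def by (simp add: algebra_simps)
  finally have P: "P sq m \<le> ?k + ?k * (?k - 1) * \<rho> + 2 * s1 * ?k + b * (real s1)\<^sup>2" .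
  have m: "real m = ?k + (real s0 + real b * real s1)"
    using fits[OF True] by (metis (no_types, lifting) add.commute diff_diff_left le_add_diff_inverse2
        of_nat_add of_nat_mult)
  have "\<gamma> * (?k + (real s0 + real b * real s1))\<^sup>2 \<le> (1 - \<rho>) * (?k * (?k - 1)) + (real s0)\<^sup>2 + (real s1)\<^sup>2"
  proof (rule gain_bound[where B = "real b"])
    show "?k = 0 \<or> ?k = 1 \<or> 2 \<le> ?k"
      by (metis One_nat_def Suc_1 le_less_Suc_eq less_2_cases_iff linorder_not_le of_nat_0 of_nat_1 of_nat_le_iff of_nat_numeral)
    show "1 \<le> real s0 + real b * real s1 \<or> real s0 + real b * real s1 = 0 \<and> 2 \<le> ?k"
    proof (cases "s0 + b * s1 = 0")
      case False
      then have "1 \<le> s0 + b * s1" by linarith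
      then have "1 \<le> real (s0 + b * s1)" by linarith
      then show ?thesis by simp
    next
      case True
      then show ?thesis using \<open>s < m\<close> s_pos b_pos by auto
    qed
  qed (use rho_less_1 rho_nonneg b_ge_2 in \<open>auto simp: \<gamma>_def\<close>)
  then have "\<gamma> * sq m \<le> (1 - \<rho>) * (?k * (?k - 1)) + (real s0)\<^sup>2 + (real s1)\<^sup>2" using m by simp
  moreover have "sq m = ?k\<^sup>2 + (real s0)\<^sup>2 + (real b * real s1)\<^sup>2 + 2 * ?k * real s0 + 2 * ?k * (real b * real s1)
      + 2 * real s0 * (real b * real s1)" unfolding m by (simp add: power2_eq_square algebra_simps)
  moreover have "2 * ?k * (real b * real s1) \<ge> 2 * (2 * real s1 * ?k)"
    using mult_right_mono[of 2 "real b" "real s1 * ?k"] b_ge_2 by (simp add: algebra_simps)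
  moreover have "(real b * real s1)\<^sup>2 \<ge> b * (real s1)\<^sup>2 + (real s1)\<^sup>2"
  proof -
    have "2 * real b \<le> real b * real b" using b_ge_2 by (intro mult_right_mono) auto
    moreover have "real b + 1 \<le> 2 * real b" using b_ge_2 by simp
    ultimately have "real b + 1 \<le> (real b)\<^sup>2" unfolding power2_eq_square by linarith
    then have "(real b + 1) * (real s1)\<^sup>2 \<le> (real b)\<^sup>2 * (real s1)\<^sup>2" by (intro mult_right_mono) auto
    then show ?thesis by (simp add: power_mult_distrib algebra_simps)
  qed
  moreover have "0 \<le> 2 * ?k * real s0" "0 \<le> 2 * real s0 * (real b * real s1)" "0 \<le> real s1 * ?k" by simp_all
  moreover have "(1 - \<rho>) * (?k * (?k - 1)) = ?k\<^sup>2 - ?k - ?k * (?k - 1) * \<rho>"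
    by (simp add: power2_eq_square algebra_simps)
  ultimately have "?k + ?k * (?k - 1) * \<rho> + 2 * s1 * ?k + b * (real s1)\<^sup>2 \<le> sq m - \<gamma> * sq m"
    by linarith
  then show ?thesis using P by (simp add: algebra_simps)
qed


definition \<mu> :: real where "\<mu> = split_mu b D"

lemma integrable_xlnx: "integrable D (\<lambda>v. v 0 * ln (v 0))"
proof (rule integrable_coord_bounded[of "\<lambda>x. x * ln x" 1])
  fix x :: real assume x: "0 < x" "x < 1"
  have "- ln x \<le> 1 / x - 1" using x ln_le_minus_one[of "1/x"] by (simp add: ln_div)
  then have "x * (- ln x) \<le> x * (1 / x - 1)" using x by (intro mult_left_mono) auto
  also have "\<dots> \<le> 1" using x by (simp add: algebra_simps)
  finally show "\<bar>x * ln x\<bar> \<le> 1" using x by (simp add: abs_mult ln_less_zero)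
qed simp

lemma mu_eq: "\<mu> = - real b * (\<integral>v. v 0 * ln (v 0) \<partial>D)"
  by (simp add: \<mu>_def split_mu_def)

lemma mu_pos: "0 < \<mu>"
proof -
  have "(\<integral>v. v 0 * ln (v 0) \<partial>D) < (\<integral>v. 0 \<partial>D)"
  proof (rule D.integral_less_AE_space[OF integrable_xlnx])
    show "AE v in D. v 0 * ln (v 0) < 0"
      using AE_coord_0 by eventually_elim (simp add: mult_pos_neg)
  qed (simp_all add: D.emeasure_space_1)
  then show ?thesis using b_pos by (simp add: mu_eq mult_pos_neg)
qed

definition xlnx :: "nat \<Rightarrow> real" where "xlnx m = real m * ln (real m)"

text \<open>
The shift \<open>C / m\<close> inside the logarithm stems from the discreteness of the balls; it disappears in the
limit by dominated convergence.
\<close>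

lemma shifted_entropy_tendsto:
  assumes C: "1 \<le> C"
  shows "(\<lambda>m. \<integral>v. v 0 * ln (v 0 + C / real m) \<partial>D) \<longlonglongrightarrow> (\<integral>v. v 0 * ln (v 0) \<partial>D)"
    and "0 < m \<Longrightarrow> integrable D (\<lambda>v. v 0 * ln (v 0 + C / real m))"
proof -
  have bound: "\<bar>x * ln (x + C / real m)\<bar> \<le> 1 + ln (1 + C)" if x: "0 < x" "x < 1" and m: "0 < m" for x m
  proof -
    have t: "0 < C / real m" "C / real m \<le> C" using C m by (auto simp: divide_le_eq)
    have "- ln x \<le> 1 / x - 1" using x ln_le_minus_one[of "1/x"] by (simp add: ln_div)
    then have "x * (- ln x) \<le> x * (1 / x - 1)" using x by (intro mult_left_mono) auto
    also have "\<dots> \<le> 1" using x by (simp add: algebra_simps)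
    finally have "- 1 \<le> x * ln x" by simp
    also have "\<dots> \<le> x * ln (x + C / real m)" using x t by (intro mult_left_mono) auto
    finally have lo: "- 1 \<le> x * ln (x + C / real m)" .
    have "x * ln (x + C / real m) \<le> x * ln (1 + C)" using x t by (intro mult_left_mono) auto
    also have "\<dots> \<le> 1 * ln (1 + C)" using x C by (intro mult_right_mono) auto
    finally have "x * ln (x + C / real m) \<le> ln (1 + C)" by simp
    moreover have "0 \<le> ln (1 + C)" using C by simp
    ultimately show ?thesis using lo by linarith
  qed
  show "0 < m \<Longrightarrow> integrable D (\<lambda>v. v 0 * ln (v 0 + C / real m))"
    by (rule integrable_coord_bounded[of "\<lambda>x. x * ln (x + C / real m)"]) (auto intro: bound)
  have [measurable]: "(\<lambda>v. v 0) \<in> borel_measurable D" using b_pos by simp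
  have "(\<lambda>m. \<integral>v. v 0 * ln (v 0 + C / real (Suc m)) \<partial>D) \<longlonglongrightarrow> (\<integral>v. v 0 * ln (v 0) \<partial>D)"
  proof (rule integral_dominated_convergence[where w = "\<lambda>_. 1 + ln (1 + C)"])
    show "AE v in D. (\<lambda>m. v 0 * ln (v 0 + C / real (Suc m))) \<longlonglongrightarrow> v 0 * ln (v 0)"
      using AE_coord_0
    proof eventually_elim
      case (elim v)
      have "(\<lambda>m. C / real (Suc m)) \<longlonglongrightarrow> 0" by real_asymp
      then have "(\<lambda>m. v 0 * ln (v 0 + C / real (Suc m))) \<longlonglongrightarrow> v 0 * ln (v 0 + 0)"
        using elim by (intro tendsto_intros) auto
      then show ?case by simp
    qed
    show "AE v in D. norm (v 0 * ln (v 0 + C / real (Suc m))) \<le> 1 + ln (1 + C)" for m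
      using AE_coord_0
    proof eventually_elim
      case (elim v)
      then show ?case using bound[of "v 0" "Suc m"] by (simp del: of_nat_Suc)
    qed
  qed auto
  then show "(\<lambda>m. \<integral>v. v 0 * ln (v 0 + C / real m) \<partial>D) \<longlonglongrightarrow> (\<integral>v. v 0 * ln (v 0) \<partial>D)"
    by (subst (asm) filterlim_sequentially_Suc)
qed

text \<open>
Jensen's inequality for the size-biased count \<open>Y\<close>: the tangent of \<open>ln\<close> at \<open>A\<close> gives
\<open>Y ln Y \<le> Y ln A + Y\<^sup>2 / A - Y\<close>, and the last two terms cancel in mean because
\<open>E Y\<^sup>2 \<le> E Y (E Y + 1)\<close>.
\<close>

lemma multinomial_mean_xlnx:
  assumes v: "\<forall>i<b. 0 < v i \<and> v i < 1" "(\<Sum>i<b. v i) = 1" "i < b" and km: "k \<le> m" "0 < m"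
  shows "multinomial_mean b k v (\<lambda>x. xlnx (x i + s1))
    \<le> (real m * v i + real s1) * ln (real m * v i + (real s1 + 1))"
proof -
  define A where "A = real m * v i + (real s1 + 1)"
  have vi: "0 < v i" using v by auto
  have A: "1 \<le> A" unfolding A_def using vi by simp
  let ?E = "real k * v i + real s1"
  have EA: "?E + 1 \<le> A" unfolding A_def using vi km by (auto intro!: mult_right_mono)
  have tangent: "xlnx (y + s1) \<le> ln A * real (y + s1) + (1 / A * (real (y + s1))\<^sup>2 + (-1) * real (y + s1))" for y :: nat
  proof (cases "y + s1 = 0")
    case False
    let ?y = "real (y + s1)"
    have "0 < ?y" using False by (simp del: of_nat_add)
    then have "ln (?y / A) \<le> ?y / A - 1" using A by (intro ln_le_minus_one) (simp del: of_nat_add)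
    then have "?y * ln ?y \<le> ?y * (ln A + ?y / A - 1)"
      using A \<open>0 < ?y\<close> by (intro mult_left_mono) (simp_all add: ln_div del: of_nat_add)
    then show ?thesis unfolding xlnx_def by (simp add: algebra_simps power2_eq_square del: of_nat_add)
  qed (simp add: xlnx_def)
  have "multinomial_mean b k v (\<lambda>x. xlnx (x i + s1)) \<le> multinomial_mean b k v
      (\<lambda>x. ln A * real (x i + s1) + (1 / A * (real (x i + s1))\<^sup>2 + (-1) * real (x i + s1)))"
    using v by (intro multinomial_mean_mono tangent) (auto intro: less_imp_le)
  also have "\<dots> = ln A * ?E + (1 / A * (real k * v i + real k * (real k - 1) * (v i)\<^sup>2 + 2 * real s1 * real k * v i + (real s1)\<^sup>2)
       + (-1) * ?E)"
    by (simp only: multinomial_mean_add multinomial_mean_cmult multinomial_mean_shift[OF v(2,3)]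
        multinomial_mean_shift_sq[OF v(2,3)])
  also have "real k * v i + real k * (real k - 1) * (v i)\<^sup>2 + 2 * real s1 * real k * v i + (real s1)\<^sup>2 \<le> ?E * (?E + 1)"
  proof -
    have "0 \<le> real k * (v i)\<^sup>2" by simp
    moreover have "0 \<le> real s1" by simp
    ultimately show ?thesis unfolding power2_eq_square by (simp add: algebra_simps)
  qed
  also have "?E * (?E + 1) \<le> ?E * A" using vi EA by (intro mult_left_mono) auto
  finally have "multinomial_mean b k v (\<lambda>x. xlnx (x i + s1)) \<le> ln A * ?E + (1 / A * (?E * A) + (-1) * ?E)"
    using A by (simp add: divide_right_mono mult_left_mono)
  also have "\<dots> = ?E * ln A" using A by simp
  also have "\<dots> \<le> (real m * v i + real s1) * ln A"
    using vi km A by (intro mult_right_mono) (auto intro!: mult_right_mono)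
  finally show ?thesis unfolding A_def .
qed

text \<open>
The entropy of a split: a ball loses \<open>\<mu>\<close> in the logarithm of the size of its sub-tree per
generation.
\<close>

lemma P_xlnx_le:
  fixes \<eta> :: real
  assumes \<eta>: "0 < \<eta>"
  shows "\<forall>\<^sub>F m in sequentially. P xlnx m \<le> xlnx m - \<mu> * m + \<eta> * m"
proof -
  define C where "C = real s1 + 1"
  have C: "1 \<le> C" by (simp add: C_def)
  let ?I = "\<lambda>m. \<integral>v. v 0 * ln (v 0 + C / real m) \<partial>D"
  have int1: "integrable D (\<lambda>v. v 0)" 
    using integrable_coord_bounded[of "\<lambda>x. x" 1] by auto
  have bound: "P xlnx m \<le> xlnx m + real m * (real b * ?I m) + real b * real s1 * ln (real m + C)"
    if m: "s < m" for m
  proof -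
    have m0: "0 < m" using m by simp
    let ?f = "\<lambda>x. real m * ln (real m) * x + real m * (x * ln (x + C / real m)) + real s1 * ln (real m + C)"
    have "P xlnx m \<le> real b * (\<integral>v. ?f (v 0) \<partial>D)"
    proof (rule P_le_integral[OF m])
      show "integrable D (\<lambda>v. ?f (v 0))"
        using int1 shifted_entropy_tendsto(2)[OF C m0] by auto
      fix v :: "nat \<Rightarrow> real" and i assume v: "\<forall>i<b. 0 < v i \<and> v i < 1" "(\<Sum>i<b. v i) = 1" "i < b"
      have vi: "0 < v i" "v i < 1" using v by auto
      have "multinomial_mean b (rest m) v (\<lambda>x. xlnx (x i + s1))
        \<le> (real m * v i + real s1) * ln (real m * v i + C)"
        unfolding C_def using m0 by (intro multinomial_mean_xlnx v) auto
      also have "\<dots> = real m * v i * ln (real m * v i + C) + real s1 * ln (real m * v i + C)"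
        by (simp add: algebra_simps)
      also have "real s1 * ln (real m * v i + C) \<le> real s1 * ln (real m + C)"
        using m0 vi C by (intro mult_left_mono) (auto intro!: ln_mono add_pos_nonneg)
      also have "ln (real m * v i + C) = ln (real m * (v i + C / real m))"
        using m0 by (simp add: algebra_simps)
      also have "\<dots> = ln (real m) + ln (v i + C / real m)"
        using m0 vi C by (intro ln_mult_pos) (auto intro!: add_pos_nonneg)
      finally show "multinomial_mean b (rest m) v (\<lambda>x. xlnx (x i + s1)) \<le> ?f (v i)"
        by (simp add: algebra_simps)
    qed simp
    also have "(\<integral>v. ?f (v 0) \<partial>D) = real m * ln (real m) * (1 / b) + real m * ?I m + real s1 * ln (real m + C)"
      using int1 shifted_entropy_tendsto(2)[OF C m0] D.prob_space by (simp add: mean_coord)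
    also have "real b * \<dots> = xlnx m + real m * (real b * ?I m) + real b * real s1 * ln (real m + C)"
      using b_pos by (simp add: xlnx_def algebra_simps)
    finally show ?thesis .
  qed
  have "(\<lambda>m. real b * ?I m + real b * real s1 * (ln (real m + C) / real m)) \<longlonglongrightarrow> 
     real b * (\<integral>v. v 0 * ln (v 0) \<partial>D) + real b * real s1 * 0"
    by (intro tendsto_intros shifted_entropy_tendsto C) (use C in real_asymp)
  then have "\<forall>\<^sub>F m in sequentially. real b * ?I m + real b * real s1 * (ln (real m + C) / real m) < - \<mu> + \<eta>"
    by (rule order_tendstoD) (use \<eta> in \<open>simp add: mu_eq\<close>)
  then show ?thesis using eventually_gt_at_top[of s]
  proof eventually_elim
    case (elim m)
    have "real m * (real b * ?I m + real b * real s1 * (ln (real m + C) / real m)) \<le> real m * (- \<mu> + \<eta>)"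
      using elim by (intro mult_left_mono) auto
    moreover have "real m * (real b * ?I m + real b * real s1 * (ln (real m + C) / real m)) =
      real m * (real b * ?I m) + real b * real s1 * ln (real m + C)" using elim by (simp add: field_simps)
    ultimately show ?case using bound[OF elim(2)] by (simp add: algebra_simps)
  qed
qed

text \<open>
Jensen's inequality for a concave power; the additive error comes from the \<open>s1\<close> balls given to each
child.
\<close>

lemma P_powr_le:
  assumes \<beta>: "0 < \<beta>" "\<beta> \<le> 1" and m: "s < m"
  shows "P (\<lambda>m. real m powr \<beta>) m \<le> real m powr \<beta> * (real b * (\<integral>v. v 0 powr \<beta> \<partial>D)) + real b * real s1"
proof -
  have m0: "0 < m" using m by simp
  have int: "integrable D (\<lambda>v. v 0 powr \<beta>)"
    by (rule integrable_coord_bounded[of "\<lambda>x. x powr \<beta>" 1]) (use \<beta> in \<open>auto simp: powr_le1\<close>)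
  let ?f = "\<lambda>x. real m powr \<beta> * x powr \<beta> + real s1"
  have "P (\<lambda>m. real m powr \<beta>) m \<le> real b * (\<integral>v. ?f (v 0) \<partial>D)"
  proof (rule P_le_integral[OF m])
    show "integrable D (\<lambda>v. ?f (v 0))" using int by auto
    fix v :: "nat \<Rightarrow> real" and i assume v: "\<forall>i<b. 0 < v i \<and> v i < 1" "(\<Sum>i<b. v i) = 1" "i < b"
    have vi: "0 < v i" "v i < 1" using v by auto
    define A where "A = real m * v i + real s1"
    have A: "0 < A" unfolding A_def using m0 vi by (auto intro: add_pos_nonneg)
    let ?c = "\<beta> * A powr (\<beta> - 1)"
    have "multinomial_mean b (rest m) v (\<lambda>x. real (x i + s1) powr \<beta>) \<le>
      multinomial_mean b (rest m) v (\<lambda>x. ?c * real (x i + s1) + (A powr \<beta> - ?c * A))"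
    proof (rule multinomial_mean_mono)
      fix x :: "nat \<Rightarrow> nat"
      show "real (x i + s1) powr \<beta> \<le> ?c * real (x i + s1) + (A powr \<beta> - ?c * A)"
        using powr_le_tangent[OF A of_nat_0_le_iff \<beta>, of "x i + s1"] by (simp add: right_diff_distrib del: of_nat_add)
    qed (use v in \<open>auto intro: less_imp_le\<close>)
    also have "\<dots> = ?c * (real (rest m) * v i + real s1) + (A powr \<beta> - ?c * A)"
      by (simp only: multinomial_mean_add multinomial_mean_cmult multinomial_mean_shift[OF v(2,3)]
        multinomial_mean_const[OF v(2)])
    also have "\<dots> \<le> ?c * A + (A powr \<beta> - ?c * A)"
      unfolding A_def using vi \<beta> by (intro add_right_mono mult_left_mono mult_right_mono) auto
    also have "\<dots> = A powr \<beta>" by simp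
    also have "\<dots> \<le> (real m * v i) powr \<beta> + real s1 powr \<beta>"
    proof (cases "s1 = 0")
      case False
      have "A powr \<beta> = A * A powr (\<beta> - 1)" using A by (simp add: powr_diff)
      also have "\<dots> = (real m * v i) * A powr (\<beta> - 1) + real s1 * A powr (\<beta> - 1)"
        by (simp add: A_def algebra_simps)
      also have "\<dots> \<le> (real m * v i) * (real m * v i) powr (\<beta> - 1) + real s1 * real s1 powr (\<beta> - 1)"
        using vi m0 False \<beta> by (intro add_mono mult_left_mono powr_mono2') (auto simp: A_def)
      also have "\<dots> = (real m * v i) powr \<beta> + real s1 powr \<beta>"
        using vi m0 False by (simp add: powr_diff)
      finally show ?thesis .
    qed (simp add: A_def)
    also have "real s1 powr \<beta> \<le> real s1"
    proof (cases "s1 = 0")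
      case False
      then have "real s1 powr \<beta> \<le> real s1 powr 1" using \<beta> by (intro powr_mono) auto
      then show ?thesis by simp
    qed simp
    finally show "multinomial_mean b (rest m) v (\<lambda>x. real (x i + s1) powr \<beta>) \<le> ?f (v i)"
      using vi by (simp add: powr_mult)
  qed simp
  also have "(\<integral>v. ?f (v 0) \<partial>D) = real m powr \<beta> * (\<integral>v. v 0 powr \<beta> \<partial>D) + real s1"
    using int D.prob_space by simp
  finally show ?thesis by (simp add: algebra_simps)
qed


text \<open>
One half of the first-order expansion \<open>b E (V powr (1 - \<theta>)) = 1 + \<theta> \<mu> + o(\<theta>)\<close>.  The quotient
\<open>(V powr (1 - \<theta>) - V) / \<theta>\<close> is at most \<open>- ln V * V powr (1 - \<theta>)\<close>, which increases with \<open>\<theta>\<close>, so a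
single small \<open>\<theta>0\<close> serves all smaller \<open>\<theta>\<close>.
\<close>

lemma moment_le:
  assumes \<eta>: "0 < \<eta>"
  shows "\<exists>\<theta>0>0. \<theta>0 \<le> 1/2 \<and> (\<forall>\<theta>. 0 < \<theta> \<longrightarrow> \<theta> \<le> \<theta>0 \<longrightarrow>
    real b * (\<integral>v. v 0 powr (1 - \<theta>) \<partial>D) \<le> 1 + \<theta> * (\<mu> + \<eta>))"
proof -
  have int1: "integrable D (\<lambda>v. v 0)" 
    using integrable_coord_bounded[of "\<lambda>x. x" 1] by auto
  have [measurable]: "(\<lambda>v. v 0) \<in> borel_measurable D" using b_pos by simp
  have bound: "\<bar>- ln x * x powr (1 - \<theta>)\<bar> \<le> 2" if "0 < x" "x < 1" "\<theta> \<le> 1/2" for x \<theta> :: real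
  proof -
    have "- ln x = 2 * ln (x powr (-1/2))" using that by (simp add: ln_powr)
    also have "\<dots> \<le> 2 * (x powr (-1/2))"
      using ln_le_minus_one[of "x powr (-1/2)"] that by simp
    finally have "- ln x * x powr (1 - \<theta>) \<le> 2 * x powr (-1/2) * x powr (1 - \<theta>)"
      by (intro mult_right_mono) auto
    also have "\<dots> = 2 * x powr (1/2 - \<theta>)" by (simp flip: powr_add)
    also have "\<dots> \<le> 2" using that by (simp add: powr_le1)
    finally show ?thesis using that by (simp add: abs_mult)
  qed
  have int2: "integrable D (\<lambda>v. - ln (v 0) * v 0 powr (1 - \<theta>))" if "\<theta> \<le> 1/2" for \<theta>
    by (rule integrable_coord_bounded[of "\<lambda>x. - ln x * x powr (1 - \<theta>)" 2]) (use bound that in auto)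
  have "(\<lambda>k. \<integral>v. - ln (v 0) * v 0 powr (1 - 1 / (real k + 2)) \<partial>D) \<longlonglongrightarrow> (\<integral>v. - (v 0 * ln (v 0)) \<partial>D)"
  proof (rule integral_dominated_convergence[where w = "\<lambda>_. 2"])
    show "AE v in D. (\<lambda>k. - ln (v 0) * v 0 powr (1 - 1 / (real k + 2))) \<longlonglongrightarrow> - (v 0 * ln (v 0))"
      using AE_coord_0
    proof eventually_elim
      case (elim v)
      have "(\<lambda>k. 1 - 1 / (real k + 2)) \<longlonglongrightarrow> 1" by real_asymp
      then have "(\<lambda>k. - ln (v 0) * v 0 powr (1 - 1 / (real k + 2))) \<longlonglongrightarrow> - ln (v 0) * v 0 powr 1"
        using elim by (intro tendsto_intros) auto
      then show ?case using elim by (simp add: mult.commute)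
    qed
    show "AE v in D. norm (- ln (v 0) * v 0 powr (1 - 1 / (real k + 2))) \<le> 2" for k
      using AE_coord_0
    proof eventually_elim
      case (elim v)
      then show ?case using bound[of "v 0" "1 / (real k + 2)"] by (simp add: field_simps)
    qed
  qed auto
  then have "(\<lambda>k. real b * (\<integral>v. - ln (v 0) * v 0 powr (1 - 1 / (real k + 2)) \<partial>D)) \<longlonglongrightarrow> \<mu>"
    unfolding mu_eq by (auto dest: tendsto_mult_left[of _ _ _ "real b"])
  then have "\<forall>\<^sub>F k in sequentially. real b * (\<integral>v. - ln (v 0) * v 0 powr (1 - 1 / (real k + 2)) \<partial>D) < \<mu> + \<eta>"
    by (rule order_tendstoD) (use \<eta> in simp)
  then obtain k where k: "real b * (\<integral>v. - ln (v 0) * v 0 powr (1 - 1 / (real k + 2)) \<partial>D) < \<mu> + \<eta>"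
    by (auto simp: eventually_sequentially)
  define \<theta>0 where "\<theta>0 = 1 / (real k + 2)"
  have \<theta>0: "0 < \<theta>0" "\<theta>0 \<le> 1/2" by (auto simp: \<theta>0_def field_simps)
  have "real b * (\<integral>v. v 0 powr (1 - \<theta>) \<partial>D) \<le> 1 + \<theta> * (\<mu> + \<eta>)" if \<theta>: "0 < \<theta>" "\<theta> \<le> \<theta>0" for \<theta>
  proof -
    have int3: "integrable D (\<lambda>v. v 0 powr (1 - \<theta>))"
      by (rule integrable_coord_bounded[of "\<lambda>x. x powr (1 - \<theta>)" 1]) (use \<theta> \<theta>0 in \<open>auto simp: powr_le1\<close>)
    have "(\<integral>v. v 0 powr (1 - \<theta>) \<partial>D) \<le> (\<integral>v. v 0 + \<theta> * (- ln (v 0) * v 0 powr (1 - \<theta>0)) \<partial>D)"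
    proof (rule integral_mono_AE[OF int3])
      show "integrable D (\<lambda>v. v 0 + \<theta> * (- ln (v 0) * v 0 powr (1 - \<theta>0)))"
        using int1 int2[OF \<theta>0(2)] by (intro Bochner_Integration.integrable_add integrable_mult_right) auto
      show "AE v in D. v 0 powr (1 - \<theta>) \<le> v 0 + \<theta> * (- ln (v 0) * v 0 powr (1 - \<theta>0))"
        using AE_coord_0
      proof eventually_elim
        case (elim v)
        let ?x = "v 0"
        have "1 + \<theta> * ln ?x \<le> ?x powr \<theta>"
          using elim exp_ge_add_one_self[of "\<theta> * ln ?x"] by (simp add: powr_def)
        then have "?x powr (1 - \<theta>) * (1 + \<theta> * ln ?x) \<le> ?x powr (1 - \<theta>) * ?x powr \<theta>"
          by (intro mult_left_mono) auto
        also have "\<dots> = ?x" using elim by (simp flip: powr_add)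
        finally have "?x powr (1 - \<theta>) \<le> ?x + \<theta> * (- ln ?x * ?x powr (1 - \<theta>))" by (simp add: algebra_simps)
        also have "\<theta> * (- ln ?x * ?x powr (1 - \<theta>)) \<le> \<theta> * (- ln ?x * ?x powr (1 - \<theta>0))"
          using elim \<theta> by (intro mult_left_mono powr_mono') (auto simp: )
        finally show ?case by simp
      qed
    qed
    also have "\<dots> = 1 / real b + \<theta> * (\<integral>v. - ln (v 0) * v 0 powr (1 - \<theta>0) \<partial>D)"
      using int1 int2[OF \<theta>0(2)] by (subst Bochner_Integration.integral_add) (auto simp: mean_coord)
    finally have "real b * (\<integral>v. v 0 powr (1 - \<theta>) \<partial>D) \<le>
        real b * (1 / real b + \<theta> * (\<integral>v. - ln (v 0) * v 0 powr (1 - \<theta>0) \<partial>D))"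
      by (rule mult_left_mono) simp
    also have "\<dots> = 1 + \<theta> * (real b * (\<integral>v. - ln (v 0) * v 0 powr (1 - \<theta>0) \<partial>D))"
      using b_pos by (simp add: algebra_simps)
    also have "\<dots> \<le> 1 + \<theta> * (\<mu> + \<eta>)"
      using k \<theta> unfolding \<theta>0_def by (intro add_left_mono mult_left_mono) auto
    finally show ?thesis .
  qed
  then show ?thesis using \<theta>0 by blast
qed

end

section \<open>Potentials of the kernel\<close>

context split_kernel
begin

lemma P_suminf:
  assumes "\<And>j. j \<le> m \<Longrightarrow> summable (\<lambda>k. f k j)"
  shows "summable (\<lambda>k. P (f k) m)" and "P (\<lambda>j. \<Sum>k. f k j) m = (\<Sum>k. P (f k) m)"
proof -
  have s: "summable (\<lambda>k. children_law m a * (\<Sum>i<b. f k (a i)))" if "a \<in> profiles b m" for a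
    using that by (intro summable_mult summable_sum assms) auto
  show "summable (\<lambda>k. P (f k) m)"
    unfolding P_def K_def by (intro summable_sum s)
  have "P (\<lambda>j. \<Sum>k. f k j) m = (\<Sum>a\<in>profiles b m. \<Sum>k. children_law m a * (\<Sum>i<b. f k (a i)))"
    unfolding P_def K_def
  proof (intro sum.cong refl)
    fix a assume a: "a \<in> profiles b m"
    have "(\<Sum>i<b. \<Sum>k. f k (a i)) = (\<Sum>k. \<Sum>i<b. f k (a i))"
      using a by (intro suminf_sum[symmetric] assms) auto
    moreover have "summable (\<lambda>k. \<Sum>i<b. f k (a i))"
      using a by (intro summable_sum assms) auto
    ultimately show "children_law m a * (\<Sum>i<b. \<Sum>k. f k (a i)) = (\<Sum>k. children_law m a * (\<Sum>i<b. f k (a i)))"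
      by (simp add: suminf_mult)
  qed
  also have "\<dots> = (\<Sum>k. P (f k) m)"
    unfolding P_def K_def by (intro suminf_sum[symmetric] s)
  finally show "P (\<lambda>j. \<Sum>k. f k j) m = (\<Sum>k. P (f k) m)" .
qed

lemma P_abs: "\<bar>P \<phi> m\<bar> \<le> P (\<lambda>j. \<bar>\<phi> j\<bar>) m"
proof -
  have "P \<phi> m \<le> P (\<lambda>j. \<bar>\<phi> j\<bar>) m" by (intro P_mono) auto
  moreover have "P (\<lambda>j. - 1 * \<phi> j) m \<le> P (\<lambda>j. \<bar>\<phi> j\<bar>) m" by (intro P_mono) auto
  ultimately show ?thesis unfolding P_cmult by auto
qed

lemma Pk_mono: "(\<And>j. j \<le> m \<Longrightarrow> \<phi> j \<le> \<psi> j) \<Longrightarrow> (P ^^ k) \<phi> m \<le> (P ^^ k) \<psi> m"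
proof (induction k arbitrary: m)
  case (Suc k)
  then show ?case by (auto intro!: P_mono)
qed simp

lemma Pk_add: "(P ^^ k) (\<lambda>j. \<phi> j + \<psi> j) = (\<lambda>m. (P ^^ k) \<phi> m + (P ^^ k) \<psi> m)"
  by (induction k; intro ext) (simp_all add: P_add)

lemma Pk_cmult: "(P ^^ k) (\<lambda>j. c * \<phi> j) = (\<lambda>m. c * (P ^^ k) \<phi> m)"
  by (induction k; intro ext) (simp_all add: P_cmult)

lemma Pk_zero: "(P ^^ k) (\<lambda>_. 0) = (\<lambda>_. 0)"
  by (induction k; intro ext) simp_all

lemma Pk_nonneg: "(\<And>j. j \<le> m \<Longrightarrow> 0 \<le> \<phi> j) \<Longrightarrow> 0 \<le> (P ^^ k) \<phi> m"
  using Pk_mono[of m "\<lambda>_. 0" \<phi> k] by (simp add: Pk_zero)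

lemma Pk_abs: "\<bar>(P ^^ k) \<phi> m\<bar> \<le> (P ^^ k) (\<lambda>j. \<bar>\<phi> j\<bar>) m"
proof (induction k arbitrary: m)
  case (Suc k)
  have "\<bar>(P ^^ Suc k) \<phi> m\<bar> \<le> P (\<lambda>j. \<bar>(P ^^ k) \<phi> j\<bar>) m" by (simp add: P_abs)
  also have "\<dots> \<le> P (\<lambda>j. (P ^^ k) (\<lambda>j. \<bar>\<phi> j\<bar>) j) m" by (intro P_mono Suc.IH)
  finally show ?case by simp
qed simp

lemma Pk_sq_le: "(P ^^ k) sq m \<le> (1 - \<gamma>) ^ k * sq m"
proof (induction k arbitrary: m)
  case (Suc k)
  have "(P ^^ Suc k) sq m \<le> P (\<lambda>j. (1 - \<gamma>) ^ k * sq j) m" by (auto intro!: P_mono Suc.IH)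
  also have "\<dots> = (1 - \<gamma>) ^ k * P sq m" by (rule P_cmult)
  also have "\<dots> \<le> (1 - \<gamma>) ^ k * ((1 - \<gamma>) * sq m)"
    using gamma_le by (intro mult_left_mono P_sq_le) auto
  finally show ?case by (simp add: algebra_simps)
qed simp

text \<open>
The class of functions on which the Neumann series of \<open>P\<close> converges, by the contraction of squares.
\<close>

definition quad_bounded :: "(nat \<Rightarrow> real) \<Rightarrow> bool" where
  "quad_bounded \<phi> \<longleftrightarrow> (\<exists>C. \<forall>j. \<bar>\<phi> j\<bar> \<le> C * sq j)"

text \<open>
\<open>potential p \<phi> m\<close> is the expectation of \<open>\<Sum>u. p ^ |u| * \<phi> (n\<^sub>u)\<close> over all vertices of the tree grown from
\<open>m\<close> balls.
\<close>

definition potential :: "real \<Rightarrow> (nat \<Rightarrow> real) \<Rightarrow> nat \<Rightarrow> real" where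
  "potential p \<phi> m = (\<Sum>k. p ^ k * (P ^^ k) \<phi> m)"

lemma Pk_quad_bounded:
  assumes "\<And>j. \<bar>\<phi> j\<bar> \<le> C * sq j"
  shows "\<bar>(P ^^ k) \<phi> m\<bar> \<le> C * (1 - \<gamma>) ^ k * sq m"
proof -
  have C: "0 \<le> C" using assms[of 1] by simp
  have "\<bar>(P ^^ k) \<phi> m\<bar> \<le> (P ^^ k) (\<lambda>j. \<bar>\<phi> j\<bar>) m" by (rule Pk_abs)
  also have "\<dots> \<le> (P ^^ k) (\<lambda>j. C * sq j) m" by (intro Pk_mono assms)
  also have "\<dots> = C * (P ^^ k) sq m" by (simp add: Pk_cmult)
  also have "\<dots> \<le> C * ((1 - \<gamma>) ^ k * sq m)" by (intro mult_left_mono Pk_sq_le C)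
  finally show ?thesis by (simp add: algebra_simps)
qed

lemma geometric_gamma: "summable (\<lambda>k. (1 - \<gamma>) ^ k)" "(\<Sum>k. (1 - \<gamma>) ^ k) = 1 / \<gamma>"
  using gamma_pos gamma_le by (auto simp: summable_geometric_iff suminf_geometric)

context
  fixes p :: real
  assumes p: "0 \<le> p" "p \<le> 1"
begin

lemma potential_term_le:
  assumes "\<And>j. \<bar>\<phi> j\<bar> \<le> C * sq j"
  shows "\<bar>p ^ k * (P ^^ k) \<phi> m\<bar> \<le> C * sq m * (1 - \<gamma>) ^ k"
proof -
  have "\<bar>p ^ k * (P ^^ k) \<phi> m\<bar> \<le> 1 * (C * (1 - \<gamma>) ^ k * sq m)"
    unfolding abs_mult using p by (intro mult_mono Pk_quad_bounded assms) (auto simp: power_le_one)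
  then show ?thesis by (simp add: algebra_simps)
qed

lemma potential_summable: "quad_bounded \<phi> \<Longrightarrow> summable (\<lambda>k. p ^ k * (P ^^ k) \<phi> m)"
proof -
  assume "quad_bounded \<phi>"
  then obtain C where C: "\<And>j. \<bar>\<phi> j\<bar> \<le> C * sq j" by (auto simp: quad_bounded_def)
  show ?thesis
    by (rule summable_comparison_test'[of "\<lambda>k. C * sq m * (1 - \<gamma>) ^ k"])
       (use geometric_gamma(1) potential_term_le[OF C] in \<open>auto intro: summable_mult\<close>)
qed

lemma potential_abs_le:
  assumes "\<And>j. \<bar>\<phi> j\<bar> \<le> C * sq j"
  shows "\<bar>potential p \<phi> m\<bar> \<le> C / \<gamma> * sq m"
proof -
  have "\<bar>potential p \<phi> m\<bar> \<le> (\<Sum>k. C * sq m * (1 - \<gamma>) ^ k)"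
  proof -
    have s: "summable (\<lambda>k. \<bar>p ^ k * (P ^^ k) \<phi> m\<bar>)"
      by (rule summable_comparison_test'[of "\<lambda>k. C * sq m * (1 - \<gamma>) ^ k"])
         (use geometric_gamma(1) potential_term_le[OF assms] in \<open>auto intro: summable_mult\<close>)
    have "\<bar>potential p \<phi> m\<bar> \<le> (\<Sum>k. \<bar>p ^ k * (P ^^ k) \<phi> m\<bar>)" unfolding potential_def by (rule summable_rabs[OF s])
    also have "\<dots> \<le> (\<Sum>k. C * sq m * (1 - \<gamma>) ^ k)"
      using geometric_gamma(1) by (intro suminf_le s potential_term_le assms summable_mult) auto
    finally show ?thesis .
  qed
  then show ?thesis using geometric_gamma by (simp add: suminf_mult)
qed

lemma potential_unfold:
  assumes "quad_bounded \<phi>"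
  shows "potential p \<phi> m = \<phi> m + p * P (potential p \<phi>) m"
proof -
  have "potential p \<phi> m = \<phi> m + (\<Sum>k. p ^ Suc k * (P ^^ Suc k) \<phi> m)"
    unfolding potential_def using suminf_split_head[OF potential_summable[OF assms]] by simp
  also have "(\<lambda>k. p ^ Suc k * (P ^^ Suc k) \<phi> m) = (\<lambda>k. p * P (\<lambda>j. p ^ k * (P ^^ k) \<phi> j) m)"
    by (simp add: P_cmult algebra_simps)
  also have "(\<Sum>k. p * P (\<lambda>j. p ^ k * (P ^^ k) \<phi> j) m) = p * P (potential p \<phi>) m"
    unfolding potential_def using P_suminf[of m "\<lambda>k j. p ^ k * (P ^^ k) \<phi> j"] potential_summable[OF assms]
    by (subst suminf_mult) auto
  finally show ?thesis .
qed

lemma potential_P: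
  assumes "quad_bounded \<phi>"
  shows "potential p (P \<phi>) m = P (potential p \<phi>) m"
proof -
  have "(\<lambda>k. p ^ k * (P ^^ k) (P \<phi>) m) = (\<lambda>k. P (\<lambda>j. p ^ k * (P ^^ k) \<phi> j) m)"
    by (simp add: P_cmult funpow_swap1)
  then show ?thesis
    unfolding potential_def using P_suminf(2)[of m "\<lambda>k j. p ^ k * (P ^^ k) \<phi> j"] potential_summable[OF assms] by simp
qed

lemma potential_add:
  assumes "quad_bounded \<phi>" "quad_bounded \<psi>"
  shows "potential p (\<lambda>j. \<phi> j + \<psi> j) m = potential p \<phi> m + potential p \<psi> m"
  unfolding potential_def using suminf_add[OF potential_summable[OF assms(1)] potential_summable[OF assms(2)]]
  by (simp add: Pk_add algebra_simps)

lemma potential_cmult: "quad_bounded \<phi> \<Longrightarrow> potential p (\<lambda>j. c * \<phi> j) m = c * potential p \<phi> m"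
  unfolding potential_def by (subst suminf_mult[symmetric]) (auto simp: potential_summable Pk_cmult algebra_simps)

lemma partial_le_pot:
  assumes "quad_bounded \<phi>" "\<And>j. 0 \<le> \<phi> j"
  shows "(\<Sum>k<L. p ^ k * (P ^^ k) \<phi> m) \<le> potential p \<phi> m"
  unfolding potential_def using assms p by (intro sum_le_suminf potential_summable) (auto intro!: mult_nonneg_nonneg Pk_nonneg)

lemma potential_nonneg: "quad_bounded \<phi> \<Longrightarrow> (\<And>j. 0 \<le> \<phi> j) \<Longrightarrow> 0 \<le> potential p \<phi> m"
  using partial_le_pot[where L = 0] by simp

text \<open>
A function \<open>w\<close> that dominates \<open>\<tau>\<close> plus its own discounted image dominates the potential of \<open>\<tau>\<close>.
The first disjunct allows exceptional sizes, typically small ones, at which the potential is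
bounded by other means.
\<close>

lemma supersolution:
  assumes q: "quad_bounded \<tau>"
    and w: "\<And>m. (\<forall>L. (\<Sum>k<L. p ^ k * (P ^^ k) \<tau> m) \<le> w m) \<or> \<tau> m + p * P w m \<le> w m"
    and w0: "\<And>m. 0 \<le> w m"
  shows "potential p \<tau> m \<le> w m"
proof -
  have "(\<Sum>k<L. p ^ k * (P ^^ k) \<tau> m) \<le> w m" for L
  proof (induction L arbitrary: m)
    case (Suc L)
    show ?case
    proof (cases "\<tau> m + p * P w m \<le> w m")
      case True
      have "(\<Sum>k<Suc L. p ^ k * (P ^^ k) \<tau> m) = \<tau> m + (\<Sum>k<L. p ^ Suc k * (P ^^ Suc k) \<tau> m)"
        by (subst sum.lessThan_Suc_shift) simp
      also have "(\<Sum>k<L. p ^ Suc k * (P ^^ Suc k) \<tau> m) = p * (\<Sum>k<L. P (\<lambda>j. p ^ k * (P ^^ k) \<tau> j) m)"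
        by (simp add: P_cmult sum_distrib_left algebra_simps)
      also have "(\<Sum>k<L. P (\<lambda>j. p ^ k * (P ^^ k) \<tau> j) m) = P (\<lambda>j. \<Sum>k<L. p ^ k * (P ^^ k) \<tau> j) m"
        by (induction L) (simp_all add: P_add)
      also have "\<tau> m + p * \<dots> \<le> \<tau> m + p * P w m"
        using p by (intro add_left_mono mult_left_mono P_mono Suc.IH) auto
      finally show ?thesis using True by simp
    qed (use w in blast)
  qed (simp add: w0)
  then show ?thesis
    unfolding potential_def by (intro suminf_le_const potential_summable q) (auto simp: lessThan_atLeast0)
qed

end

definition pos :: "nat \<Rightarrow> real" where "pos m = (if m = 0 then 0 else 1)"
text \<open>
The balls stored at the vertex itself.  Hence \<open>potential p own m\<close> is the expectation of
\<open>\<Sum> p ^ depth\<close> over the \<open>m\<close> balls, and \<open>path_length m\<close> below is the sum of the expected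
values of depth plus one.
\<close>

definition own :: "nat \<Rightarrow> real" where "own m = real m - P real m"
definition mean_vertices :: "nat \<Rightarrow> real" where "mean_vertices = potential 1 pos"
definition path_length :: "nat \<Rightarrow> real" where "path_length = potential 1 real"

lemma real_le_sq: "real m \<le> sq m"
  by (cases "m = 0") (auto simp: power2_eq_square)

lemma pos_le: "0 \<le> pos m" "pos m \<le> real m" "pos m \<le> 1" by (auto simp: pos_def)

lemma own_eq: "own m = (if s < m then real s0 else real m)"
  by (simp add: own_def P_id)

lemma own_bounds: "0 \<le> own m" "own m \<le> real m"
  using s0_le by (auto simp: own_eq)

lemma quad_boundedI: "(\<And>j. \<bar>\<phi> j\<bar> \<le> C * real j) \<Longrightarrow> quad_bounded \<phi>"
proof -
  assume A: "\<And>j. \<bar>\<phi> j\<bar> \<le> C * real j"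
  then have "0 \<le> C" using A[of 1] by simp
  then have "\<bar>\<phi> j\<bar> \<le> C * sq j" for j
    using A[of j] mult_left_mono[OF real_le_sq, of C j] by linarith
  then show ?thesis by (auto simp: quad_bounded_def)
qed

lemma quad_bounded_basic [simp]: "quad_bounded pos" "quad_bounded own" "quad_bounded real"
  using pos_le own_bounds by (auto intro!: quad_boundedI[of _ 1])

lemma quad_bounded_sq [simp]: "quad_bounded sq"
  unfolding quad_bounded_def by (intro exI[of _ 1]) simp

lemma quad_bounded_add: 
  assumes "quad_bounded \<phi>" "quad_bounded \<psi>" shows "quad_bounded (\<lambda>j. \<phi> j + \<psi> j)"
proof -
  obtain C C' where "\<And>j. \<bar>\<phi> j\<bar> \<le> C * sq j" "\<And>j. \<bar>\<psi> j\<bar> \<le> C' * sq j"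
    using assms by (auto simp: quad_bounded_def)
  then have "\<bar>\<phi> j + \<psi> j\<bar> \<le> (C + C') * sq j" for j
    using abs_triangle_ineq[of "\<phi> j" "\<psi> j"] by (simp add: distrib_right) (meson add_mono order_trans)
  then show ?thesis unfolding quad_bounded_def by blast
qed

lemma quad_bounded_cmult: 
  assumes "quad_bounded \<phi>" shows "quad_bounded (\<lambda>j. c * \<phi> j)"
proof -
  obtain C where "\<And>j. \<bar>\<phi> j\<bar> \<le> C * sq j"
    using assms by (auto simp: quad_bounded_def)
  then have "\<bar>c * \<phi> j\<bar> \<le> (\<bar>c\<bar> * C) * sq j" for j
    by (auto simp: abs_mult mult.assoc intro: mult_left_mono)
  then show ?thesis unfolding quad_bounded_def by blast
qed

lemma quad_bounded_mono:
  assumes "quad_bounded \<psi>" "\<And>j. \<bar>\<phi> j\<bar> \<le> \<psi> j" shows "quad_bounded \<phi>"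
  using assms unfolding quad_bounded_def by (meson abs_ge_self order_trans)

lemma quad_bounded_P:
  assumes "quad_bounded \<phi>" shows "quad_bounded (P \<phi>)"
proof -
  obtain C where C: "\<And>j. \<bar>\<phi> j\<bar> \<le> C * sq j"
    using assms by (auto simp: quad_bounded_def)
  have "\<bar>P \<phi> j\<bar> \<le> (C * (1 - \<gamma>)) * sq j" for j
    using Pk_quad_bounded[OF C, of 1 j] by simp
  then show ?thesis unfolding quad_bounded_def by blast
qed

lemma mean_vertices_nonneg: "0 \<le> mean_vertices m" and path_length_nonneg: "0 \<le> path_length m"
  unfolding mean_vertices_def path_length_def by (auto intro!: potential_nonneg simp: pos_le)

lemma path_length_le_sq: "path_length m \<le> sq m / \<gamma>"
  using potential_abs_le[of 1 real 1 m] real_le_sq unfolding path_length_def by simp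

text \<open>
The supersolution is \<open>A m ln m + B m\<close>: one application of \<open>P\<close> lowers it by \<open>A \<mu> m\<close>, which pays for the
\<open>m\<close> balls of the present generation as soon as \<open>A > 1 / \<mu>\<close> and \<open>m\<close> is large.
\<close>

lemma path_length_le:
  assumes \<eta>: "0 < \<eta>"
  shows "\<exists>B\<ge>0::real. \<forall>m. path_length m \<le> (1 + \<eta>) / \<mu> * xlnx m + B * m"
proof -
  define A where "A = (1 + \<eta>) / \<mu>"
  have A: "0 < A" "A * \<mu> = 1 + \<eta>" using \<eta> mu_pos by (auto simp: A_def)
  have "0 < \<eta> / A" using \<eta> A by simp
  from P_xlnx_le[OF this] obtain M where M: "\<And>m. M \<le> m \<Longrightarrow> P xlnx m \<le> xlnx m - \<mu> * m + \<eta> / A * m"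
    by (auto simp: eventually_sequentially)
  \<comment> \<open>For sizes below \<open>M\<close> the quadratic bound \<open>path_length m \<le> m\<^sup>2 / \<gamma>\<close> is linear with this slope.\<close>
  define B where "B = real M / \<gamma>"
  have B: "0 \<le> B" using gamma_pos by (simp add: B_def)
  have xlnx: "0 \<le> xlnx m" for m by (cases "m = 0") (auto simp: xlnx_def)
  have "path_length m \<le> A * xlnx m + B * real m" for m
    unfolding path_length_def
  proof (rule supersolution)
    fix m
    show "(\<forall>L. (\<Sum>k<L. 1 ^ k * (P ^^ k) real m) \<le> A * xlnx m + B * real m) \<or>
       real m + 1 * P (\<lambda>m. A * xlnx m + B * real m) m \<le> A * xlnx m + B * real m"
    proof (cases "M \<le> m")
      case True
      have "P (\<lambda>m. A * xlnx m + B * real m) m = A * P xlnx m + B * P real m"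
        by (simp add: P_add P_cmult)
      also have "\<dots> \<le> A * (xlnx m - \<mu> * m + \<eta> / A * m) + B * real m"
        using A B M[OF True] by (intro add_mono mult_left_mono) (auto simp: P_id)
      also have "\<dots> = A * xlnx m - (A * \<mu>) * m + \<eta> * m + B * real m"
        using A(1) by (simp add: field_simps)
      also have "\<dots> = A * xlnx m + B * real m - real m"
        unfolding A(2) by (simp add: algebra_simps)
      finally show ?thesis by simp
    next
      case False
      have "(\<Sum>k<L. 1 ^ k * (P ^^ k) real m) \<le> A * xlnx m + B * real m" for L
      proof -
        have "(\<Sum>k<L. 1 ^ k * (P ^^ k) real m) \<le> path_length m" unfolding path_length_def by (intro partial_le_pot) auto
        also have "\<dots> \<le> sq m / \<gamma>" by (rule path_length_le_sq)
        also have "\<dots> \<le> B * real m"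
          unfolding B_def power2_eq_square using False gamma_pos by (simp add: divide_right_mono mult_right_mono)
        finally show ?thesis using A xlnx[of m] by (simp add: add_increasing)
      qed
      then show ?thesis by blast
    qed
  qed (use A B xlnx in auto)
  then show ?thesis using B unfolding A_def by blast
qed

lemma potential_own_le:
  assumes "0 \<le> p" "p \<le> 1"
  shows "potential p own m \<le> real m"
proof (rule supersolution[OF assms])
  fix m
  have "p * P real m \<le> 1 * P real m" using assms by (intro mult_right_mono P_nonneg) auto
  then show "(\<forall>L. (\<Sum>k<L. p ^ k * (P ^^ k) own m) \<le> real m) \<or> own m + p * P real m \<le> real m"
    by (simp add: own_def)
qed auto

text \<open>
Jensen's inequality for \<open>p ^ depth\<close> in the form of a tangent line at \<open>x\<close>, an upper bound of the mean
depth of a ball.  Truncation at depth \<open>L\<close> keeps all sums finite.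
\<close>

lemma potential_own_ge:
  assumes p: "0 < p" "p \<le> 1" and x: "0 \<le> x" "path_length m \<le> (x + 1) * real m"
  shows "p powr x * real m \<le> potential p own m"
proof -
  let ?Q = "\<lambda>k. (P ^^ k) real m"
  let ?q = "\<lambda>k. (P ^^ k) own m"
  have lnp: "ln p \<le> 0" using p by (simp add: ln_le_zero_iff)
  have q: "?q k = ?Q k - ?Q (Suc k)" for k
  proof -
    have "?q k = (P ^^ k) (\<lambda>j. real j + (-1) * P real j) m" by (simp add: own_def[abs_def])
    then show ?thesis by (simp only: Pk_add Pk_cmult funpow_swap1 o_def funpow.simps)
  qed
  have q0: "0 \<le> ?q k" for k by (intro Pk_nonneg own_bounds)
  have Q0: "0 \<le> ?Q k" for k by (intro Pk_nonneg) auto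
  have sum_q: "(\<Sum>k<L. ?q k) = real m - ?Q L" for L
    unfolding q using sum_lessThan_telescope'[of ?Q L] by simp
  have sum_kq: "(\<Sum>k<L. real k * ?q k) \<le> path_length m - real m" for L
  proof -
    have "(\<Sum>k<L. real k * ?q k) \<le> (\<Sum>k<L. ?Q (Suc k))"
    proof -
      have parts: "(\<Sum>k<L. real k * ?q k) + real L * ?Q L = (\<Sum>k<L. ?Q (Suc k))" for L
      proof (induction L)
        case (Suc L)
        have "real L * ?q L + real (Suc L) * ?Q (Suc L) = real L * ?Q L + ?Q (Suc L)"
          unfolding q of_nat_Suc by algebra
        then show ?case using Suc unfolding sum.lessThan_Suc by linarith
      qed simp
      have "0 \<le> real L * ?Q L" by (intro mult_nonneg_nonneg Q0) simp
      then show ?thesis using parts[of L] by linarith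
    qed
    also have "\<dots> = (\<Sum>k<Suc L. ?Q k) - real m" by (subst sum.lessThan_Suc_shift) simp
    also have "(\<Sum>k<Suc L. ?Q k) \<le> path_length m"
      using partial_le_pot[of 1 real m "Suc L"] unfolding path_length_def by simp
    finally show ?thesis by simp
  qed
  have lower: "p powr x * ((1 - x * ln p) * (real m - ?Q L) + ln p * (x * real m)) \<le> potential p own m" for L
  proof -
    have "p powr x * ((1 - x * ln p) * (real m - ?Q L) + ln p * (x * real m))
      \<le> p powr x * ((1 - x * ln p) * (\<Sum>k<L. ?q k) + ln p * (\<Sum>k<L. real k * ?q k))"
    proof (rule mult_left_mono)
      have "(\<Sum>k<L. real k * ?q k) \<le> x * real m" using sum_kq[of L] x by (simp add: algebra_simps)
      then have "ln p * (x * real m) \<le> ln p * (\<Sum>k<L. real k * ?q k)"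
        using lnp by (rule mult_left_mono_neg)
      then show "(1 - x * ln p) * (real m - ?Q L) + ln p * (x * real m)
        \<le> (1 - x * ln p) * (\<Sum>k<L. ?q k) + ln p * (\<Sum>k<L. real k * ?q k)"
        unfolding sum_q by linarith
    qed simp
    also have "\<dots> = (\<Sum>k<L. p powr x * (1 + ln p * (real k - x)) * ?q k)"
      by (simp add: sum_distrib_left sum.distrib[symmetric] algebra_simps)
    also have "\<dots> \<le> (\<Sum>k<L. p ^ k * ?q k)"
    proof (intro sum_mono mult_right_mono q0)
      fix k
      have "p powr x * (1 + ln p * (real k - x)) \<le> p powr x * exp (ln p * (real k - x))"
        by (intro mult_left_mono exp_ge_add_one_self) auto
      also have "\<dots> = p powr x * p powr (real k - x)" using p by (simp add: powr_def mult.commute)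
      also have "\<dots> = p ^ k" using p by (simp add: powr_realpow flip: powr_add)
      finally show "p powr x * (1 + ln p * (real k - x)) \<le> p ^ k" .
    qed
    also have "\<dots> \<le> potential p own m" using p by (intro partial_le_pot) (auto simp: own_bounds)
    finally show ?thesis .
  qed
  have "?Q \<longlonglongrightarrow> 0"
    using summable_LIMSEQ_zero[OF potential_summable[of 1 real m]] by simp
  then have "(\<lambda>L. p powr x * ((1 - x * ln p) * (real m - ?Q L) + ln p * (x * real m)))
    \<longlonglongrightarrow> p powr x * ((1 - x * ln p) * (real m - 0) + ln p * (x * real m))"
    by (intro tendsto_intros)
  then have "p powr x * ((1 - x * ln p) * (real m - 0) + ln p * (x * real m)) \<le> potential p own m"
    by (rule LIMSEQ_le_const2) (use lower in blast)
  then show ?thesis by (simp add: algebra_simps)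
qed

text \<open>
For \<open>m > Z\<close> the power \<open>m powr (1 - \<theta>)\<close> is a supersolution: the killing \<open>\<delta>\<close> exceeds the growth \<open>(1 - q) \<delta>\<close>
of the power, and the surplus \<open>q \<delta> m powr (1 - \<theta>)\<close> absorbs the additive errors.  For \<open>m \<le> Z\<close>
the trivial bound \<open>m\<close> suffices, at the cost of the factor \<open>Z powr \<theta>\<close>, which tends to \<open>1\<close> when
\<open>\<theta>\<close> is of the order of \<open>\<delta>\<close>.
\<close>

lemma potential_own_powr_le:
  assumes \<delta>: "0 < \<delta>" "\<delta> < 1" and q: "0 < q" "q \<le> 1" and \<theta>: "0 < \<theta>" "\<theta> \<le> 1/2"
    and moment: "real b * (\<integral>v. v 0 powr (1 - \<theta>) \<partial>D) \<le> 1 + (1 - q) * \<delta>"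
  defines "Z \<equiv> ((real (s0 + b * s1 + s + 1)) / (q * \<delta>))\<^sup>2"
  shows "potential (1 - \<delta>) own m \<le> Z powr \<theta> * real m powr (1 - \<theta>)"
proof -
  let ?d = "real (s0 + b * s1 + s + 1)"
  have qd: "0 < q * \<delta>" "q * \<delta> \<le> 1" using q \<delta> by (auto simp: mult_le_one)
  have r1: "?d \<le> ?d / (q * \<delta>)" using qd by (simp add: le_divide_eq mult_left_le)
  have d1: "1 \<le> ?d" by simp
  then have "1 \<le> ?d / (q * \<delta>)" using r1 by (rule order_trans)
  then have "?d / (q * \<delta>) \<le> Z" unfolding Z_def using self_le_power[of "?d / (q * \<delta>)" 2] by simp
  with r1 have Zd: "?d \<le> Z" by (rule order_trans)
  define A where "A = Z powr \<theta>"
  have A: "1 \<le> A" unfolding A_def using order_trans[OF d1 Zd] \<theta> by (intro ge_one_powr_ge_zero) auto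
  have p: "0 \<le> 1 - \<delta>" "1 - \<delta> \<le> 1" using \<delta> by auto
  show ?thesis unfolding A_def[symmetric]
  proof (rule supersolution[OF p])
    fix m
    show "(\<forall>L. (\<Sum>k<L. (1 - \<delta>) ^ k * (P ^^ k) own m) \<le> A * real m powr (1 - \<theta>)) \<or>
      own m + (1 - \<delta>) * P (\<lambda>m. A * real m powr (1 - \<theta>)) m \<le> A * real m powr (1 - \<theta>)"
    proof (cases "real m \<le> Z")
      case True
      have "(\<Sum>k<L. (1 - \<delta>) ^ k * (P ^^ k) own m) \<le> A * real m powr (1 - \<theta>)" for L
      proof -
        have "(\<Sum>k<L. (1 - \<delta>) ^ k * (P ^^ k) own m) \<le> potential (1 - \<delta>) own m"
          by (intro partial_le_pot p) (auto simp: own_bounds)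
        also have "\<dots> \<le> real m" by (intro potential_own_le p)
        also have "real m = real m powr \<theta> * real m powr (1 - \<theta>)" by (simp flip: powr_add)
        also have "\<dots> \<le> A * real m powr (1 - \<theta>)"
          unfolding A_def using True \<theta> by (intro mult_right_mono powr_mono2) auto
        finally show ?thesis .
      qed
      then show ?thesis by blast
    next
      case False
      then have "?d < real m" using Zd by simp
      then have m: "s < m" by linarith
      let ?h = "real m powr (1 - \<theta>)"
      have "?d / (q * \<delta>) = Z powr (1/2)"
        unfolding Z_def using qd by (subst powr_half_sqrt) (auto simp: real_sqrt_unique)
      also have "\<dots> \<le> real m powr (1/2)" using False by (intro powr_mono2) (auto simp: Z_def)
      also have "\<dots> \<le> ?h" using m \<theta> by (intro powr_mono) auto
      finally have h: "?d \<le> q * \<delta> * ?h" using qd by (simp add: divide_le_eq mult.commute)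
      have h0: "0 \<le> ?h" by simp
      have "P (\<lambda>m. real m powr (1 - \<theta>)) m \<le> ?h * (real b * (\<integral>v. v 0 powr (1 - \<theta>) \<partial>D)) + real b * real s1"
        using \<theta> by (intro P_powr_le m) auto
      also have "\<dots> \<le> ?h * (1 + (1 - q) * \<delta>) + real b * real s1"
        by (intro add_right_mono mult_left_mono moment) auto
      finally have "(1 - \<delta>) * P (\<lambda>m. real m powr (1 - \<theta>)) m
          \<le> (1 - \<delta>) * (?h * (1 + (1 - q) * \<delta>) + real b * real s1)"
        using p by (intro mult_left_mono) auto
      also have "\<dots> = ?h * ((1 - \<delta>) * (1 + (1 - q) * \<delta>)) + (1 - \<delta>) * (real b * real s1)"
        by (simp add: algebra_simps)
      also have "\<dots> \<le> ?h * (1 - q * \<delta>) + 1 * (real b * real s1)"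
      proof (intro add_mono mult_left_mono mult_right_mono)
        have "0 \<le> (1 - q) * (\<delta> * \<delta>)" using q by simp
        then show "(1 - \<delta>) * (1 + (1 - q) * \<delta>) \<le> 1 - q * \<delta>" by (simp add: algebra_simps)
      qed (use \<delta> in auto)
      finally have "(1 - \<delta>) * P (\<lambda>m. real m powr (1 - \<theta>)) m + real s0 \<le> ?h"
        using h by (simp add: algebra_simps)
      then have "A * ((1 - \<delta>) * P (\<lambda>m. real m powr (1 - \<theta>)) m + real s0) \<le> A * ?h"
        using A by (intro mult_left_mono) auto
      moreover have "real s0 \<le> A * real s0" using A by (simp add: mult_le_cancel_right1)
      ultimately show ?thesis using m by (simp add: own_eq P_cmult algebra_simps)
    qed
  qed (use A in auto)
qed

end

section \<open>Mean size of the root cluster\<close>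

context split_kernel
begin

lemma potential_abs_le_pot:
  assumes p: "0 \<le> p" "p \<le> 1" and q: "quad_bounded \<psi>" and le: "\<And>j. \<bar>\<phi> j\<bar> \<le> \<psi> j"
  shows "\<bar>potential p \<phi> m\<bar> \<le> potential 1 \<psi> m"
proof -
  have le': "\<bar>p ^ k * (P ^^ k) \<phi> m\<bar> \<le> 1 ^ k * (P ^^ k) \<psi> m" for k
  proof -
    have "\<bar>p ^ k * (P ^^ k) \<phi> m\<bar> \<le> 1 * (P ^^ k) (\<lambda>j. \<bar>\<phi> j\<bar>) m"
      unfolding abs_mult using p by (intro mult_mono Pk_abs) (auto simp: power_le_one)
    also have "\<dots> \<le> 1 * (P ^^ k) \<psi> m" by (intro mult_left_mono Pk_mono le) auto
    finally show ?thesis by simp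
  qed
  have s: "summable (\<lambda>k. \<bar>p ^ k * (P ^^ k) \<phi> m\<bar>)"
    by (rule summable_comparison_test'[of "\<lambda>k. 1 ^ k * (P ^^ k) \<psi> m"])
       (use potential_summable[of 1 \<psi> m] q le' in auto)
  have "\<bar>potential p \<phi> m\<bar> \<le> (\<Sum>k. \<bar>p ^ k * (P ^^ k) \<phi> m\<bar>)" unfolding potential_def by (rule summable_rabs[OF s])
  also have "\<dots> \<le> potential 1 \<psi> m"
    unfolding potential_def by (intro suminf_le s le' potential_summable q) auto
  finally show ?thesis .
qed

text \<open>
The expected size of the root cluster of the tree grown from a given number of balls.
\<close>

definition visits :: "real \<Rightarrow> nat \<Rightarrow> real" where "visits p = potential p pos"

lemma visits_bounds:
  assumes "0 \<le> p" "p \<le> 1" shows "0 \<le> visits p m" "visits p m \<le> mean_vertices m"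
  using assms potential_nonneg[of p pos m] potential_abs_le_pot[OF assms, of pos pos m]
  by (auto simp: visits_def mean_vertices_def pos_le)

lemma visits_0: assumes "0 \<le> p" "p \<le> 1" shows "visits p 0 = 0"
proof -
  have "\<bar>visits p 0\<bar> \<le> 1 / \<gamma> * sq 0"
    unfolding visits_def using real_le_sq pos_le order_trans by (intro potential_abs_le assms) (auto simp: pos_def)
  then show ?thesis by simp
qed

lemma mean_vertices_unfold: "mean_vertices m = pos m + P mean_vertices m"
  using potential_unfold[of 1 pos m] by (simp add: mean_vertices_def)

definition pairs :: "(nat \<Rightarrow> real) \<Rightarrow> (nat \<Rightarrow> nat) \<Rightarrow> real" where
  "pairs g a = (\<Sum>i<b. \<Sum>j\<in>{..<b}-{i}. g (a i) * g (a j))"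

text \<open>
Expected products over ordered pairs of distinct children.
\<close>

definition P2 :: "(nat \<Rightarrow> real) \<Rightarrow> nat \<Rightarrow> real" where "P2 g = K (pairs g)"

text \<open>
The expected number of ordered pairs of vertices that are connected to a given vertex and have it
as last common ancestor: both equal to it, exactly one equal to it, or below distinct children.
\<close>

definition tau :: "real \<Rightarrow> nat \<Rightarrow> real" where
  "tau p m = pos m + 2 * p * P (visits p) m + p\<^sup>2 * P2 (visits p) m"

lemma pairs_eq: "pairs g a = (\<Sum>i<b. g (a i))\<^sup>2 - (\<Sum>i<b. (g (a i))\<^sup>2)"
proof -
  have "(\<Sum>i<b. g (a i))\<^sup>2 = (\<Sum>i<b. \<Sum>j<b. g (a i) * g (a j))"
    by (simp add: power2_eq_square sum_product)
  also have "\<dots> = (\<Sum>i<b. (g (a i))\<^sup>2 + (\<Sum>j\<in>{..<b}-{i}. g (a i) * g (a j)))"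
    by (intro sum.cong refl, subst sum.remove) (auto simp: power2_eq_square)
  finally show ?thesis by (simp add: pairs_def sum.distrib)
qed

lemma P2_nonneg: "(\<And>j. 0 \<le> g j) \<Longrightarrow> 0 \<le> P2 g m"
proof -
  assume "\<And>j. 0 \<le> g j"
  then have "0 \<le> pairs g a" for a unfolding pairs_def by (intro sum_nonneg mult_nonneg_nonneg)
  then show ?thesis unfolding P2_def using K_mono[of m "\<lambda>_. 0" "pairs g"] by simp
qed

lemma P2_leaf: "m \<le> s \<Longrightarrow> g 0 = 0 \<Longrightarrow> P2 g m = 0"
  unfolding P2_def by (simp add: K_leaf pairs_def)

lemma P2_le_square:
  assumes "0 \<le> C" and "\<And>j. j \<le> m \<Longrightarrow> 0 \<le> g j" "\<And>j. j \<le> m \<Longrightarrow> g j \<le> C * real j"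
  shows "P2 g m \<le> C\<^sup>2 * sq m"
proof -
  have "P2 g m \<le> K (\<lambda>_. C\<^sup>2 * sq m) m" unfolding P2_def
  proof (rule K_mono)
    fix a assume a: "a \<in> profiles b m" "(\<Sum>i<b. a i) \<le> m"
    have le: "a i \<le> m" if "i < b" for i using a that by auto
    have "pairs g a \<le> (\<Sum>i<b. g (a i))\<^sup>2" unfolding pairs_eq by (simp add: sum_nonneg)
    also have "\<dots> \<le> (C * real m)\<^sup>2"
    proof (rule power_mono)
      have "(\<Sum>i<b. g (a i)) \<le> (\<Sum>i<b. C * real (a i))" using le by (intro sum_mono assms) auto
      also have "\<dots> = C * real (\<Sum>i<b. a i)" by (simp add: sum_distrib_left)
      also have "\<dots> \<le> C * real m" using a(2) assms(1) by (intro mult_left_mono) (simp_all del: of_nat_sum)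
      finally show "(\<Sum>i<b. g (a i)) \<le> C * real m" .
    qed (use le assms in \<open>auto intro!: sum_nonneg\<close>)
    finally show "pairs g a \<le> C\<^sup>2 * sq m" by (simp add: power_mult_distrib)
  qed
  then show ?thesis by simp
qed

lemma tau_nonneg: "0 \<le> p \<Longrightarrow> p \<le> 1 \<Longrightarrow> 0 \<le> tau p m"
  unfolding tau_def using visits_bounds by (auto intro!: add_nonneg_nonneg mult_nonneg_nonneg P_nonneg P2_nonneg simp: pos_le)

text \<open>
The square of the sum splits into distinct pairs and squares, and the sum itself is at most
\<open>b powr (1 - \<beta>) * m powr \<beta>\<close> by concavity.  Hence the form with a difference, which telescopes.
\<close>

lemma P2_powr_le:
  assumes \<beta>: "0 < \<beta>" "\<beta> \<le> 1"
  defines "h \<equiv> \<lambda>m. real m powr \<beta>"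
  shows "P2 h m \<le> (real b powr (1 - \<beta>))\<^sup>2 * (h m)\<^sup>2 + (-1) * P (\<lambda>j. (h j)\<^sup>2) m"
proof -
  have "P2 h m = K (\<lambda>a. (\<Sum>i<b. h (a i))\<^sup>2 + (-1) * (\<Sum>i<b. (h (a i))\<^sup>2)) m"
    unfolding P2_def by (rule K_cong) (simp add: pairs_eq)
  also have "\<dots> = K (\<lambda>a. (\<Sum>i<b. h (a i))\<^sup>2) m + (-1) * P (\<lambda>j. (h j)\<^sup>2) m"
    unfolding K_add K_cmult P_def ..
  also have "K (\<lambda>a. (\<Sum>i<b. h (a i))\<^sup>2) m \<le> K (\<lambda>_. (real b powr (1 - \<beta>) * h m)\<^sup>2) m"
  proof (rule K_mono)
    fix a assume a: "a \<in> profiles b m" "(\<Sum>i<b. a i) \<le> m"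
    have "(\<Sum>i<b. h (a i)) \<le> real b powr (1 - \<beta>) * h m"
    proof (cases "m = 0")
      case True
      then show ?thesis using a by (auto simp: h_def)
    next
      case False
      define A where "A = real m / real b"
      have A: "0 < A" using False b_pos by (simp add: A_def)
      have "(\<Sum>i<b. h (a i)) \<le> (\<Sum>i<b. A powr \<beta> + \<beta> * A powr (\<beta> - 1) * (real (a i) - A))"
        unfolding h_def by (intro sum_mono powr_le_tangent A \<beta>) auto
      also have "\<dots> = real b * A powr \<beta> + \<beta> * A powr (\<beta> - 1) * (real (\<Sum>i<b. a i) - real b * A)"
        by (simp add: sum.distrib sum_subtractf flip: sum_distrib_left)
      also have "\<dots> \<le> real b * A powr \<beta> + \<beta> * A powr (\<beta> - 1) * 0"
        using a(2) \<beta> b_pos by (intro add_left_mono mult_left_mono) (auto simp: A_def simp del: of_nat_sum)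
      also have "\<dots> = real b powr (1 - \<beta>) * h m"
        using b_pos by (simp add: A_def h_def powr_divide powr_diff)
      finally show ?thesis .
    qed
    then show "(\<Sum>i<b. h (a i))\<^sup>2 \<le> (real b powr (1 - \<beta>) * h m)\<^sup>2"
      by (intro power_mono) (auto simp: h_def intro: sum_nonneg)
  qed
  finally show ?thesis by (simp add: power_mult_distrib)
qed

lemma powr_le_self_nat: "0 < \<beta> \<Longrightarrow> \<beta> \<le> 1 \<Longrightarrow> real m powr \<beta> \<le> real m"
  using powr_mono[of \<beta> 1 "real m"] by (cases "m = 0") auto

lemma sum_P2_powr_le:
  assumes \<beta>: "0 < \<beta>" "\<beta> \<le> 1"
  defines "h \<equiv> \<lambda>m. real m powr \<beta>"
  shows "(\<Sum>l<L. (P ^^ l) (P2 h) n) \<le> (h n)\<^sup>2 + ((real b powr (1 - \<beta>))\<^sup>2 - 1) * (sq n / \<gamma>)"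
proof -
  let ?B = "(real b powr (1 - \<beta>))\<^sup>2"
  let ?H = "\<lambda>l. (P ^^ l) (\<lambda>j. (h j)\<^sup>2) n"
  have h: "0 \<le> h m" "h m \<le> real m" for m using powr_le_self_nat[OF \<beta>] by (auto simp: h_def)
  have B: "1 \<le> ?B" using b_pos \<beta> by (intro one_le_power ge_one_powr_ge_zero) auto
  have H0: "0 \<le> ?H l" for l by (intro Pk_nonneg) auto
  have "(\<Sum>l<L. (P ^^ l) (P2 h) n) \<le> (\<Sum>l<L. (P ^^ l) (\<lambda>m. ?B * (h m)\<^sup>2 + (-1) * P (\<lambda>j. (h j)\<^sup>2) m) n)"
    unfolding h_def by (intro sum_mono Pk_mono P2_powr_le \<beta>)
  also have "\<dots> = (\<Sum>l<L. ?B * ?H l + (-1) * ?H (Suc l))"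
    by (simp only: Pk_add Pk_cmult funpow_swap1 o_def funpow.simps)
  also have "\<dots> = (\<Sum>l<L. ?H l - ?H (Suc l)) + (?B - 1) * (\<Sum>l<L. ?H l)"
    unfolding sum_distrib_left sum.distrib[symmetric] by (intro sum.cong refl) (simp add: algebra_simps)
  also have "(\<Sum>l<L. ?H l - ?H (Suc l)) = ?H 0 - ?H L" by (rule sum_lessThan_telescope')
  also have "\<dots> \<le> (h n)\<^sup>2" using H0[of L] by simp
  also have "(\<Sum>l<L. ?H l) \<le> sq n / \<gamma>"
  proof -
    have "(\<Sum>l<L. ?H l) \<le> (\<Sum>l<L. 1 ^ l * (P ^^ l) sq n)"
      using h by (intro sum_mono) (auto intro!: Pk_mono power_mono)
    also have "\<dots> \<le> potential 1 sq n" by (intro partial_le_pot) auto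
    also have "\<dots> \<le> sq n / \<gamma>" using potential_abs_le[of 1 sq 1 n] by simp
    finally show ?thesis .
  qed
  finally show ?thesis using B by (simp add: mult_left_mono)
qed

text \<open>
Transfers a pointwise approximation of \<open>g\<close> to the pair functional; errors that are small relative
to \<open>m\<close> become small relative to \<open>m\<^sup>2\<close>.
\<close>

lemma P2_perturb:
  fixes A \<epsilon> C :: real
  assumes g: "\<And>j. 0 \<le> g j" and h: "\<And>j. 0 \<le> h j" "\<And>j. h j \<le> real j"
    and A: "0 \<le> A" and \<epsilon>: "0 \<le> \<epsilon>" and C: "0 \<le> C"
    and le: "\<And>j. j \<le> m \<Longrightarrow> g j \<le> A * h j + (\<epsilon> * real j + C * pos j)" and m: "s < m"
  shows "P2 g m \<le> A\<^sup>2 * P2 h m + ((2 * A * \<epsilon> + \<epsilon>\<^sup>2) * sq m +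
    (2 * A * (b * C) + 2 * \<epsilon> * (b * C) + (b * C)\<^sup>2) * real m)"
proof -
  let ?D = "real b * C"
  let ?X = "2 * A * real m * (\<epsilon> * real m + ?D) + (\<epsilon> * real m + ?D)\<^sup>2"
  have "P2 g m \<le> K (\<lambda>a. A\<^sup>2 * pairs h a + ?X) m" unfolding P2_def
  proof (rule K_mono)
    fix a assume a: "a \<in> profiles b m" "(\<Sum>i<b. a i) \<le> m"
    let ?u = "\<lambda>j. A * h j" and ?v = "\<lambda>j. \<epsilon> * real j + C * pos j"
    have v0: "0 \<le> ?v j" for j using \<epsilon> C by (simp add: pos_le)
    have u0: "0 \<le> ?u j" for j using A h by simp
    have "pairs g a \<le> pairs (\<lambda>j. ?u j + ?v j) a"
      unfolding pairs_def using a by (intro sum_mono mult_mono le g add_nonneg_nonneg[OF u0 v0]) auto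
    also have "\<dots> = pairs ?u a + 2 * (\<Sum>i<b. ?u (a i)) * (\<Sum>i<b. ?v (a i)) + (\<Sum>i<b. ?v (a i))\<^sup>2
       - (\<Sum>i<b. 2 * ?u (a i) * ?v (a i) + (?v (a i))\<^sup>2)"
      unfolding pairs_eq by (simp only: sum.distrib power2_sum)
    also have "\<dots> \<le> pairs ?u a + 2 * (\<Sum>i<b. ?u (a i)) * (\<Sum>i<b. ?v (a i)) + (\<Sum>i<b. ?v (a i))\<^sup>2"
      using u0 v0 by (simp add: sum_nonneg)
    also have "pairs ?u a = A\<^sup>2 * pairs h a"
      unfolding pairs_def by (simp add: sum_distrib_left power2_eq_square algebra_simps)
    finally have split: "pairs g a \<le> A\<^sup>2 * pairs h a + 2 * (\<Sum>i<b. ?u (a i)) * (\<Sum>i<b. ?v (a i)) +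
      (\<Sum>i<b. ?v (a i))\<^sup>2" .
    have "2 * (\<Sum>i<b. ?u (a i)) * (\<Sum>i<b. ?v (a i)) + (\<Sum>i<b. ?v (a i))\<^sup>2 \<le> ?X"
    proof -
      have sa: "(\<Sum>i<b. real (a i)) \<le> real m" using a(2) by (simp flip: of_nat_sum)
      have U: "(\<Sum>i<b. ?u (a i)) \<le> A * real m"
      proof -
        have "(\<Sum>i<b. ?u (a i)) \<le> (\<Sum>i<b. A * real (a i))" using A h by (intro sum_mono mult_left_mono) auto
        also have "\<dots> \<le> A * real m" using sa A by (simp add: mult_left_mono flip: sum_distrib_left)
        finally show ?thesis .
      qed
      have V: "(\<Sum>i<b. ?v (a i)) \<le> \<epsilon> * real m + ?D"
      proof -
        have "(\<Sum>i<b. ?v (a i)) \<le> (\<Sum>i<b. \<epsilon> * real (a i) + C * 1)"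
          using C pos_le by (intro sum_mono add_left_mono mult_left_mono) auto
        also have "\<dots> = \<epsilon> * (\<Sum>i<b. real (a i)) + ?D" by (simp add: sum.distrib sum_distrib_left)
        also have "\<dots> \<le> \<epsilon> * real m + ?D" using sa \<epsilon> by (simp add: mult_left_mono)
        finally show ?thesis .
      qed
      have V0: "0 \<le> (\<Sum>i<b. ?v (a i))" using v0 by (intro sum_nonneg) auto
      have U0: "0 \<le> (\<Sum>i<b. ?u (a i))" using u0 by (intro sum_nonneg) auto
      have "2 * (\<Sum>i<b. ?u (a i)) * (\<Sum>i<b. ?v (a i)) \<le> 2 * (A * real m) * (\<epsilon> * real m + ?D)"
        using U V U0 V0 A by (intro mult_mono) auto
      moreover have "(\<Sum>i<b. ?v (a i))\<^sup>2 \<le> (\<epsilon> * real m + ?D)\<^sup>2" using V V0 by (intro power_mono)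
      ultimately show ?thesis by (simp add: mult.assoc)
    qed
    with split show "pairs g a \<le> A\<^sup>2 * pairs h a + ?X" by linarith
  qed
  also have "\<dots> = A\<^sup>2 * P2 h m + ?X" unfolding P2_def by (simp add: K_add K_cmult)
  also have "?X \<le> (2 * A * \<epsilon> + \<epsilon>\<^sup>2) * sq m + (2 * A * ?D + 2 * \<epsilon> * ?D + ?D\<^sup>2) * real m"
  proof -
    have "?D\<^sup>2 * 1 \<le> ?D\<^sup>2 * real m" using m by (intro mult_left_mono) auto
    then show ?thesis by (simp add: power2_sum power_mult_distrib) (simp add: power2_eq_square algebra_simps)
  qed
  finally show ?thesis by simp
qed

end

locale linear_split_kernel = split_kernel +
  fixes \<alpha> c :: real
  assumes alpha_pos: "0 < \<alpha>" and c_pos: "0 < c"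
    and mean_vertices_asymp: "(\<lambda>m. mean_vertices m / real m) \<longlonglongrightarrow> \<alpha>"
begin

definition R :: "nat \<Rightarrow> real" where "R m = mean_vertices m - \<alpha> * real m"

lemma R_le:
  assumes "0 < \<epsilon>"
  shows "\<exists>C\<ge>0. \<forall>m. \<bar>R m\<bar> \<le> \<epsilon> * real m + C * pos m"
proof -
  have "\<forall>\<^sub>F m in sequentially. dist (mean_vertices m / real m) \<alpha> < \<epsilon>" using mean_vertices_asymp assms by (rule tendstoD)
  then obtain N where N: "\<And>m. N \<le> m \<Longrightarrow> \<bar>mean_vertices m / real m - \<alpha>\<bar> < \<epsilon>"
    by (auto simp: eventually_sequentially dist_real_def)
  define C where "C = (\<Sum>m<N. \<bar>R m\<bar>)"
  have "0 \<le> C" unfolding C_def by (intro sum_nonneg) auto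
  moreover have "\<bar>R m\<bar> \<le> \<epsilon> * real m + C * pos m" for m
  proof (cases "m = 0")
    case True
    then show ?thesis using visits_0[of 1] by (simp add: R_def mean_vertices_def visits_def pos_def)
  next
    case m: False
    show ?thesis
    proof (cases "N \<le> m")
      case True
      have "R m = (mean_vertices m / real m - \<alpha>) * real m" using m by (simp add: R_def field_simps)
      then have "\<bar>R m\<bar> = \<bar>mean_vertices m / real m - \<alpha>\<bar> * real m" by (simp only: abs_mult abs_of_nat)
      also have "\<dots> \<le> \<epsilon> * real m" using N[OF True] by (intro mult_right_mono) auto
      finally show ?thesis using \<open>0 \<le> C\<close> pos_le(1)[of m] by (simp add: add_increasing2)
    next
      case False
      then have "\<bar>R m\<bar> \<le> C" unfolding C_def by (intro member_le_sum) auto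
      then show ?thesis using assms m by (simp add: pos_def add_increasing)
    qed
  qed
  ultimately show ?thesis by blast
qed

lemma mean_vertices_le: "\<exists>C>0. \<forall>m. mean_vertices m \<le> C * real m"
proof -
  obtain C where C: "0 \<le> C" "\<And>m. \<bar>R m\<bar> \<le> 1 * real m + C * pos m" using R_le[of 1] by auto
  have "mean_vertices m \<le> (\<alpha> + 1 + C) * real m" for m
    using C(2)[of m] mult_left_mono[OF pos_le(2) C(1), of m] by (simp add: R_def algebra_simps)
  then show ?thesis using alpha_pos C(1) by (intro exI[of _ "\<alpha> + 1 + C"]) auto
qed

lemma quad_bounded_R: "quad_bounded R"
proof -
  obtain C where C: "0 \<le> C" "\<And>m. \<bar>R m\<bar> \<le> 1 * real m + C * pos m" using R_le[of 1] by auto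
  show ?thesis by (rule quad_bounded_mono[OF _ C(2)]) (intro quad_bounded_add quad_bounded_cmult quad_bounded_basic)
qed

text \<open>
Since the indicator of a vertex is \<open>mean_vertices - P mean_vertices\<close> and \<open>mean_vertices m = \<alpha> m + R m\<close>, the potential of
vertices is \<open>\<alpha>\<close> times the potential of balls plus the potential of \<open>R - P R\<close>, which telescopes up to
the factor \<open>1 - p\<close>.
\<close>

lemma visits_decomp:
  assumes p: "0 \<le> p" "p \<le> 1"
  shows "visits p m = \<alpha> * potential p own m + R m - (1 - p) * P (potential p R) m"
proof -
  note q = quad_bounded_R quad_bounded_P[OF quad_bounded_R] quad_bounded_basic quad_bounded_cmult quad_bounded_add
  have "pos j = (\<alpha> * own j + R j) + (-1) * P R j" for j
  proof -
    have "P mean_vertices j = P (\<lambda>j. \<alpha> * real j + R j) j" by (simp add: R_def)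
    also have "\<dots> = \<alpha> * P real j + P R j" by (simp add: P_add P_cmult)
    finally show ?thesis using mean_vertices_unfold[of j] by (simp add: own_def R_def algebra_simps)
  qed
  then have "pos = (\<lambda>j. (\<alpha> * own j + R j) + (-1) * P R j)" by auto
  then have "visits p m = potential p (\<lambda>j. (\<alpha> * own j + R j) + (-1) * P R j) m" by (simp add: visits_def)
  also have "\<dots> = \<alpha> * potential p own m + potential p R m - potential p (P R) m"
  proof -
    have "potential p (\<lambda>j. (\<alpha> * own j + R j) + (-1) * P R j) m =
      potential p (\<lambda>j. \<alpha> * own j + R j) m + potential p (\<lambda>j. (-1) * P R j) m"
      by (intro potential_add p q)
    also have "potential p (\<lambda>j. \<alpha> * own j + R j) m = potential p (\<lambda>j. \<alpha> * own j) m + potential p R m"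
      by (intro potential_add p q)
    also have "potential p (\<lambda>j. \<alpha> * own j) m = \<alpha> * potential p own m" by (intro potential_cmult p q)
    also have "potential p (\<lambda>j. (-1) * P R j) m = (-1) * potential p (P R) m" by (intro potential_cmult p q)
    finally show ?thesis by simp
  qed
  also have "potential p R m = R m + p * P (potential p R) m" by (rule potential_unfold[OF p quad_bounded_R])
  also have "potential p (P R) m = P (potential p R) m" by (rule potential_P[OF p quad_bounded_R])
  finally show ?thesis by (simp add: algebra_simps)
qed

lemma visits_remainder:
  assumes p: "0 \<le> p" "p \<le> 1" and C: "0 \<le> C" "\<And>m. \<bar>R m\<bar> \<le> \<epsilon> * real m + C * pos m"
  shows "\<bar>visits p m - \<alpha> * potential p own m\<bar> \<le> (\<epsilon> * real m + C * pos m) + (1 - p) * (\<epsilon> * path_length m + C * mean_vertices m)"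
proof -
  let ?\<phi> = "\<lambda>m. \<epsilon> * real m + C * pos m"
  have \<phi>0: "0 \<le> ?\<phi> j" for j using C(2)[of j] by linarith
  have q: "quad_bounded ?\<phi>" by (intro quad_bounded_add quad_bounded_cmult quad_bounded_basic)
  have "\<bar>P (potential p R) m\<bar> \<le> P (\<lambda>j. \<bar>potential p R j\<bar>) m" by (rule P_abs)
  also have "\<dots> \<le> P (potential 1 ?\<phi>) m" by (intro P_mono potential_abs_le_pot p q C(2))
  also have "\<dots> \<le> potential 1 ?\<phi> m" using potential_unfold[of 1 ?\<phi> m] q \<phi>0[of m] by simp
  also have "\<dots> = \<epsilon> * path_length m + C * mean_vertices m"
    by (simp add: potential_add potential_cmult quad_bounded_cmult path_length_def mean_vertices_def)
  finally have "(1 - p) * \<bar>P (potential p R) m\<bar> \<le> (1 - p) * (\<epsilon> * path_length m + C * mean_vertices m)"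
    using p by (intro mult_left_mono) auto
  moreover have "\<bar>visits p m - \<alpha> * potential p own m\<bar> \<le> \<bar>R m\<bar> + (1 - p) * \<bar>P (potential p R) m\<bar>"
    unfolding visits_decomp[OF p] using p abs_triangle_ineq4[of "R m" "(1 - p) * P (potential p R) m"]
    by (simp add: abs_mult)
  ultimately show ?thesis using C(2)[of m] by linarith
qed

definition pn :: "nat \<Rightarrow> real" where "pn n = 1 - c / ln (real n)"

lemma pn_range: "\<forall>\<^sub>F n in sequentially. 0 < pn n \<and> pn n < 1 \<and> 1 < real n"
  unfolding pn_def using c_pos by (intro eventually_conj; real_asymp)

text \<open>
The error is uniform in the starting size \<open>m \<le> n\<close> although the percolation parameter is the one of
\<open>n\<close>: the sum of \<open>n\<^sub>u\<close> over all vertices has mean \<open>O(m ln m)\<close>, the remainders enter with the weight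
\<open>c / ln n\<close>, and \<open>ln m \<le> ln n\<close>.
\<close>

lemma visits_approx:
  assumes \<epsilon>: "0 < \<epsilon>"
  shows "\<exists>C\<ge>0. \<forall>\<^sub>F n in sequentially. \<forall>m\<le>n.
    \<bar>visits (pn n) m - \<alpha> * potential (pn n) own m\<bar> \<le> \<epsilon> * real m + C * pos m"
proof -
  obtain B where B: "0 \<le> B" "\<And>m. path_length m \<le> (1 + 1) / \<mu> * xlnx m + B * real m"
    using path_length_le[of 1] by auto
  obtain C2 where C2: "0 < C2" "\<And>m. mean_vertices m \<le> C2 * real m" using mean_vertices_le by blast
  define A where "A = 2 / \<mu>"
  have A: "0 < A" using mu_pos by (simp add: A_def)
  define \<epsilon>1 where "\<epsilon>1 = \<epsilon> / (2 + A * c + B)"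
  have den: "0 < 2 + A * c + B" using A B c_pos by (simp add: add_pos_nonneg)
  have \<epsilon>1: "0 < \<epsilon>1" "\<epsilon>1 * (2 + A * c + B) = \<epsilon>" using \<epsilon> den by (auto simp: \<epsilon>1_def)
  obtain C where C: "0 \<le> C" "\<And>m. \<bar>R m\<bar> \<le> \<epsilon>1 * real m + C * pos m" using R_le[OF \<epsilon>1(1)] by blast
  have "(\<lambda>n. c / ln (real n) * (C * C2)) \<longlonglongrightarrow> 0" by real_asymp
  then have "\<forall>\<^sub>F n in sequentially. c / ln (real n) * (C * C2) < \<epsilon>1"
    by (rule order_tendstoD) (use \<epsilon>1 in simp)
  with pn_range have "\<forall>\<^sub>F n in sequentially. \<forall>m\<le>n.
    \<bar>visits (pn n) m - \<alpha> * potential (pn n) own m\<bar> \<le> \<epsilon> * real m + C * pos m"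
  proof eventually_elim
    case (elim n)
    define \<delta> where "\<delta> = c / ln (real n)"
    have \<delta>: "0 < \<delta>" "\<delta> < 1" "pn n = 1 - \<delta>" using elim by (auto simp: \<delta>_def pn_def)
    show ?case
    proof (intro allI impI)
      fix m assume m: "m \<le> n"
      have lnm: "\<delta> * xlnx m \<le> c * real m"
      proof (cases "m = 0")
        case False
        have "\<delta> * ln (real m) \<le> \<delta> * ln (real n)" using m False \<delta> by (intro mult_left_mono) auto
        also have "\<dots> = c" using elim by (simp add: \<delta>_def)
        finally have "real m * (\<delta> * ln (real m)) \<le> real m * c" by (rule mult_left_mono) simp
        then show ?thesis by (simp add: xlnx_def algebra_simps)
      qed (simp add: xlnx_def)
      have "\<bar>visits (pn n) m - \<alpha> * potential (pn n) own m\<bar>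
        \<le> (\<epsilon>1 * real m + C * pos m) + (1 - pn n) * (\<epsilon>1 * path_length m + C * mean_vertices m)"
        using elim by (intro visits_remainder C) auto
      also have "(1 - pn n) * (\<epsilon>1 * path_length m + C * mean_vertices m) \<le> \<delta> * (\<epsilon>1 * (A * xlnx m + B * real m) + C * (C2 * real m))"
      proof -
        have "\<epsilon>1 * path_length m + C * mean_vertices m \<le> \<epsilon>1 * (A * xlnx m + B * real m) + C * (C2 * real m)"
        proof (rule add_mono)
          have "path_length m \<le> A * xlnx m + B * real m" using B(2)[of m] by (simp add: A_def)
          then show "\<epsilon>1 * path_length m \<le> \<epsilon>1 * (A * xlnx m + B * real m)" using \<epsilon>1(1) by simp
        qed (use C(1) C2(2) in \<open>simp add: mult_left_mono\<close>)
        then show ?thesis unfolding \<delta>(3) using \<delta>(1) by simp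
      qed
      also have "\<dots> = \<epsilon>1 * (A * (\<delta> * xlnx m) + \<delta> * (B * real m)) + \<delta> * (C * C2) * real m"
        by (simp add: algebra_simps)
      also have "\<dots> \<le> \<epsilon>1 * (A * (c * real m) + 1 * (B * real m)) + \<epsilon>1 * real m"
      proof -
        have 1: "A * (\<delta> * xlnx m) \<le> A * (c * real m)" using lnm A by simp
        have 2: "\<delta> * (B * real m) \<le> 1 * (B * real m)"
          using \<delta> B(1) by (intro mult_right_mono) auto
        have "\<epsilon>1 * (A * (\<delta> * xlnx m) + \<delta> * (B * real m)) \<le> \<epsilon>1 * (A * (c * real m) + 1 * (B * real m))"
          by (rule mult_left_mono[OF add_mono[OF 1 2]]) (use \<epsilon>1(1) in simp)
        moreover have "\<delta> * (C * C2) * real m \<le> \<epsilon>1 * real m"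
          using elim unfolding \<delta>_def[symmetric] by (intro mult_right_mono) auto
        ultimately show ?thesis by (rule add_mono)
      qed
      also have "(\<epsilon>1 * real m + C * pos m) + \<dots> = \<epsilon>1 * (2 + A * c + B) * real m + C * pos m"
        by (simp add: algebra_simps)
      finally show "\<bar>visits (pn n) m - \<alpha> * potential (pn n) own m\<bar> \<le> \<epsilon> * real m + C * pos m"
        unfolding \<epsilon>1(2) by simp
    qed
  qed
  then show ?thesis using C(1) by blast
qed

end

section \<open>Asymptotics of first and second moments\<close>

context linear_split_kernel
begin

definition limit :: real where "limit = exp (- c / \<mu>)"

lemma limit_pos: "0 < limit" by (simp add: limit_def)

lemma visits_lower:
  assumes \<epsilon>: "0 < \<epsilon>"
  shows "\<forall>\<^sub>F n in sequentially. (\<alpha> * limit - \<epsilon>) * real n \<le> visits (pn n) n"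
proof -
  \<comment> \<open>A third of \<open>\<epsilon>\<close> each for the limit of \<open>p powr x\<close>, for the approximation of vertices by balls, and
    for the additive constant.\<close>
  define e where "e = \<epsilon> / (3 * \<alpha>)"
  have e: "0 < e" "\<alpha> * e = \<epsilon> / 3" using \<epsilon> alpha_pos by (auto simp: e_def)
  have "((\<lambda>\<eta>. exp (- c * (1 + \<eta>) / \<mu>)) \<longlongrightarrow> exp (- c * (1 + 0) / \<mu>)) (at_right 0)"
    using mu_pos by (intro tendsto_intros) auto
  then have "\<forall>\<^sub>F \<eta> in at_right 0. limit - e < exp (- c * (1 + \<eta>) / \<mu>)"
    by (rule order_tendstoD) (use e in \<open>simp add: limit_def\<close>)
  then have "\<forall>\<^sub>F \<eta> in at_right 0. limit - e < exp (- c * (1 + \<eta>) / \<mu>) \<and> 0 < \<eta>"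
    using eventually_at_right_less[of "0::real"] by eventually_elim auto
  then obtain \<eta> where \<eta>: "limit - e < exp (- c * (1 + \<eta>) / \<mu>)" "0 < \<eta>"
    using eventually_happens'[OF trivial_limit_at_right_real] by blast
  obtain B where B: "0 \<le> B" "\<And>m. path_length m \<le> (1 + \<eta>) / \<mu> * xlnx m + B * real m"
    using path_length_le[OF \<eta>(2)] by blast
  define a where "a = (1 + \<eta>) / \<mu>"
  have a: "0 < a" using \<eta> mu_pos by (simp add: a_def)
  define x where "x n = a * ln (real n) + B" for n
  have "(\<lambda>n. pn n powr x n) \<longlonglongrightarrow> exp (- c * a)"
    unfolding pn_def x_def using c_pos a B(1) by real_asymp
  moreover have "limit - e < exp (- c * a)" using \<eta>(1) by (simp add: a_def)
  ultimately have "\<forall>\<^sub>F n in sequentially. limit - e < pn n powr x n" by (rule order_tendstoD)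
  moreover obtain C where "\<forall>\<^sub>F n in sequentially. \<forall>m\<le>n.
    \<bar>visits (pn n) m - \<alpha> * potential (pn n) own m\<bar> \<le> \<epsilon> / 3 * real m + C * pos m"
    using visits_approx[of "\<epsilon> / 3"] \<epsilon> by auto
  moreover have "\<forall>\<^sub>F n in sequentially. C \<le> \<epsilon> / 3 * real n"
    using \<epsilon> by real_asymp
  ultimately show ?thesis using pn_range
  proof eventually_elim
    case (elim n)
    have n: "1 < real n" "0 < n" using elim by auto
    have xn: "0 \<le> x n" unfolding x_def using a B n by (intro add_nonneg_nonneg mult_nonneg_nonneg) auto
    have "path_length n \<le> (x n + 1) * real n"
      using B(2)[of n] by (simp add: x_def a_def xlnx_def algebra_simps)
    then have "pn n powr x n * real n \<le> potential (pn n) own n"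
      using elim xn by (intro potential_own_ge) auto
    moreover have "(limit - e) * real n \<le> pn n powr x n * real n"
      using elim by (intro mult_right_mono) auto
    ultimately have "(limit - e) * real n \<le> potential (pn n) own n" by linarith
    then have "\<alpha> * ((limit - e) * real n) \<le> \<alpha> * potential (pn n) own n"
      using alpha_pos by (intro mult_left_mono) auto
    moreover have "\<alpha> * ((limit - e) * real n) = \<alpha> * limit * real n - \<epsilon> / 3 * real n"
      using e(2) by (simp add: algebra_simps)
    moreover have "\<bar>visits (pn n) n - \<alpha> * potential (pn n) own n\<bar> \<le> \<epsilon> / 3 * real n + C"
      using elim(2) n by (auto simp: pos_def)
    ultimately have "\<alpha> * limit * real n - \<epsilon> * real n \<le> visits (pn n) n"
      using elim(3) by linarith
    then show ?case by (simp add: algebra_simps)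
  qed
qed

lemma potential_own_upper:
  assumes \<kappa>: "0 < \<kappa>" "\<kappa> < 1 / \<mu>"
  shows "\<exists>A. A \<longlonglongrightarrow> 1 \<and> (\<forall>\<^sub>F n in sequentially. \<forall>m.
    potential (pn n) own m \<le> A n * real m powr (1 - \<kappa> * c / ln (real n)))"
proof -
  \<comment> \<open>Half of the slack \<open>1 - \<kappa> \<mu>\<close> is spent on the error \<open>\<eta>\<close> of the moment expansion, and \<open>q\<close> is what
    remains: \<open>\<kappa> (\<mu> + \<eta>) = 1 - q\<close>.\<close>
  define q where "q = (1 - \<kappa> * \<mu>) / 2"
  have km: "0 < \<kappa> * \<mu>" "\<kappa> * \<mu> < 1" using \<kappa> mu_pos by (auto simp: field_simps)
  have q: "0 < q" "q \<le> 1" using km by (auto simp: q_def)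
  define \<eta> where "\<eta> = q / \<kappa>"
  have \<eta>: "0 < \<eta>" "\<kappa> * (\<mu> + \<eta>) = 1 - q" using \<kappa> q by (auto simp: \<eta>_def q_def field_simps)
  obtain \<theta>0 where \<theta>0: "0 < \<theta>0" "\<theta>0 \<le> 1/2"
    "\<And>\<theta>. 0 < \<theta> \<Longrightarrow> \<theta> \<le> \<theta>0 \<Longrightarrow> real b * (\<integral>v. v 0 powr (1 - \<theta>) \<partial>D) \<le> 1 + \<theta> * (\<mu> + \<eta>)"
    using moment_le[OF \<eta>(1)] by blast
  define d where "d = real (s0 + b * s1 + s + 1)"
  have d: "0 < d" unfolding d_def by (simp only: of_nat_0_less_iff)
  define A where "A n = ((d / (q * (c / ln (real n))))\<^sup>2) powr (\<kappa> * c / ln (real n))" for n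
  have "A \<longlonglongrightarrow> 1" unfolding A_def using d q c_pos \<kappa> by real_asymp
  moreover have "\<forall>\<^sub>F n in sequentially. \<kappa> * c / ln (real n) < \<theta>0"
    using \<theta>0(1) c_pos \<kappa> by real_asymp
  then have "\<forall>\<^sub>F n in sequentially. \<forall>m. potential (pn n) own m \<le> A n * real m powr (1 - \<kappa> * c / ln (real n))"
    using pn_range
  proof eventually_elim
    case (elim n)
    define \<delta> where "\<delta> = c / ln (real n)"
    have \<delta>: "0 < \<delta>" "\<delta> < 1" "pn n = 1 - \<delta>" using elim by (auto simp: \<delta>_def pn_def)
    have \<theta>: "0 < \<kappa> * \<delta>" "\<kappa> * \<delta> < \<theta>0" using mult_pos_pos[OF \<kappa>(1) \<delta>(1)] elim by (auto simp: \<delta>_def)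
    have "real b * (\<integral>v. v 0 powr (1 - \<kappa> * \<delta>) \<partial>D) \<le> 1 + \<kappa> * \<delta> * (\<mu> + \<eta>)"
      using \<theta> by (intro \<theta>0(3)) auto
    also have "\<kappa> * \<delta> * (\<mu> + \<eta>) = \<kappa> * (\<mu> + \<eta>) * \<delta>" by simp
    finally have mom: "real b * (\<integral>v. v 0 powr (1 - \<kappa> * \<delta>) \<partial>D) \<le> 1 + (1 - q) * \<delta>" unfolding \<eta>(2) .
    have "potential (1 - \<delta>) own m \<le> ((d / (q * \<delta>))\<^sup>2) powr (\<kappa> * \<delta>) * real m powr (1 - \<kappa> * \<delta>)" for m
      unfolding d_def using \<theta> \<theta>0 by (intro potential_own_powr_le \<delta> q mom) auto
    then show ?case unfolding \<delta>(3) A_def by (simp add: \<delta>_def)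
  qed
  ultimately show ?thesis by blast
qed

lemma tau_quadratic: "\<exists>C. \<forall>p m. 0 \<le> p \<longrightarrow> p \<le> 1 \<longrightarrow> tau p m \<le> C * sq m"
proof -
  obtain C where C: "0 < C" "\<And>m. mean_vertices m \<le> C * real m" using mean_vertices_le by blast
  have "tau p m \<le> (1 + 2 * C + C\<^sup>2) * sq m" if p: "0 \<le> p" "p \<le> 1" for p m
  proof -
    have v: "visits p j \<le> C * real j" for j using visits_bounds(2)[OF p, of j] C(2)[of j] by linarith
    have v0: "0 \<le> visits p j" for j using visits_bounds(1)[OF p] .
    have "P (visits p) m \<le> P mean_vertices m" by (intro P_mono visits_bounds p)
    also have "\<dots> \<le> mean_vertices m" using mean_vertices_unfold[of m] pos_le(1)[of m] by simp
    also have "\<dots> \<le> C * real m" by (rule C(2))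
    also have "\<dots> \<le> C * sq m" using C(1) real_le_sq by simp
    finally have 1: "P (visits p) m \<le> C * sq m" .
    have 2: "P2 (visits p) m \<le> C\<^sup>2 * sq m" using C(1) v v0 by (intro P2_le_square) auto
    have "p * P (visits p) m \<le> 1 * (C * sq m)"
      using p 1 v0 by (intro mult_mono P_nonneg) auto
    moreover have "p\<^sup>2 * P2 (visits p) m \<le> 1 * (C\<^sup>2 * sq m)"
      using p 2 v0 by (intro mult_mono P2_nonneg) (auto simp: power_le_one)
    moreover have "pos m \<le> sq m" using pos_le(2)[of m] real_le_sq[of m] by linarith
    ultimately show ?thesis unfolding tau_def by (simp add: algebra_simps)
  qed
  then show ?thesis by blast
qed

lemma weighted_tau_sum: "\<exists>C. \<forall>n L. (\<Sum>l<L. real l * (P ^^ l) (tau 1) n) \<le> C * sq n"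
proof -
  obtain C where "\<forall>p m. 0 \<le> p \<longrightarrow> p \<le> 1 \<longrightarrow> tau p m \<le> C * sq m" using tau_quadratic by blast
  then have C: "tau 1 m \<le> C * sq m" for m by simp
  have abs: "\<bar>tau 1 j\<bar> \<le> C * sq j" for j using C tau_nonneg[of 1 j] by simp
  have C0: "0 \<le> C" using abs[of 1] by simp
  have s: "(\<lambda>l. real (Suc l) * (1 - \<gamma>) ^ l) sums (1 / (1 - (1 - \<gamma>))\<^sup>2)"
    using gamma_pos gamma_le by (intro geometric_deriv_sums) auto
  have "(\<Sum>l<L. real l * (P ^^ l) (tau 1) n) \<le> (C * (1 / (1 - (1 - \<gamma>))\<^sup>2)) * sq n" for n L
  proof -
    have "(\<Sum>l<L. real l * (P ^^ l) (tau 1) n) \<le> (\<Sum>l<L. real (Suc l) * (C * (1 - \<gamma>) ^ l * sq n))"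
    proof (intro sum_mono mult_mono)
      fix l show "(P ^^ l) (tau 1) n \<le> C * (1 - \<gamma>) ^ l * sq n"
        using Pk_quad_bounded[OF abs, of l n] by linarith
    qed (auto intro!: Pk_nonneg tau_nonneg)
    also have "\<dots> = C * sq n * (\<Sum>l<L. real (Suc l) * (1 - \<gamma>) ^ l)"
      unfolding sum_distrib_left by (intro sum.cong refl) (simp add: algebra_simps)
    also have "\<dots> \<le> C * sq n * (1 / (1 - (1 - \<gamma>))\<^sup>2)"
    proof (rule mult_left_mono)
      show "(\<Sum>l<L. real (Suc l) * (1 - \<gamma>) ^ l) \<le> 1 / (1 - (1 - \<gamma>))\<^sup>2"
        using sum_le_suminf[OF sums_summable[OF s], of "{..<L}"] sums_unique[OF s] gamma_le by simp
    qed (use C0 in simp)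
    finally show ?thesis by (simp only: mult.commute mult.left_commute)
  qed
  then show ?thesis by blast
qed

text \<open>
By \<open>visits_approx\<close> and \<open>potential_own_upper\<close>, \<open>visits\<close> is at most \<open>\<alpha> A h\<close> plus a small linear error, with
\<open>h m = m powr (1 - \<kappa> c / ln n)\<close> and \<open>A\<close> close to \<open>1\<close>.  The pair sums of \<open>h\<close> telescope to \<open>(h n)\<^sup>2\<close>, and
\<open>h n = n exp (- \<kappa> c)\<close>.
\<close>

lemma second_moment_upper:
  assumes \<epsilon>: "0 < \<epsilon>"
  shows "\<forall>\<^sub>F n in sequentially. \<forall>L. (\<Sum>l<L. pn n ^ l * (P ^^ l) (tau (pn n)) n)
    \<le> ((\<alpha> * limit)\<^sup>2 + \<epsilon>) * sq n"
proof -
  \<comment> \<open>Small enough that the quadratic error \<open>\<epsilon>2 m\<^sup>2\<close> of the pair functional, summed over the whole tree, is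
    at most \<open>\<epsilon> n\<^sup>2 / 4\<close>.\<close>
  define \<epsilon>1 where "\<epsilon>1 = min 1 (\<epsilon> * \<gamma> / (4 * (4 * \<alpha> + 1)))"
  have \<epsilon>1: "0 < \<epsilon>1" "\<epsilon>1 \<le> 1" using \<epsilon> gamma_pos alpha_pos by (auto simp: \<epsilon>1_def)
  define \<epsilon>2 where "\<epsilon>2 = 4 * \<alpha> * \<epsilon>1 + \<epsilon>1\<^sup>2"
  have \<epsilon>2: "0 \<le> \<epsilon>2" "\<epsilon>2 / \<gamma> \<le> \<epsilon> / 4"
  proof -
    show "0 \<le> \<epsilon>2" using \<epsilon>1 alpha_pos by (simp add: \<epsilon>2_def)
    have "\<epsilon>1\<^sup>2 \<le> \<epsilon>1" using \<epsilon>1 by (simp add: power2_eq_square mult_left_le_one_le)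
    then have "\<epsilon>2 \<le> (4 * \<alpha> + 1) * \<epsilon>1" by (simp add: \<epsilon>2_def algebra_simps)
    also have "\<dots> \<le> (4 * \<alpha> + 1) * (\<epsilon> * \<gamma> / (4 * (4 * \<alpha> + 1)))"
      using alpha_pos by (intro mult_left_mono) (auto simp: \<epsilon>1_def)
    also have "\<dots> = \<epsilon> * \<gamma> / 4" using alpha_pos by (simp add: field_simps)
    finally show "\<epsilon>2 / \<gamma> \<le> \<epsilon> / 4" using gamma_pos by (simp add: field_simps)
  qed
  have "((\<lambda>t. (\<alpha> * exp (- c * (1 / \<mu> - t)))\<^sup>2) \<longlongrightarrow> (\<alpha> * exp (- c * (1 / \<mu> - 0)))\<^sup>2) (at_right 0)"
    using mu_pos by (intro tendsto_intros)
  then have "\<forall>\<^sub>F t in at_right 0. (\<alpha> * exp (- c * (1 / \<mu> - t)))\<^sup>2 < (\<alpha> * limit)\<^sup>2 + \<epsilon> / 4"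
    by (rule order_tendstoD) (use \<epsilon> in \<open>simp add: limit_def\<close>)
  then have "\<forall>\<^sub>F t in at_right 0. (\<alpha> * exp (- c * (1 / \<mu> - t)))\<^sup>2 < (\<alpha> * limit)\<^sup>2 + \<epsilon> / 4 \<and> 0 < t \<and> t < 1 / \<mu>"
    using eventually_at_right_less[of "0::real"] eventually_at_right_field[of _ "0::real"] mu_pos
    by (intro eventually_conj) (auto simp: eventually_at_right_field intro!: exI[of _ "1 / \<mu>"])
  then obtain t where t: "(\<alpha> * exp (- c * (1 / \<mu> - t)))\<^sup>2 < (\<alpha> * limit)\<^sup>2 + \<epsilon> / 4" "0 < t" "t < 1 / \<mu>"
    using eventually_happens'[OF trivial_limit_at_right_real] by blast
  \<comment> \<open>The exponent must stay below \<open>1 / \<mu>\<close> for \<open>h\<close> to be a supersolution; \<open>t\<close> measures the loss.\<close>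
  define \<kappa> where "\<kappa> = 1 / \<mu> - t"
  have \<kappa>: "0 < \<kappa>" "\<kappa> < 1 / \<mu>" "(\<alpha> * exp (- c * \<kappa>))\<^sup>2 < (\<alpha> * limit)\<^sup>2 + \<epsilon> / 4"
    using t by (auto simp: \<kappa>_def)
  obtain A where A: "A \<longlonglongrightarrow> 1" "\<forall>\<^sub>F n in sequentially. \<forall>m.
    potential (pn n) own m \<le> A n * real m powr (1 - \<kappa> * c / ln (real n))"
    using potential_own_upper[OF \<kappa>(1,2)] by blast
  obtain C where C: "0 \<le> C" "\<forall>\<^sub>F n in sequentially. \<forall>m\<le>n.
    \<bar>visits (pn n) m - \<alpha> * potential (pn n) own m\<bar> \<le> \<epsilon>1 * real m + C * pos m"
    using visits_approx[OF \<epsilon>1(1)] by blast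
  obtain C2 where C2: "0 < C2" "\<And>m. mean_vertices m \<le> C2 * real m" using mean_vertices_le by blast
  obtain B where B: "0 \<le> B" "\<And>m. path_length m \<le> (1 + 1) / \<mu> * xlnx m + B * real m"
    using path_length_le[of 1] by auto
  define C4 where "C4 = 1 + 2 * C2 + (4 * \<alpha> * (b * C) + 2 * \<epsilon>1 * (b * C) + (b * C)\<^sup>2)"
  have C4: "0 \<le> C4" unfolding C4_def using C2 alpha_pos C(1) \<epsilon>1 by simp
  define \<theta> where "\<theta> n = \<kappa> * c / ln (real n)" for n
  define F where "F n = (\<alpha> * A n)\<^sup>2 * ((real n powr (- \<theta> n))\<^sup>2 + ((real b powr \<theta> n)\<^sup>2 - 1) / \<gamma>) + \<epsilon>2 / \<gamma>
     + C4 * ((1 + 1) / \<mu> * (ln (real n) / real n) + B / real n)" for n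
  define u1 u2 u3 u4 where "u1 n = real n powr (- \<theta> n)" and "u2 n = real b powr \<theta> n"
    and "u3 n = ln (real n) / real n" and "u4 n = B / real n" for n
  have bb: "0 < real b" using b_pos by simp
  have u: "u1 \<longlonglongrightarrow> exp (- c * \<kappa>)" "u2 \<longlonglongrightarrow> 1" "u3 \<longlonglongrightarrow> 0" "u4 \<longlonglongrightarrow> 0"
    unfolding u1_def u2_def u3_def u4_def \<theta>_def using c_pos \<kappa>(1) bb by real_asymp+
  have "(\<lambda>n. (\<alpha> * A n)\<^sup>2 * ((u1 n)\<^sup>2 + ((u2 n)\<^sup>2 - 1) / \<gamma>) + \<epsilon>2 / \<gamma> + C4 * ((1 + 1) / \<mu> * u3 n + u4 n))
    \<longlonglongrightarrow> (\<alpha> * 1)\<^sup>2 * ((exp (- c * \<kappa>))\<^sup>2 + (1\<^sup>2 - 1) / \<gamma>) + \<epsilon>2 / \<gamma> + C4 * ((1 + 1) / \<mu> * 0 + 0)"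
    using gamma_pos by (intro tendsto_intros A(1) u) auto
  then have "F \<longlonglongrightarrow> (\<alpha> * 1)\<^sup>2 * ((exp (- c * \<kappa>))\<^sup>2 + (1\<^sup>2 - 1) / \<gamma>) + \<epsilon>2 / \<gamma> + C4 * ((1 + 1) / \<mu> * 0 + 0)"
    unfolding F_def u1_def u2_def u3_def u4_def .
  then have "\<forall>\<^sub>F n in sequentially. F n < (\<alpha> * limit)\<^sup>2 + \<epsilon>"
  proof (rule order_tendstoD)
    have "(\<alpha> * 1)\<^sup>2 * ((exp (- c * \<kappa>))\<^sup>2 + (1\<^sup>2 - 1) / \<gamma>) + \<epsilon>2 / \<gamma> + C4 * ((1 + 1) / \<mu> * 0 + 0) =
      (\<alpha> * exp (- c * \<kappa>))\<^sup>2 + \<epsilon>2 / \<gamma>" by (simp add: power_mult_distrib)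
    also have "\<dots> < (\<alpha> * limit)\<^sup>2 + \<epsilon>" using \<kappa>(3) \<epsilon>2(2) \<epsilon> by linarith
    finally show "(\<alpha> * 1)\<^sup>2 * ((exp (- c * \<kappa>))\<^sup>2 + (1\<^sup>2 - 1) / \<gamma>) + \<epsilon>2 / \<gamma> + C4 * ((1 + 1) / \<mu> * 0 + 0)
      < (\<alpha> * limit)\<^sup>2 + \<epsilon>" .
  qed
  moreover have "\<forall>\<^sub>F n in sequentially. A n < 2" "\<forall>\<^sub>F n in sequentially. 0 < A n"
    using A(1) by (auto intro: order_tendstoD)
  moreover have "\<forall>\<^sub>F n in sequentially. \<theta> n < 1 / 2" "\<forall>\<^sub>F n in sequentially. 0 < \<theta> n"
    unfolding \<theta>_def using c_pos \<kappa>(1) by real_asymp+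
  ultimately show ?thesis using A(2) C(2) pn_range
  proof eventually_elim
    case (elim n)
    define h where "h m = real m powr (1 - \<theta> n)" for m
    have \<beta>: "0 < 1 - \<theta> n" "1 - \<theta> n \<le> 1" using elim by auto
    have p: "0 \<le> pn n" "pn n \<le> 1" using elim by auto
    have n: "0 < n" using elim by auto
    have h: "0 \<le> h m" "h m \<le> real m" for m using powr_le_self_nat[OF \<beta>] by (auto simp: h_def)
    have v0: "0 \<le> visits (pn n) j" for j using visits_bounds(1)[OF p] .
    have vC: "visits (pn n) j \<le> mean_vertices j" for j using visits_bounds(2)[OF p] .
    have vis: "visits (pn n) m \<le> (\<alpha> * A n) * h m + (\<epsilon>1 * real m + C * pos m)" if "m \<le> n" for m
    proof -
      have "potential (pn n) own m \<le> A n * h m" using elim by (simp add: h_def \<theta>_def)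
      then have "\<alpha> * potential (pn n) own m \<le> \<alpha> * (A n * h m)" using alpha_pos by (intro mult_left_mono) auto
      moreover have "\<bar>visits (pn n) m - \<alpha> * potential (pn n) own m\<bar> \<le> \<epsilon>1 * real m + C * pos m"
        using elim that by blast
      ultimately show ?thesis by (simp add: mult.assoc)
    qed
    have P2h: "0 \<le> P2 h m" for m using h by (intro P2_nonneg)
    have tau_le: "tau (pn n) m \<le> (\<alpha> * A n)\<^sup>2 * P2 h m + (\<epsilon>2 * sq m + C4 * real m)" if m: "m \<le> n" for m
    proof -
      have P2v: "P2 (visits (pn n)) m \<le> (\<alpha> * A n)\<^sup>2 * P2 h m + (\<epsilon>2 * sq m +
          (4 * \<alpha> * (b * C) + 2 * \<epsilon>1 * (b * C) + (b * C)\<^sup>2) * real m)"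
      proof (cases "s < m")
        case True
        have aA: "0 \<le> \<alpha> * A n" "2 * (\<alpha> * A n) \<le> 4 * \<alpha>" using alpha_pos elim by auto
        have "P2 (visits (pn n)) m \<le> (\<alpha> * A n)\<^sup>2 * P2 h m + ((2 * (\<alpha> * A n) * \<epsilon>1 + \<epsilon>1\<^sup>2) * sq m +
          (2 * (\<alpha> * A n) * (b * C) + 2 * \<epsilon>1 * (b * C) + (b * C)\<^sup>2) * real m)"
          using m aA \<epsilon>1 C(1) True by (intro P2_perturb v0 h vis) auto
        also have "\<dots> \<le> (\<alpha> * A n)\<^sup>2 * P2 h m + ((4 * \<alpha> * \<epsilon>1 + \<epsilon>1\<^sup>2) * sq m +
          (4 * \<alpha> * (b * C) + 2 * \<epsilon>1 * (b * C) + (b * C)\<^sup>2) * real m)"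
          using aA(2) \<epsilon>1(1) C(1) by (intro add_left_mono add_mono mult_right_mono add_right_mono) auto
        finally show ?thesis by (simp add: \<epsilon>2_def)
      next
        case False
        have "P2 (visits (pn n)) m = 0" using False visits_0[OF p] by (intro P2_leaf) auto
        moreover have "0 \<le> (\<alpha> * A n)\<^sup>2 * P2 h m + (\<epsilon>2 * sq m +
          (4 * \<alpha> * (b * C) + 2 * \<epsilon>1 * (b * C) + (b * C)\<^sup>2) * real m)"
          using P2h \<epsilon>2(1) alpha_pos C(1) \<epsilon>1 by (intro add_nonneg_nonneg mult_nonneg_nonneg) auto
        ultimately show ?thesis by simp
      qed
      have "P (visits (pn n)) m \<le> P mean_vertices m" by (intro P_mono vC)
      also have "\<dots> \<le> mean_vertices m" using mean_vertices_unfold[of m] pos_le(1)[of m] by simp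
      also have "\<dots> \<le> C2 * real m" by (rule C2(2))
      finally have "pn n * P (visits (pn n)) m \<le> 1 * (C2 * real m)"
        using p v0 by (intro mult_mono P_nonneg) auto
      moreover have "(pn n)\<^sup>2 * P2 (visits (pn n)) m \<le> 1 * P2 (visits (pn n)) m"
        using p v0 by (intro mult_right_mono P2_nonneg) (auto simp: power_le_one)
      ultimately show ?thesis using P2v pos_le(2)[of m] unfolding tau_def C4_def by (simp add: algebra_simps)
    qed
    show ?case
    proof
      fix L
      have "(\<Sum>l<L. pn n ^ l * (P ^^ l) (tau (pn n)) n) \<le> (\<Sum>l<L. 1 * (P ^^ l) (tau (pn n)) n)"
        using p by (intro sum_mono mult_right_mono Pk_nonneg tau_nonneg) (auto simp: power_le_one)
      also have "\<dots> \<le> (\<Sum>l<L. 1 * (P ^^ l) (\<lambda>m. (\<alpha> * A n)\<^sup>2 * P2 h m + (\<epsilon>2 * sq m + C4 * real m)) n)"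
        by (intro sum_mono mult_left_mono Pk_mono tau_le) auto
      also have "\<dots> = (\<alpha> * A n)\<^sup>2 * (\<Sum>l<L. (P ^^ l) (P2 h) n) + (\<epsilon>2 * (\<Sum>l<L. 1 ^ l * (P ^^ l) sq n)
          + C4 * (\<Sum>l<L. 1 ^ l * (P ^^ l) real n))"
        by (simp add: Pk_add Pk_cmult sum.distrib sum_distrib_left)
      also have "\<dots> \<le> (\<alpha> * A n)\<^sup>2 * ((h n)\<^sup>2 + ((real b powr \<theta> n)\<^sup>2 - 1) * (sq n / \<gamma>)) + (\<epsilon>2 * (sq n / \<gamma>)
          + C4 * ((1 + 1) / \<mu> * xlnx n + B * real n))"
      proof (intro add_mono mult_left_mono)
        show "(\<Sum>l<L. (P ^^ l) (P2 h) n) \<le> (h n)\<^sup>2 + ((real b powr \<theta> n)\<^sup>2 - 1) * (sq n / \<gamma>)"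
          using sum_P2_powr_le[OF \<beta>, of n L] by (simp add: h_def[abs_def])
        have "(\<Sum>l<L. 1 ^ l * (P ^^ l) sq n) \<le> potential 1 sq n" by (intro partial_le_pot) auto
        also have "\<dots> \<le> sq n / \<gamma>" using potential_abs_le[of 1 sq 1 n] by simp
        finally show "(\<Sum>l<L. 1 ^ l * (P ^^ l) sq n) \<le> sq n / \<gamma>" .
        have "(\<Sum>l<L. 1 ^ l * (P ^^ l) real n) \<le> path_length n" unfolding path_length_def by (intro partial_le_pot) auto
        then show "(\<Sum>l<L. 1 ^ l * (P ^^ l) real n) \<le> (1 + 1) / \<mu> * xlnx n + B * real n"
          using B(2)[of n] by linarith
      qed (use \<epsilon>2 C4 in auto)
      also have "\<dots> = F n * sq n"
      proof -
        have "h n = real n * real n powr (- \<theta> n)" using n unfolding h_def by (simp add: powr_diff powr_minus field_simps)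
        then have h2: "(h n)\<^sup>2 = (real n powr (- \<theta> n))\<^sup>2 * sq n" by (simp add: power_mult_distrib)
        have x: "(1 + 1) / \<mu> * xlnx n + B * real n = ((1 + 1) / \<mu> * (ln (real n) / real n) + B / real n) * sq n"
          using n by (simp add: xlnx_def power2_eq_square field_simps)
        show ?thesis unfolding h2 x F_def by (simp add: algebra_simps diff_divide_distrib)
      qed
      also have "\<dots> \<le> ((\<alpha> * limit)\<^sup>2 + \<epsilon>) * sq n" using elim by (intro mult_right_mono) auto
      finally show "(\<Sum>l<L. pn n ^ l * (P ^^ l) (tau (pn n)) n) \<le> ((\<alpha> * limit)\<^sup>2 + \<epsilon>) * sq n" .
    qed
  qed
qed

end

section \<open>The joint law of the ball counts\<close>

lemma nn_integral_countable_valued: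
  fixes X :: "'a \<Rightarrow> 'b"
  assumes S: "countable S" "\<And>\<omega>. \<omega> \<in> space M \<Longrightarrow> X \<omega> \<in> S"
    and meas: "\<And>x. x \<in> S \<Longrightarrow> {\<omega> \<in> space M. X \<omega> = x} \<in> sets M"
    and F: "\<And>x. x \<in> S \<Longrightarrow> F x \<in> borel_measurable M"
  shows "(\<integral>\<^sup>+\<omega>. F (X \<omega>) \<omega> \<partial>M) =
    (\<integral>\<^sup>+x. (\<integral>\<^sup>+\<omega>. F x \<omega> * indicator {\<omega> \<in> space M. X \<omega> = x} \<omega> \<partial>M) \<partial>count_space S)"
proof -
  have "(\<integral>\<^sup>+\<omega>. F (X \<omega>) \<omega> \<partial>M) =
    (\<integral>\<^sup>+\<omega>. (\<integral>\<^sup>+x. F x \<omega> * indicator {\<omega> \<in> space M. X \<omega> = x} \<omega> \<partial>count_space S) \<partial>M)"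
  proof (rule nn_integral_cong)
    fix \<omega> assume \<omega>: "\<omega> \<in> space M"
    have "(\<integral>\<^sup>+x. F x \<omega> * indicator {\<omega> \<in> space M. X \<omega> = x} \<omega> \<partial>count_space S)
      = (\<Sum>x\<in>{X \<omega>}. F x \<omega> * indicator {\<omega> \<in> space M. X \<omega> = x} \<omega>)"
      using S(2)[OF \<omega>] by (intro nn_integral_count_space') (auto simp: indicator_def)
    then show "F (X \<omega>) \<omega> = (\<integral>\<^sup>+x. F x \<omega> * indicator {\<omega> \<in> space M. X \<omega> = x} \<omega> \<partial>count_space S)"
      using \<omega> by simp
  qed
  also have "\<dots> = (\<integral>\<^sup>+x. (\<integral>\<^sup>+\<omega>. F x \<omega> * indicator {\<omega> \<in> space M. X \<omega> = x} \<omega> \<partial>M) \<partial>count_space S)"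
    using meas F by (intro nn_integral_count_space_nn_integral S) (auto intro!: borel_measurable_times_ennreal borel_measurable_indicator)
  finally show ?thesis .
qed

locale split_tree_model = split_kernel b s s0 s1 D + random_split_tree M b s s0 s1 D n V balls
  for M :: "'w measure" and b s s0 s1 D n V balls
begin

lemma V_measurable [measurable]: "u \<in> vertices b \<Longrightarrow> V u \<in> measurable M (vec_space b)"
  using V_indep unfolding indep_vars_def by blast

lemma balls_measurable' [measurable]: "u \<in> vertices b \<Longrightarrow> balls u \<in> measurable M (count_space UNIV)"
  by (rule balls_measurable)

abbreviation past :: "nat list \<Rightarrow> 'w measure" where "past \<equiv> past_of M b V balls"

lemma past_gen: 
  "{V w -` A \<inter> space M | w A. w \<in> vertices b \<and> A \<in> sets (vec_space b)} \<union>
   {balls w -` B \<inter> space M | w B. w \<in> vertices b \<and> \<not> strict_prefix u w} \<subseteq> sets M"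
proof -
  have "balls w -` B \<inter> space M \<in> sets M" if "w \<in> vertices b" for w B
    by (rule measurable_sets[OF balls_measurable'[OF that]]) simp
  then show ?thesis using measurable_sets[OF V_measurable] by blast
qed

lemma space_past [simp]: "space (past u) = space M"
  unfolding past_of_def by (rule space_measure_of) (use past_gen sets.space_closed in blast)

lemma sets_past: "sets (past u) = sigma_sets (space M)
   ({V w -` A \<inter> space M | w A. w \<in> vertices b \<and> A \<in> sets (vec_space b)} \<union>
    {balls w -` B \<inter> space M | w B. w \<in> vertices b \<and> \<not> strict_prefix u w})"
  unfolding past_of_def by (rule sets_measure_of) (use past_gen sets.space_closed in blast)

lemma subalgebra_past: "subalgebra M (past u)"
  unfolding subalgebra_def sets_past using sets.sigma_sets_subset[OF past_gen] by auto

lemma sigma_finite_past: "sigma_finite_subalgebra M (past u)"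
  by (intro finite_measure_subalgebra_is_sigma_finite finite_measure_subalgebra.intro
      finite_measure_axioms finite_measure_subalgebra_axioms.intro subalgebra_past)

lemma V_measurable_past: "w \<in> vertices b \<Longrightarrow> V w \<in> measurable (past u) (vec_space b)"
proof (rule measurableI)
  fix A assume "w \<in> vertices b" "A \<in> sets (vec_space b)"
  then show "V w -` A \<inter> space (past u) \<in> sets (past u)"
    unfolding sets_past space_past by (intro sigma_sets.Basic) blast
qed (use measurable_space[OF V_measurable] in auto)

lemma balls_measurable_past:
  "w \<in> vertices b \<Longrightarrow> \<not> strict_prefix u w \<Longrightarrow> balls w \<in> measurable (past u) (count_space UNIV)"
proof (rule measurableI)
  fix B assume "w \<in> vertices b" "\<not> strict_prefix u w"
  then show "balls w -` B \<inter> space (past u) \<in> sets (past u)"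
    unfolding sets_past space_past by (intro sigma_sets.Basic) blast
qed auto

text \<open>
Agrees with \<open>children_prob\<close> for almost all split vectors and is bounded everywhere, so that it can be
integrated without side conditions.
\<close>

definition clamped_prob :: "nat \<Rightarrow> (nat \<Rightarrow> nat) \<Rightarrow> (nat \<Rightarrow> real) \<Rightarrow> real" where
  "clamped_prob m a v = max 0 (min 1 (children_prob b s s0 s1 m v a))"

lemma clamped_prob_bounds: "0 \<le> clamped_prob m a v" "clamped_prob m a v \<le> 1"
  by (auto simp: clamped_prob_def)

lemma clamped_prob_measurable [measurable]: "clamped_prob m a \<in> borel_measurable (vec_space b)"
  unfolding clamped_prob_def children_prob_def multinomial_prob_def by measurable

lemma clamped_prob_eq: "\<forall>i<b. 0 \<le> v i \<Longrightarrow> (\<Sum>i<b. v i) = 1 \<Longrightarrow> clamped_prob m a v = children_prob b s s0 s1 m v a"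
  unfolding clamped_prob_def using children_prob_nonneg[of v m a] children_prob_le_1[of v m a] by auto

lemma integral_clamped: "(\<integral>v. clamped_prob m a v \<partial>D) = children_law m a"
  unfolding children_law_def
proof (rule integral_cong_AE)
  show "AE v in D. clamped_prob m a v = children_prob b s s0 s1 m v a"
    using AE_simplex by eventually_elim (simp add: clamped_prob_eq)
  show "clamped_prob m a \<in> borel_measurable D"
    using clamped_prob_measurable measurable_cong_sets[OF sets_D refl] by blast
qed measurable

lemma AE_V_simplex: "u \<in> vertices b \<Longrightarrow> AE \<omega> in M. (\<forall>i<b. 0 \<le> V u \<omega> i) \<and> (\<Sum>i<b. V u \<omega> i) = 1"
proof -
  assume u: "u \<in> vertices b"
  have "AE v in distr M (vec_space b) (V u). (\<forall>i<b. 0 \<le> v i) \<and> (\<Sum>i<b. v i) = 1"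
    unfolding V_law[OF u] by (rule AE_simplex)
  then show ?thesis using u by (subst (asm) AE_distr_iff) auto
qed

definition child_event :: "nat list \<Rightarrow> (nat \<Rightarrow> nat) \<Rightarrow> 'w set" where
  "child_event u a = {\<omega> \<in> space M. \<forall>i<b. balls (u @ [i]) \<omega> = a i}"

lemma child_event_sets [measurable]: "u \<in> vertices b \<Longrightarrow> child_event u a \<in> sets M"
  unfolding child_event_def by measurable

text \<open>
The defining property of the conditional law, tested against a bounded function of the past.
\<close>

lemma one_split:
  assumes u: "u \<in> vertices b" and f: "f \<in> borel_measurable (past u)"
    and f01: "\<And>\<omega>. 0 \<le> f \<omega>" "\<And>\<omega>. f \<omega> \<le> (1::real)"
  shows "(\<integral>\<omega>. f \<omega> * indicator (child_event u a) \<omega> \<partial>M) =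
    (\<integral>\<omega>. f \<omega> * clamped_prob (balls u \<omega>) a (V u \<omega>) \<partial>M)"
proof -
  interpret sigma_finite_subalgebra M "past u" by (rule sigma_finite_past)
  have fM [measurable]: "f \<in> borel_measurable M" by (rule measurable_from_subalg[OF subalgebra_past f])
  have int: "integrable M (\<lambda>\<omega>. f \<omega> * indicator (child_event u a) \<omega>)"
    by (rule integrable_const_bound[where B = 1])
       (use u f01 in \<open>auto simp: indicator_def\<close>)
  have ind: "(indicator (child_event u a) :: 'w \<Rightarrow> real) \<in> borel_measurable M" using u by measurable
  have "(\<integral>\<omega>. f \<omega> * indicator (child_event u a) \<omega> \<partial>M) =
     (\<integral>\<omega>. f \<omega> * real_cond_exp M (past u) (indicator (child_event u a)) \<omega> \<partial>M)"
    by (rule real_cond_exp_intg(2)[OF int f ind, symmetric])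
  also have "\<dots> = (\<integral>\<omega>. f \<omega> * clamped_prob (balls u \<omega>) a (V u \<omega>) \<partial>M)"
  proof (rule integral_cong_AE)
    show "AE \<omega> in M. f \<omega> * real_cond_exp M (past u) (indicator (child_event u a)) \<omega> =
      f \<omega> * clamped_prob (balls u \<omega>) a (V u \<omega>)"
      using balls_split[OF u, of a] AE_V_simplex[OF u] unfolding child_event_def
      by eventually_elim (simp add: clamped_prob_eq)
    show "(\<lambda>\<omega>. f \<omega> * clamped_prob (balls u \<omega>) a (V u \<omega>)) \<in> borel_measurable M"
    proof -
      have "(\<lambda>\<omega>. clamped_prob (balls u \<omega>) a (V u \<omega>)) \<in> borel_measurable M"
      proof (rule measurable_compose_countable[where g = "balls u" and f = "\<lambda>m \<omega>. clamped_prob m a (V u \<omega>)"])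
        show "(\<lambda>\<omega>. clamped_prob m a (V u \<omega>)) \<in> borel_measurable M" for m
          using u by measurable
      qed (use u in measurable)
      then show ?thesis by measurable
    qed
  qed measurable
  finally show ?thesis .
qed

text \<open>
The event that \<open>a\<close> records the ball counts at the root and at all children of vertices in \<open>J\<close>.
\<close>

definition config :: "nat list set \<Rightarrow> (nat list \<Rightarrow> nat) \<Rightarrow> 'w set" where
  "config J a = {\<omega> \<in> space M. balls [] \<omega> = a [] \<and> (\<forall>u\<in>J. \<forall>i\<in>{..<b}. balls (u @ [i]) \<omega> = a (u @ [i]))}"

definition closed_words :: "nat list set \<Rightarrow> bool" where
  "closed_words J \<longleftrightarrow> (\<forall>w i. w @ [i] \<in> J \<longrightarrow> w \<in> J)"

lemma config_measurable_past:
  assumes J: "finite J" "J \<subseteq> vertices b" and u: "\<And>w i. w \<in> J \<Longrightarrow> \<not> strict_prefix u (w @ [i])"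
  shows "config J a \<in> sets (past u)"
proof -
  have m: "{\<omega> \<in> space (past u). balls w \<omega> = k} \<in> sets (past u)" if "w \<in> vertices b" "\<not> strict_prefix u w" for w k
  proof -
    have "balls w -` {k} \<inter> space (past u) \<in> sets (past u)"
      by (rule measurable_sets[OF balls_measurable_past[OF that]]) simp
    moreover have "balls w -` {k} \<inter> space (past u) = {\<omega> \<in> space (past u). balls w \<omega> = k}" by auto
    ultimately show ?thesis by simp
  qed
  have "{\<omega> \<in> space (past u). balls [] \<omega> = a [] \<and> (\<forall>w\<in>J. \<forall>i\<in>{..<b}. balls (w @ [i]) \<omega> = a (w @ [i]))} \<in> sets (past u)"
    using J u by (intro sets.sets_Collect_conj sets.sets_Collect_finite_All m) auto
  then show ?thesis by (simp add: config_def)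
qed

lemma config_sets: "finite J \<Longrightarrow> J \<subseteq> vertices b \<Longrightarrow> config J a \<in> sets M"
proof -
  assume J: "finite J" "J \<subseteq> vertices b"
  have m: "{\<omega> \<in> space M. balls w \<omega> = k} \<in> sets M" if "w \<in> vertices b" for w k
    using that by measurable
  have "{\<omega> \<in> space M. balls [] \<omega> = a [] \<and> (\<forall>w\<in>J. \<forall>i\<in>{..<b}. balls (w @ [i]) \<omega> = a (w @ [i]))} \<in> sets M"
    using J by (intro sets.sets_Collect_conj sets.sets_Collect_finite_All m) auto
  then show ?thesis by (simp add: config_def)
qed

text \<open>
The ball counts and the split vectors factorise.  The functions \<open>f w\<close> are test functions of the split
vectors; carrying them through the induction is what proves that the vectors not yet used are
independent of the ball counts revealed so far.  The induction removes a deepest vertex \<open>u\<close> of \<open>J\<close>: the rest of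
the configuration then lies in the past of \<open>u\<close>, and its transition probability is absorbed
into \<open>f u\<close>.
\<close>

lemma config_law:
  assumes "finite J" "J \<subseteq> U" "closed_words J" and U: "finite U" "U \<subseteq> vertices b"
    and f: "\<And>w. w \<in> U \<Longrightarrow> f w \<in> borel_measurable (vec_space b)"
    and f01: "\<And>w v. 0 \<le> f w v" "\<And>w v. f w v \<le> (1::real)"
  shows "(\<integral>\<omega>. indicator (config J a) \<omega> * (\<Prod>w\<in>U. f w (V w \<omega>)) \<partial>M) =
    of_bool (a [] = n) * (\<Prod>w\<in>U. \<integral>v. (if w \<in> J then clamped_prob (a w) (\<lambda>i. a (w @ [i])) v else 1) * f w v \<partial>D)"
  using assms(1-3) f f01
proof (induction "card J" arbitrary: J f)
  case 0
  then have J: "J = {}" by simp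
  have fD: "f w \<in> borel_measurable D" if "w \<in> U" for w
    using 0(5)[OF that] measurable_cong_sets[OF sets_D refl] by blast
  have fV: "(\<lambda>\<omega>. f w (V w \<omega>)) \<in> borel_measurable M" if "w \<in> U" for w
    using that U by (intro measurable_compose[OF V_measurable 0(5)]) auto
  have prodV: "(\<lambda>\<omega>. \<Prod>w\<in>U. f w (V w \<omega>)) \<in> borel_measurable M"
    by (intro borel_measurable_prod fV)
  have "(\<integral>\<omega>. indicator (config J a) \<omega> * (\<Prod>w\<in>U. f w (V w \<omega>)) \<partial>M) =
    (\<integral>\<omega>. of_bool (a [] = n) * (\<Prod>w\<in>U. f w (V w \<omega>)) \<partial>M)"
  proof (rule integral_cong_AE)
    show "AE \<omega> in M. indicator (config J a) \<omega> * (\<Prod>w\<in>U. f w (V w \<omega>)) = of_bool (a [] = n) * (\<Prod>w\<in>U. f w (V w \<omega>))"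
      using balls_root AE_space by eventually_elim (simp add: config_def J indicator_def of_bool_def)
    show "(\<lambda>\<omega>. indicator (config J a) \<omega> * (\<Prod>w\<in>U. f w (V w \<omega>))) \<in> borel_measurable M"
      using config_sets[of J a] by (intro borel_measurable_times borel_measurable_indicator prodV) (simp add: J)
    show "(\<lambda>\<omega>. of_bool (a [] = n) * (\<Prod>w\<in>U. f w (V w \<omega>))) \<in> borel_measurable M"
      by (intro borel_measurable_times prodV) simp
  qed
  also have "\<dots> = of_bool (a [] = n) * (\<integral>\<omega>. (\<Prod>w\<in>U. f w (V w \<omega>)) \<partial>M)" by simp
  also have "(\<integral>\<omega>. (\<Prod>w\<in>U. f w (V w \<omega>)) \<partial>M) = (\<Prod>w\<in>U. \<integral>\<omega>. f w (V w \<omega>) \<partial>M)"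
  proof (rule indep_vars_lebesgue_integral[OF U(1)])
    show "indep_vars (\<lambda>_. borel) (\<lambda>w \<omega>. f w (V w \<omega>)) U"
      by (rule indep_vars_compose2[OF indep_vars_subset[OF V_indep U(2)]]) (use 0 in auto)
    show "integrable M (\<lambda>\<omega>. f w (V w \<omega>))" if "w \<in> U" for w
      by (rule integrable_const_bound[where B = 1])
         (use fV[OF that] 0(6,7) in auto)
  qed
  also have "\<dots> = (\<Prod>w\<in>U. \<integral>v. f w v \<partial>D)"
  proof (rule prod.cong[OF refl])
    fix w assume w: "w \<in> U"
    then have wv: "w \<in> vertices b" using U by auto
    have "(\<integral>v. f w v \<partial>D) = (\<integral>v. f w v \<partial>distr M (vec_space b) (V w))" by (simp only: V_law[OF wv])
    also have "\<dots> = (\<integral>\<omega>. f w (V w \<omega>) \<partial>M)" by (rule integral_distr[OF V_measurable[OF wv] 0(5)[OF w]])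
    finally show "(\<integral>\<omega>. f w (V w \<omega>) \<partial>M) = (\<integral>v. f w v \<partial>D)" ..
  qed
  finally show ?case by (simp add: J)
next
  case (Suc k)
  have "J \<noteq> {}" using Suc.hyps(2) by auto
  obtain u where u: "u \<in> J" "\<And>w. w \<in> J \<Longrightarrow> length w \<le> length u"
  proof -
    have "Max (length ` J) \<in> length ` J" using Suc.prems(1) \<open>J \<noteq> {}\<close> by (intro Max_in) auto
    then obtain u where "u \<in> J" "length u = Max (length ` J)" by (metis imageE)
    then show ?thesis using that[of u] Suc.prems(1) by simp
  qed
  define J' where "J' = J - {u}"
  have uv: "u \<in> vertices b" and uU: "u \<in> U" using u Suc.prems(2) U by auto
  have J': "finite J'" "J' \<subseteq> U" "card J' = k" "u \<notin> J'" "J = insert u J'" "J' \<subseteq> vertices b"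
    using Suc.prems(1,2) Suc.hyps(2) u U by (auto simp: J'_def)
  have closed: "closed_words J'"
    unfolding closed_words_def J'_def
  proof (intro allI impI)
    fix w i assume "w @ [i] \<in> J - {u}"
    then show "w \<in> J - {u}" using Suc.prems(3) u(2)[of "w @ [i]"] by (auto simp: closed_words_def)
  qed
  have below: "\<not> strict_prefix u (w @ [i])" if "w \<in> J'" for w i
  proof
    assume "strict_prefix u (w @ [i])"
    then have "prefix u w" by (auto simp: strict_prefix_def)
    then obtain zs where zs: "w = u @ zs" by (auto simp: prefix_def)
    moreover have "length w \<le> length u" using u(2) that J'(5) by simp
    ultimately have "w = u" by simp
    then show False using that J'(4) by simp
  qed
  let ?c = "\<lambda>i. a (u @ [i])"
  define g where "g \<omega> = indicator (config J' a) \<omega> * (\<Prod>w\<in>U. f w (V w \<omega>))" for \<omega>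
  define f' where "f' = f(u := \<lambda>v. clamped_prob (a u) ?c v * f u v)"
  have "(\<integral>\<omega>. indicator (config J a) \<omega> * (\<Prod>w\<in>U. f w (V w \<omega>)) \<partial>M) =
    (\<integral>\<omega>. g \<omega> * indicator (child_event u ?c) \<omega> \<partial>M)"
    by (intro Bochner_Integration.integral_cong)
       (auto simp: g_def indicator_def config_def child_event_def J'(5))
  also have "\<dots> = (\<integral>\<omega>. g \<omega> * clamped_prob (balls u \<omega>) ?c (V u \<omega>) \<partial>M)"
  proof (rule one_split[OF uv])
    have "config J' a \<in> sets (past u)" using J' below by (intro config_measurable_past) auto
    then show "g \<in> borel_measurable (past u)"
      unfolding g_def using U Suc.prems(4)
      by (intro borel_measurable_times borel_measurable_indicator borel_measurable_prod
          measurable_compose[OF V_measurable_past]) auto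
    show "0 \<le> g \<omega>" for \<omega> unfolding g_def by (intro mult_nonneg_nonneg prod_nonneg) (auto simp: Suc.prems(5))
    show "g \<omega> \<le> 1" for \<omega> 
    proof -
      have "(\<Prod>w\<in>U. f w (V w \<omega>)) \<le> 1" by (intro prod_le_1) (auto simp: Suc.prems(5,6))
      then show ?thesis by (simp add: g_def indicator_def)
    qed
  qed
  also have "\<dots> = (\<integral>\<omega>. indicator (config J' a) \<omega> * (\<Prod>w\<in>U. f' w (V w \<omega>)) \<partial>M)"
  proof (rule Bochner_Integration.integral_cong[OF refl])
    fix \<omega> assume "\<omega> \<in> space M"
    have P: "(\<Prod>w\<in>U. f' w (V w \<omega>)) = clamped_prob (a u) ?c (V u \<omega>) * (\<Prod>w\<in>U. f w (V w \<omega>))"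
      using U(1) uU by (simp add: prod.remove[of U u] f'_def)
    have "balls u \<omega> = a u" if "\<omega> \<in> config J' a"
    proof (cases u rule: rev_cases)
      case Nil
      then show ?thesis using that by (simp add: config_def)
    next
      case (snoc w i)
      then have "w \<in> J" using Suc.prems(3) u(1) unfolding closed_words_def by blast
      then have "w \<in> J'" using snoc by (auto simp: J'_def)
      then show ?thesis using that snoc uv by (auto simp: config_def)
    qed
    then show "g \<omega> * clamped_prob (balls u \<omega>) ?c (V u \<omega>) = indicator (config J' a) \<omega> * (\<Prod>w\<in>U. f' w (V w \<omega>))"
      unfolding P g_def by (auto simp: indicator_def)
  qed
  also have "\<dots> = of_bool (a [] = n) * (\<Prod>w\<in>U. \<integral>v. (if w \<in> J' then clamped_prob (a w) (\<lambda>i. a (w @ [i])) v else 1) * f' w v \<partial>D)"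
  proof (rule Suc.hyps(1))
    show "f' w \<in> borel_measurable (vec_space b)" if "w \<in> U" for w
      unfolding f'_def using Suc.prems(4)[OF that] Suc.prems(4)[OF uU] by auto
    show "0 \<le> f' w v" "f' w v \<le> 1" for w v
      unfolding f'_def fun_upd_def
      by (auto simp: Suc.prems(5,6) clamped_prob_bounds intro!: mult_le_one mult_nonneg_nonneg)
  qed (use J' closed in auto)
  also have "(\<Prod>w\<in>U. \<integral>v. (if w \<in> J' then clamped_prob (a w) (\<lambda>i. a (w @ [i])) v else 1) * f' w v \<partial>D) =
    (\<Prod>w\<in>U. \<integral>v. (if w \<in> J then clamped_prob (a w) (\<lambda>i. a (w @ [i])) v else 1) * f w v \<partial>D)"
    using J'(4) by (intro prod.cong refl Bochner_Integration.integral_cong) (auto simp: J'(5) f'_def)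
  finally show ?case .
qed

lemma config_prob:
  assumes "finite J" "J \<subseteq> vertices b" "closed_words J"
  shows "prob (config J a) = of_bool (a [] = n) * (\<Prod>w\<in>J. children_law (a w) (\<lambda>i. a (w @ [i])))"
  using config_law[of J J "\<lambda>_ _. 1" a] assms config_sets[OF assms(1,2), of a]
  by (simp add: integral_clamped)

lemma config_prob_insert:
  assumes "finite J" "insert u J \<subseteq> vertices b" "closed_words J" "closed_words (insert u J)" "u \<notin> J"
  shows "prob (config (insert u J) a) = prob (config J a) * children_law (a u) (\<lambda>i. a (u @ [i]))"
  using assms by (simp add: config_prob)

end

section \<open>First moments along the tree\<close>

definition words :: "nat \<Rightarrow> nat \<Rightarrow> nat list set" where
  "words b N = {x \<in> vertices b. length x < N}"

lemma words_0: "words b 0 = {}" by (simp add: words_def)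

lemma words_Suc: "words b (Suc N) = insert [] (\<Union>i<b. (#) i ` words b N)"
proof (intro set_eqI iffI)
  fix x assume "x \<in> words b (Suc N)"
  then show "x \<in> insert [] (\<Union>i<b. (#) i ` words b N)"
    by (cases x) (auto simp: words_def)
qed (auto simp: words_def)

lemma finite_words [simp]: "finite (words b N)"
  by (induction N) (auto simp: words_0 words_Suc)

lemma sum_words_Suc:
  "(\<Sum>x\<in>words b (Suc N). f x) = f [] + (\<Sum>i<b. \<Sum>x\<in>words b N. f (i # x))"
proof -
  have "(\<Sum>x\<in>words b (Suc N). f x) = f [] + (\<Sum>x\<in>(\<Union>i<b. (#) i ` words b N). f x)"
    unfolding words_Suc by (subst sum.insert) auto
  also have "(\<Sum>x\<in>(\<Union>i<b. (#) i ` words b N). f x) = (\<Sum>i<b. \<Sum>x\<in>(#) i ` words b N. f x)"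
    by (intro sum.UNION_disjoint) auto
  also have "\<dots> = (\<Sum>i<b. \<Sum>x\<in>words b N. f (i # x))"
    by (rule sum.cong[OF refl]) (simp add: sum.reindex)
  finally show ?thesis .
qed

lemma words_vertices: "x \<in> words b N \<Longrightarrow> x \<in> vertices b" by (simp add: words_def)

definition level :: "nat \<Rightarrow> nat \<Rightarrow> nat list set" where
  "level b k = {x \<in> vertices b. length x = k}"

lemma level_0: "level b 0 = {[]}" by (auto simp: level_def)

lemma level_Suc: "level b (Suc k) = (\<lambda>(x, i). x @ [i]) ` (level b k \<times> {..<b})"
proof (intro set_eqI iffI)
  fix x assume x: "x \<in> level b (Suc k)"
  show "x \<in> (\<lambda>(x, i). x @ [i]) ` (level b k \<times> {..<b})"
    using x by (cases x rule: rev_cases) (auto simp: level_def image_iff)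
qed (auto simp: level_def)

lemma finite_level [simp]: "finite (level b k)"
  by (induction k) (auto simp: level_0 level_Suc)

lemma sum_level_Suc:
  "(\<Sum>x\<in>level b (Suc k). f x) = (\<Sum>x\<in>level b k. \<Sum>i<b. f (x @ [i]))"
  unfolding level_Suc by (subst sum.reindex) (auto simp: inj_on_def sum.cartesian_product case_prod_unfold)

lemma sum_words_levels: "(\<Sum>x\<in>words b N. f x) = (\<Sum>r<N. \<Sum>x\<in>level b r. f x)"
proof (induction N)
  case (Suc N)
  have "words b (Suc N) = words b N \<union> level b N" "words b N \<inter> level b N = {}"
    by (auto simp: words_def level_def)
  then show ?case using Suc by (simp add: sum.union_disjoint)
qed (simp add: words_0)

lemma level_vertices: "x \<in> level b k \<Longrightarrow> x \<in> vertices b" by (simp add: level_def)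

lemma not_strict_prefix_append: "\<not> strict_prefix z w \<Longrightarrow> \<not> strict_prefix (z @ x) w"
  by (auto simp: strict_prefix_def prefix_def)

context split_tree_model
begin

definition occ :: "nat list \<Rightarrow> 'w \<Rightarrow> real" where "occ u \<omega> = pos (balls u \<omega>)"

text \<open>
The Markov property used everywhere below.  The count of one further vertex \<open>w\<close> that does not lie
strictly below \<open>u\<close> may be carried along; this is how the independence of disjoint sub-trees
enters.
\<close>

lemma children_step:
  fixes \<Psi> :: "nat \<Rightarrow> nat \<Rightarrow> ennreal" and \<Phi> :: "(nat \<Rightarrow> nat) \<Rightarrow> real"
  assumes u: "u \<in> vertices b" and w: "w \<in> vertices b" "\<not> strict_prefix u w" and \<Phi>: "\<And>a. 0 \<le> \<Phi> a"
  shows "(\<integral>\<^sup>+\<omega>. \<Psi> (balls u \<omega>) (balls w \<omega>) * ennreal (\<Phi> (\<lambda>i\<in>{..<b}. balls (u @ [i]) \<omega>)) \<partial>M) =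
   (\<integral>\<^sup>+\<omega>. \<Psi> (balls u \<omega>) (balls w \<omega>) * ennreal (K \<Phi> (balls u \<omega>)) \<partial>M)"
proof -
  \<comment> \<open>Splitting these vertices determines the counts of \<open>u\<close> and \<open>w\<close>, and \<open>u\<close> itself is not among them.\<close>
  define J where "J = {v. strict_prefix v u} \<union> {v. strict_prefix v w}"
  have finJ: "finite J"
  proof (rule finite_subset)
    show "J \<subseteq> set (prefixes u) \<union> set (prefixes w)" by (auto simp: J_def strict_prefix_def)
  qed simp
  have Jv: "insert u J \<subseteq> vertices b"
  proof -
    have "v \<in> vertices b" if "strict_prefix v x" "x \<in> vertices b" for v x
      using that set_mono_prefix[of v x] by (auto simp: strict_prefix_def in_lists_conv_set)
    then show ?thesis using u w by (auto simp: J_def)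
  qed
  have uJ: "u \<notin> J" using w by (simp add: J_def)
  have par: "strict_prefix v x" if "strict_prefix (v @ [i]) x" for v x :: "nat list" and i
    using that by (auto simp: strict_prefix_def prefix_def)
  have closed: "closed_words J" "closed_words (insert u J)"
  proof -
    have "strict_prefix v (v @ [i])" for v :: "nat list" and i by (simp add: strict_prefix_def)
    then show "closed_words J" "closed_words (insert u J)"
      using par unfolding closed_words_def J_def by blast+
  qed
  define C where "C = insert [] ((\<lambda>(v, i). v @ [i]) ` (J \<times> {..<b}))"
  have finC: "finite C" using finJ by (simp add: C_def)
  have inC: "x \<in> C" if "x \<in> vertices b" "\<And>v. strict_prefix v x \<Longrightarrow> v \<in> J" for x
  proof (cases x rule: rev_cases)
    case (snoc v i)
    then have "v \<in> J" using that(2)[of v] by (simp add: strict_prefix_def)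
    then show ?thesis using that(1) snoc by (auto simp: C_def image_iff)
  qed (simp add: C_def)
  have uC: "u \<in> C" and wC: "w \<in> C" using u w by (auto intro!: inC simp: J_def)
  have notC: "u @ [i] \<notin> C" for i using uJ by (auto simp: C_def)
  define S where "S = C \<rightarrow>\<^sub>E (UNIV :: nat set)"
  define S' where "S' = {..<b} \<rightarrow>\<^sub>E (UNIV :: nat set)"
  have cS: "countable S" "countable S'" using finC by (auto simp: S_def S'_def intro!: countable_PiE)
  define Z where "Z \<omega> = restrict (\<lambda>v. balls v \<omega>) C" for \<omega>
  define Y where "Y \<omega> = (\<lambda>i\<in>{..<b}. balls (u @ [i]) \<omega>)" for \<omega>
  have ZS: "Z \<omega> \<in> S" and YS: "Y \<omega> \<in> S'" for \<omega> by (auto simp: Z_def Y_def S_def S'_def)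
  have Zeq: "{\<omega> \<in> space M. Z \<omega> = z} = config J z" if "z \<in> S" for z
  proof -
    have "Z \<omega> = z \<longleftrightarrow> (\<forall>v\<in>C. balls v \<omega> = z v)" for \<omega>
      using that unfolding Z_def S_def by (auto simp: fun_eq_iff PiE_iff extensional_def restrict_def)
    then show ?thesis by (auto simp: config_def C_def)
  qed
  have Yeq: "{\<omega> \<in> space M. Y \<omega> = y} = child_event u y" if "y \<in> S'" for y
  proof -
    have "Y \<omega> = y \<longleftrightarrow> (\<forall>i<b. balls (u @ [i]) \<omega> = y i)" for \<omega>
      using that unfolding Y_def S'_def by (auto simp: fun_eq_iff PiE_iff extensional_def restrict_def)
    then show ?thesis by (auto simp: child_event_def)
  qed
  have confM: "config J z \<in> sets M" for z using Jv finJ by (intro config_sets) auto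
  have YM: "Y \<in> measurable M (count_space S')"
    unfolding measurable_count_space_eq_countable[OF cS(2)]
  proof (intro conjI ballI)
    fix y assume y: "y \<in> S'"
    have "Y -` {y} \<inter> space M = {\<omega> \<in> space M. Y \<omega> = y}" by auto
    then show "Y -` {y} \<inter> space M \<in> sets M" using Yeq[OF y] u by simp
  qed (use YS in auto)
  have joint: "emeasure M (config J z \<inter> child_event u y) = emeasure M (config J z) * ennreal (children_law (z u) y)"
    if "z \<in> S" "y \<in> S'" for z y
  proof -
    \<comment> \<open>One function for the values on \<open>C\<close> and those at the children of \<open>u\<close>; the latter lie outside \<open>C\<close>.\<close>
    define z' where "z' v = (if v \<in> C then z v else y (last v))" for v
    have z': "z' [] = z []" "\<And>v i. v \<in> J \<Longrightarrow> i < b \<Longrightarrow> z' (v @ [i]) = z (v @ [i])" "\<And>i. z' (u @ [i]) = y i"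
      using notC by (auto simp: z'_def C_def)
    have "config J z \<inter> child_event u y = config (insert u J) z'"
      using z' by (auto simp: config_def child_event_def)
    moreover have "config J z' = config J z" using z' by (auto simp: config_def)
    moreover have "(\<lambda>i. z' (u @ [i])) = y" using notC by (auto simp: z'_def)
    moreover have "z' u = z u" using uC by (simp add: z'_def)
    ultimately have "prob (config J z \<inter> child_event u y) = prob (config J z) * children_law (z u) y"
      using config_prob_insert[OF finJ Jv closed uJ, of z'] by simp
    then show ?thesis by (simp add: emeasure_eq_measure ennreal_mult'' children_law_nonneg)
  qed
  have sumK: "(\<integral>\<^sup>+y. ennreal (\<Phi> y) * ennreal (children_law m y) \<partial>count_space S') = ennreal (K \<Phi> m)" for m
  proof -
    have "(\<integral>\<^sup>+y. ennreal (\<Phi> y) * ennreal (children_law m y) \<partial>count_space S') =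
      (\<Sum>y\<in>profiles b m. ennreal (\<Phi> y) * ennreal (children_law m y))"
    proof (rule nn_integral_count_space')
      fix y assume y: "y \<in> S'" "y \<notin> profiles b m"
      then have "\<exists>i<b. \<not> y i \<le> m" by (auto simp: S'_def PiE_iff)
      then have "children_law m y = 0" using children_law_support(3)[of m y] by blast
      then show "ennreal (\<Phi> y) * ennreal (children_law m y) = 0" by simp
    qed (auto simp: S'_def)
    also have "\<dots> = (\<Sum>y\<in>profiles b m. ennreal (children_law m y * \<Phi> y))"
      using \<Phi> children_law_nonneg by (intro sum.cong refl) (simp add: ennreal_mult mult.commute)
    also have "\<dots> = ennreal (K \<Phi> m)"
      unfolding K_def using \<Phi> children_law_nonneg by (intro sum_ennreal mult_nonneg_nonneg)
    finally show ?thesis .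
  qed
  have "(\<integral>\<^sup>+\<omega>. \<Psi> (balls u \<omega>) (balls w \<omega>) * ennreal (\<Phi> (\<lambda>i\<in>{..<b}. balls (u @ [i]) \<omega>)) \<partial>M) =
    (\<integral>\<^sup>+\<omega>. \<Psi> (Z \<omega> u) (Z \<omega> w) * ennreal (\<Phi> (Y \<omega>)) \<partial>M)"
    using uC wC by (simp add: Z_def Y_def)
  also have "\<dots> = (\<integral>\<^sup>+z. (\<integral>\<^sup>+\<omega>. \<Psi> (z u) (z w) * ennreal (\<Phi> (Y \<omega>)) * indicator {\<omega> \<in> space M. Z \<omega> = z} \<omega> \<partial>M) \<partial>count_space S)"
  proof (rule nn_integral_countable_valued[OF cS(1) ZS])
    show "{\<omega> \<in> space M. Z \<omega> = z} \<in> sets M" if "z \<in> S" for z using Zeq[OF that] confM by simp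
    show "(\<lambda>\<omega>. \<Psi> (z u) (z w) * ennreal (\<Phi> (Y \<omega>))) \<in> borel_measurable M" for z
      by (rule measurable_compose[OF YM]) simp
  qed
  also have "\<dots> = (\<integral>\<^sup>+z. \<Psi> (z u) (z w) * ennreal (K \<Phi> (z u)) * emeasure M (config J z) \<partial>count_space S)"
  proof (rule nn_integral_cong)
    fix z assume "z \<in> space (count_space S)"
    then have z: "z \<in> S" by simp
    have "(\<integral>\<^sup>+\<omega>. \<Psi> (z u) (z w) * ennreal (\<Phi> (Y \<omega>)) * indicator {\<omega> \<in> space M. Z \<omega> = z} \<omega> \<partial>M) =
      (\<integral>\<^sup>+y. (\<integral>\<^sup>+\<omega>. \<Psi> (z u) (z w) * ennreal (\<Phi> y) * indicator (config J z) \<omega> * indicator {\<omega> \<in> space M. Y \<omega> = y} \<omega> \<partial>M) \<partial>count_space S')"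
      unfolding Zeq[OF z]
    proof (rule nn_integral_countable_valued[OF cS(2) YS])
      show "{\<omega> \<in> space M. Y \<omega> = y} \<in> sets M" if "y \<in> S'" for y using Yeq[OF that] u by simp
      show "(\<lambda>\<omega>. \<Psi> (z u) (z w) * ennreal (\<Phi> y) * indicator (config J z) \<omega>) \<in> borel_measurable M" for y
        using confM by (intro borel_measurable_times_ennreal borel_measurable_indicator) auto
    qed
    also have "\<dots> = (\<integral>\<^sup>+y. (\<Psi> (z u) (z w) * emeasure M (config J z)) * (ennreal (\<Phi> y) * ennreal (children_law (z u) y)) \<partial>count_space S')"
    proof (rule nn_integral_cong)
      fix y assume "y \<in> space (count_space S')"
      then have y: "y \<in> S'" by simp
      have "(\<integral>\<^sup>+\<omega>. \<Psi> (z u) (z w) * ennreal (\<Phi> y) * indicator (config J z) \<omega> * indicator {\<omega> \<in> space M. Y \<omega> = y} \<omega> \<partial>M)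
        = (\<integral>\<^sup>+\<omega>. (\<Psi> (z u) (z w) * ennreal (\<Phi> y)) * indicator (config J z \<inter> child_event u y) \<omega> \<partial>M)"
        unfolding Yeq[OF y] by (simp add: indicator_inter_arith mult.assoc)
      also have "\<dots> = (\<Psi> (z u) (z w) * ennreal (\<Phi> y)) * emeasure M (config J z \<inter> child_event u y)"
        using confM u by (intro nn_integral_cmult_indicator) auto
      finally show "(\<integral>\<^sup>+\<omega>. \<Psi> (z u) (z w) * ennreal (\<Phi> y) * indicator (config J z) \<omega> * indicator {\<omega> \<in> space M. Y \<omega> = y} \<omega> \<partial>M)
        = (\<Psi> (z u) (z w) * emeasure M (config J z)) * (ennreal (\<Phi> y) * ennreal (children_law (z u) y))"
        unfolding joint[OF z y] by (simp add: mult_ac)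
    qed
    also have "\<dots> = (\<Psi> (z u) (z w) * emeasure M (config J z)) * ennreal (K \<Phi> (z u))"
      by (subst nn_integral_cmult) (simp_all add: sumK)
    finally show "(\<integral>\<^sup>+\<omega>. \<Psi> (z u) (z w) * ennreal (\<Phi> (Y \<omega>)) * indicator {\<omega> \<in> space M. Z \<omega> = z} \<omega> \<partial>M) =
      \<Psi> (z u) (z w) * ennreal (K \<Phi> (z u)) * emeasure M (config J z)" by (simp add: mult_ac)
  qed
  also have "\<dots> = (\<integral>\<^sup>+z. (\<integral>\<^sup>+\<omega>. \<Psi> (z u) (z w) * ennreal (K \<Phi> (z u)) * indicator {\<omega> \<in> space M. Z \<omega> = z} \<omega> \<partial>M) \<partial>count_space S)"
    by (intro nn_integral_cong) (use Zeq confM in \<open>simp add: nn_integral_cmult_indicator\<close>)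
  also have "\<dots> = (\<integral>\<^sup>+\<omega>. \<Psi> (Z \<omega> u) (Z \<omega> w) * ennreal (K \<Phi> (Z \<omega> u)) \<partial>M)"
  proof (rule nn_integral_countable_valued[OF cS(1) ZS, symmetric])
    show "{\<omega> \<in> space M. Z \<omega> = z} \<in> sets M" if "z \<in> S" for z using Zeq[OF that] confM by simp
  qed simp
  also have "\<dots> = (\<integral>\<^sup>+\<omega>. \<Psi> (balls u \<omega>) (balls w \<omega>) * ennreal (K \<Phi> (balls u \<omega>)) \<partial>M)"
    using uC wC by (simp add: Z_def)
  finally show ?thesis .
qed

lemma fun_balls_ennreal: "u \<in> vertices b \<Longrightarrow> (\<lambda>\<omega>. (f (balls u \<omega>) :: ennreal)) \<in> borel_measurable M"
  by (rule measurable_compose[OF balls_measurable']) auto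

lemma fun_balls_real: "u \<in> vertices b \<Longrightarrow> (\<lambda>\<omega>. (f (balls u \<omega>) :: real)) \<in> borel_measurable M"
  by (rule measurable_compose[OF balls_measurable']) auto

text \<open>
Induction on the depth, splitting the vertices of the last level.
\<close>

lemma level_step:
  fixes \<Psi> :: "nat \<Rightarrow> ennreal"
  assumes z: "z \<in> vertices b" and w: "w \<in> vertices b" "\<not> strict_prefix z w" and \<phi>: "\<And>m. 0 \<le> \<phi> m"
  shows "(\<integral>\<^sup>+\<omega>. \<Psi> (balls w \<omega>) * (\<Sum>x\<in>level b k. ennreal (\<phi> (balls (z @ x) \<omega>))) \<partial>M) =
    (\<integral>\<^sup>+\<omega>. \<Psi> (balls w \<omega>) * ennreal ((P ^^ k) \<phi> (balls z \<omega>)) \<partial>M)"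
  using \<phi>
proof (induction k arbitrary: \<phi>)
  case 0
  then show ?case by (simp add: level_0)
next
  case (Suc k)
  have P0: "0 \<le> P \<phi> m" for m using Suc.prems by (intro P_nonneg)
  have v: "z @ x \<in> vertices b" if "x \<in> level b k" for x using z level_vertices[OF that] by auto
  have "(\<integral>\<^sup>+\<omega>. \<Psi> (balls w \<omega>) * (\<Sum>x\<in>level b (Suc k). ennreal (\<phi> (balls (z @ x) \<omega>))) \<partial>M) =
    (\<integral>\<^sup>+\<omega>. (\<Sum>x\<in>level b k. \<Psi> (balls w \<omega>) * ennreal (\<Sum>i<b. \<phi> (balls ((z @ x) @ [i]) \<omega>))) \<partial>M)"
    using Suc.prems by (simp add: sum_level_Suc sum_distrib_left flip: sum_ennreal)
  also have "\<dots> = (\<Sum>x\<in>level b k. \<integral>\<^sup>+\<omega>. \<Psi> (balls w \<omega>) * ennreal (\<Sum>i<b. \<phi> (balls ((z @ x) @ [i]) \<omega>)) \<partial>M)"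
    using v w by (intro nn_integral_sum borel_measurable_times_ennreal fun_balls_ennreal
        measurable_compose[OF borel_measurable_sum measurable_ennreal] fun_balls_real) auto
  also have "\<dots> = (\<Sum>x\<in>level b k. \<integral>\<^sup>+\<omega>. \<Psi> (balls w \<omega>) * ennreal (P \<phi> (balls (z @ x) \<omega>)) \<partial>M)"
  proof (intro sum.cong refl)
    fix x assume x: "x \<in> level b k"
    show "(\<integral>\<^sup>+\<omega>. \<Psi> (balls w \<omega>) * ennreal (\<Sum>i<b. \<phi> (balls ((z @ x) @ [i]) \<omega>)) \<partial>M) =
      (\<integral>\<^sup>+\<omega>. \<Psi> (balls w \<omega>) * ennreal (P \<phi> (balls (z @ x) \<omega>)) \<partial>M)"
      using children_step[OF v[OF x] w(1) not_strict_prefix_append[OF w(2)], of "\<lambda>a. \<Sum>i<b. \<phi> (a i)" "\<lambda>_. \<Psi>"]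
        Suc.prems unfolding P_def by (simp add: sum_nonneg)
  qed
  also have "\<dots> = (\<integral>\<^sup>+\<omega>. \<Psi> (balls w \<omega>) * (\<Sum>x\<in>level b k. ennreal (P \<phi> (balls (z @ x) \<omega>))) \<partial>M)"
    unfolding sum_distrib_left using v w
    by (intro nn_integral_sum[symmetric] borel_measurable_times_ennreal fun_balls_ennreal) auto
  also have "\<dots> = (\<integral>\<^sup>+\<omega>. \<Psi> (balls w \<omega>) * ennreal ((P ^^ k) (P \<phi>) (balls z \<omega>)) \<partial>M)"
    by (rule Suc.IH[OF P0])
  finally show ?case by (simp add: funpow_swap1)
qed

text \<open>
The number of vertices below \<open>z\<close> at relative depth less than \<open>N\<close>, weighted by \<open>p\<close> to the depth.
\<close>

definition weighted_count :: "real \<Rightarrow> nat \<Rightarrow> nat list \<Rightarrow> 'w \<Rightarrow> real" where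
  "weighted_count p N z \<omega> = (\<Sum>x\<in>words b N. p ^ length x * occ (z @ x) \<omega>)"

definition visits_upto :: "real \<Rightarrow> nat \<Rightarrow> nat \<Rightarrow> real" where
  "visits_upto p N m = (\<Sum>r<N. p ^ r * (P ^^ r) pos m)"

lemma occ_bounds: "0 \<le> occ u \<omega>" "occ u \<omega> \<le> 1" by (auto simp: occ_def pos_le)

lemma weighted_count_nonneg: "0 \<le> p \<Longrightarrow> 0 \<le> weighted_count p N z \<omega>"
  unfolding weighted_count_def by (intro sum_nonneg mult_nonneg_nonneg occ_bounds) auto

lemma visits_upto_nonneg: "0 \<le> p \<Longrightarrow> 0 \<le> visits_upto p N m"
  unfolding visits_upto_def by (intro sum_nonneg mult_nonneg_nonneg Pk_nonneg) (auto simp: pos_le)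

lemma visits_upto_le: "0 \<le> p \<Longrightarrow> p \<le> 1 \<Longrightarrow> visits_upto p N m \<le> visits p m"
  unfolding visits_upto_def visits_def by (intro partial_le_pot) (auto simp: pos_le)

lemma occ_measurable: "u \<in> vertices b \<Longrightarrow> occ u \<in> borel_measurable M"
  unfolding occ_def[abs_def] by (rule fun_balls_real)

lemma weighted_count_measurable: "z \<in> vertices b \<Longrightarrow> weighted_count p N z \<in> borel_measurable M"
  unfolding weighted_count_def[abs_def]
  by (intro borel_measurable_sum borel_measurable_times occ_measurable) (auto dest: words_vertices)

lemma weighted_count_step:
  fixes \<Psi> :: "nat \<Rightarrow> ennreal"
  assumes z: "z \<in> vertices b" and w: "w \<in> vertices b" "\<not> strict_prefix z w" and p: "0 \<le> p"
  shows "(\<integral>\<^sup>+\<omega>. \<Psi> (balls w \<omega>) * ennreal (weighted_count p N z \<omega>) \<partial>M) =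
    (\<integral>\<^sup>+\<omega>. \<Psi> (balls w \<omega>) * ennreal (visits_upto p N (balls z \<omega>)) \<partial>M)"
proof -
  have v: "z @ x \<in> vertices b" if "x \<in> level b k" for x k using z level_vertices[OF that] by auto
  have nn: "0 \<le> p ^ r * pos m" "0 \<le> p ^ r * (P ^^ r) pos m" for r m
    using p by (auto intro!: mult_nonneg_nonneg Pk_nonneg simp: pos_le)
  have "ennreal (weighted_count p N z \<omega>) = (\<Sum>r<N. \<Sum>x\<in>level b r. ennreal (p ^ r * pos (balls (z @ x) \<omega>)))" for \<omega>
  proof -
    have "weighted_count p N z \<omega> = (\<Sum>r<N. \<Sum>x\<in>level b r. p ^ r * pos (balls (z @ x) \<omega>))"
      unfolding weighted_count_def sum_words_levels occ_def by (intro sum.cong refl) (simp add: level_def)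
    then show ?thesis using nn by (simp add: sum_nonneg flip: sum_ennreal)
  qed
  then have "(\<integral>\<^sup>+\<omega>. \<Psi> (balls w \<omega>) * ennreal (weighted_count p N z \<omega>) \<partial>M) =
    (\<integral>\<^sup>+\<omega>. (\<Sum>r<N. \<Psi> (balls w \<omega>) * (\<Sum>x\<in>level b r. ennreal (p ^ r * pos (balls (z @ x) \<omega>)))) \<partial>M)"
    by (simp add: sum_distrib_left)
  also have "\<dots> = (\<Sum>r<N. \<integral>\<^sup>+\<omega>. \<Psi> (balls w \<omega>) * (\<Sum>x\<in>level b r. ennreal (p ^ r * pos (balls (z @ x) \<omega>))) \<partial>M)"
    using v w by (intro nn_integral_sum borel_measurable_times_ennreal borel_measurable_sum fun_balls_ennreal) auto
  also have "\<dots> = (\<Sum>r<N. \<integral>\<^sup>+\<omega>. \<Psi> (balls w \<omega>) * ennreal (p ^ r * (P ^^ r) pos (balls z \<omega>)) \<partial>M)"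
  proof (intro sum.cong refl)
    fix r
    show "(\<integral>\<^sup>+\<omega>. \<Psi> (balls w \<omega>) * (\<Sum>x\<in>level b r. ennreal (p ^ r * pos (balls (z @ x) \<omega>))) \<partial>M) =
      (\<integral>\<^sup>+\<omega>. \<Psi> (balls w \<omega>) * ennreal (p ^ r * (P ^^ r) pos (balls z \<omega>)) \<partial>M)"
      using level_step[OF z w, of "\<lambda>m. p ^ r * pos m" \<Psi> r] nn by (simp add: Pk_cmult)
  qed
  also have "\<dots> = (\<integral>\<^sup>+\<omega>. (\<Sum>r<N. \<Psi> (balls w \<omega>) * ennreal (p ^ r * (P ^^ r) pos (balls z \<omega>))) \<partial>M)"
    using z w by (intro nn_integral_sum[symmetric] borel_measurable_times_ennreal fun_balls_ennreal)
  also have "\<dots> = (\<integral>\<^sup>+\<omega>. \<Psi> (balls w \<omega>) * ennreal (visits_upto p N (balls z \<omega>)) \<partial>M)"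
    unfolding visits_upto_def using nn by (simp add: sum_distrib_left flip: sum_ennreal)
  finally show ?thesis .
qed

lemma weighted_count_mean:
  assumes "0 \<le> p"
  shows "(\<integral>\<^sup>+\<omega>. ennreal (weighted_count p N [] \<omega>) \<partial>M) = ennreal (visits_upto p N n)"
proof -
  have "(\<integral>\<^sup>+\<omega>. ennreal (weighted_count p N [] \<omega>) \<partial>M) = (\<integral>\<^sup>+\<omega>. ennreal (visits_upto p N (balls [] \<omega>)) \<partial>M)"
    using weighted_count_step[of "[]" "[]" p "\<lambda>_. 1"] assms by simp
  also have "\<dots> = (\<integral>\<^sup>+\<omega>. ennreal (visits_upto p N n) \<partial>M)"
    by (rule nn_integral_cong_AE) (use balls_root in eventually_elim, simp)
  finally show ?thesis by (simp add: emeasure_space_1)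
qed

text \<open>
Two applications of the Markov property, one for each of two distinct children.
\<close>

lemma weighted_count_pair_step:
  assumes z: "z \<in> vertices b" and ij: "i < b" "j < b" "i \<noteq> j" and p: "0 \<le> p"
  shows "(\<integral>\<^sup>+\<omega>. ennreal (weighted_count p N (z @ [i]) \<omega> * weighted_count p N (z @ [j]) \<omega>) \<partial>M) =
    (\<integral>\<^sup>+\<omega>. ennreal (visits_upto p N (balls (z @ [i]) \<omega>) * visits_upto p N (balls (z @ [j]) \<omega>)) \<partial>M)"
proof -
  have zi: "z @ [i] \<in> vertices b" and zj: "z @ [j] \<in> vertices b" using z ij by auto
  have nsp: "\<not> strict_prefix (z @ [i]) (z @ j # y)" "\<not> strict_prefix (z @ [j]) (z @ [i])" for y
    using ij by (auto simp: strict_prefix_def prefix_def append_eq_append_conv2)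
  have m: "(\<lambda>\<omega>. ennreal (f \<omega>)) \<in> borel_measurable M" if "f \<in> borel_measurable M" for f :: "'w \<Rightarrow> real"
    using that by measurable
  have gj: "weighted_count p N (z @ [j]) \<omega> = (\<Sum>y\<in>words b N. p ^ length y * pos (balls (z @ j # y) \<omega>))" for \<omega>
    by (simp add: weighted_count_def occ_def)
  have pn: "0 \<le> p ^ k * pos m" for k m using p pos_le(1)[of m] by simp
  have vy: "z @ j # y \<in> vertices b" if "y \<in> words b N" for y using z ij words_vertices[OF that] by auto
    have dist: "ennreal (g * (\<Sum>y\<in>words b N. f y)) = (\<Sum>y\<in>words b N. ennreal (f y) * ennreal g)"
      if "0 \<le> g" "\<And>y. 0 \<le> f y" for g :: real and f
    proof -
      have "(\<Sum>y\<in>words b N. ennreal (f y) * ennreal g) = (\<Sum>y\<in>words b N. ennreal (f y * g))"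
        using that by (intro sum.cong refl) (simp add: ennreal_mult)
      also have "\<dots> = ennreal (\<Sum>y\<in>words b N. f y * g)" using that by (intro sum_ennreal) simp
      finally show ?thesis by (simp add: sum_distrib_left mult.commute)
    qed
  have "(\<integral>\<^sup>+\<omega>. ennreal (weighted_count p N (z @ [i]) \<omega> * weighted_count p N (z @ [j]) \<omega>) \<partial>M) =
    (\<integral>\<^sup>+\<omega>. (\<Sum>y\<in>words b N. ennreal (p ^ length y * pos (balls (z @ j # y) \<omega>)) * ennreal (weighted_count p N (z @ [i]) \<omega>)) \<partial>M)"
    unfolding gj using dist weighted_count_nonneg[OF p] pn by simp
  also have "\<dots> = (\<Sum>y\<in>words b N. \<integral>\<^sup>+\<omega>. ennreal (p ^ length y * pos (balls (z @ j # y) \<omega>)) * ennreal (weighted_count p N (z @ [i]) \<omega>) \<partial>M)"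
    using vy zi by (intro nn_integral_sum borel_measurable_times_ennreal fun_balls_ennreal m weighted_count_measurable)
  also have "\<dots> = (\<Sum>y\<in>words b N. \<integral>\<^sup>+\<omega>. ennreal (p ^ length y * pos (balls (z @ j # y) \<omega>)) * ennreal (visits_upto p N (balls (z @ [i]) \<omega>)) \<partial>M)"
    using vy by (intro sum.cong refl weighted_count_step[OF zi _ nsp(1) p])
  also have "\<dots> = (\<integral>\<^sup>+\<omega>. (\<Sum>y\<in>words b N. ennreal (p ^ length y * pos (balls (z @ j # y) \<omega>)) * ennreal (visits_upto p N (balls (z @ [i]) \<omega>))) \<partial>M)"
    using vy zi by (intro nn_integral_sum[symmetric] borel_measurable_times_ennreal fun_balls_ennreal)
  also have "\<dots> = (\<integral>\<^sup>+\<omega>. ennreal (visits_upto p N (balls (z @ [i]) \<omega>)) * ennreal (weighted_count p N (z @ [j]) \<omega>) \<partial>M)"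
    unfolding gj using pn visits_upto_nonneg[OF p] dist by (simp add: sum_nonneg flip: ennreal_mult)
  also have "\<dots> = (\<integral>\<^sup>+\<omega>. ennreal (visits_upto p N (balls (z @ [i]) \<omega>)) * ennreal (visits_upto p N (balls (z @ [j]) \<omega>)) \<partial>M)"
    by (rule weighted_count_step[OF zj zi nsp(2) p])
  finally show ?thesis using visits_upto_nonneg[OF p] by (simp add: ennreal_mult)
qed

lemma children_sum_step:
  assumes z: "z \<in> vertices b" and \<phi>: "\<And>m. 0 \<le> \<phi> m"
  shows "(\<Sum>i<b. \<integral>\<^sup>+\<omega>. ennreal (\<phi> (balls (z @ [i]) \<omega>)) \<partial>M) = (\<integral>\<^sup>+\<omega>. ennreal (P \<phi> (balls z \<omega>)) \<partial>M)"
proof -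
  have "(\<Sum>i<b. \<integral>\<^sup>+\<omega>. ennreal (\<phi> (balls (z @ [i]) \<omega>)) \<partial>M) = (\<integral>\<^sup>+\<omega>. (\<Sum>i<b. ennreal (\<phi> (balls (z @ [i]) \<omega>))) \<partial>M)"
    using z by (intro nn_integral_sum[symmetric] fun_balls_ennreal) auto
  also have "\<dots> = (\<integral>\<^sup>+\<omega>. 1 * (\<Sum>x\<in>level b (Suc 0). ennreal (\<phi> (balls (z @ x) \<omega>))) \<partial>M)"
    unfolding sum_level_Suc by (simp add: level_0)
  also have "\<dots> = (\<integral>\<^sup>+\<omega>. 1 * ennreal ((P ^^ Suc 0) \<phi> (balls z \<omega>)) \<partial>M)"
    by (rule level_step[OF z z]) (use \<phi> in simp_all)
  finally show ?thesis by simp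
qed

end

section \<open>Pairs of vertices\<close>

text \<open>
The weight of a pair of words that is read off after their longest common prefix: \<open>q\<close> of the length of the
prefix (on top of \<open>l\<close>), times \<open>p\<close> for each remaining letter.
\<close>

fun meet_weight :: "(nat \<Rightarrow> real) \<Rightarrow> real \<Rightarrow> nat \<Rightarrow> nat list \<Rightarrow> nat list \<Rightarrow> real" where
  "meet_weight q p l [] y = q l * p ^ length y"
| "meet_weight q p l (i # x) [] = q l * p ^ length (i # x)"
| "meet_weight q p l (i # x) (j # y) = (if i = j then meet_weight q p (Suc l) x y else q l * p ^ (length x + length y + 2))"

lemma meet_weight_nonneg: "(\<And>l. 0 \<le> q l) \<Longrightarrow> 0 \<le> p \<Longrightarrow> 0 \<le> meet_weight q p l x y"
  by (induction q p l x y rule: meet_weight.induct) auto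

text \<open>
The edges on the path from the root to \<open>u\<close>, each edge being named by its lower end.
\<close>

definition proper :: "nat list \<Rightarrow> nat list set" where
  "proper u = {v. prefix v u \<and> v \<noteq> []}"

lemma proper_Nil [simp]: "proper [] = {}" by (auto simp: proper_def)

lemma proper_Cons: "proper (i # x) = insert [i] ((#) i ` proper x)"
proof (intro set_eqI iffI)
  fix v assume "v \<in> proper (i # x)"
  then show "v \<in> insert [i] ((#) i ` proper x)"
    by (cases v) (auto simp: proper_def)
qed (auto simp: proper_def)

lemma finite_proper [simp]: "finite (proper u)"
  by (induction u) (auto simp: proper_Cons)

lemma singleton_notin [simp]: "[i] \<notin> (#) j ` proper x" by (auto simp: proper_def)

lemma card_proper [simp]: "card (proper u) = length u"
  by (induction u) (auto simp: proper_Cons card_image)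

text \<open>
The probability that both paths to the root are open.
\<close>

lemma meet_weight_union: "meet_weight (\<lambda>l. p ^ l) p l x y = p ^ (l + card (proper x \<union> proper y))"
proof (induction "\<lambda>l. p ^ l" p l x y rule: meet_weight.induct)
  case (1 p l y)
  then show ?case by (simp add: power_add)
next
  case (2 p l i x)
  then show ?case by (simp only: meet_weight.simps Un_empty_right proper_Nil card_proper power_add)
next
  case (3 p l i x j y)
  show ?case
  proof (cases "i = j")
    case True
    have "proper (i # x) \<union> proper (j # y) = insert [i] ((#) i ` (proper x \<union> proper y))"
      unfolding proper_Cons image_Un using True by auto
    moreover have "[i] \<notin> (#) i ` (proper x \<union> proper y)" by (auto simp: proper_def)
    ultimately have "card (proper (i # x) \<union> proper (j # y)) = Suc (card (proper x \<union> proper y))"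
      by (simp add: card_image)
    then show ?thesis using True 3 by simp
  next
    case False
    have "proper (i # x) \<inter> proper (j # y) = {}" using False by (auto simp: proper_Cons)
    then have "card (proper (i # x) \<union> proper (j # y)) = length x + length y + 2"
      by (simp add: card_Un_disjoint)
    then show ?thesis using False by (simp add: power_add)
  qed
qed

lemma meet_weight_inter: "meet_weight real 1 l x y = real (l + card (proper x \<inter> proper y))"
proof (induction "real" "1::real" l x y rule: meet_weight.induct)
  case (3 l i x j y)
  show ?case
  proof (cases "i = j")
    case True
    have "proper (i # x) \<inter> proper (j # y) = insert [i] ((#) i ` (proper x \<inter> proper y))"
      unfolding proper_Cons using True by auto
    moreover have "[i] \<notin> (#) i ` (proper x \<inter> proper y)" by (auto simp: proper_def)
    ultimately have "card (proper (i # x) \<inter> proper (j # y)) = Suc (card (proper x \<inter> proper y))"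
      by (simp add: card_image)
    then show ?thesis using True 3 by simp
  next
    case False
    have "proper (i # x) \<inter> proper (j # y) = {}" using False by (auto simp: proper_Cons)
    then show ?thesis using False by simp
  qed
qed simp_all

context split_tree_model
begin

definition pairsum :: "(nat \<Rightarrow> real) \<Rightarrow> real \<Rightarrow> nat \<Rightarrow> nat \<Rightarrow> nat list \<Rightarrow> 'w \<Rightarrow> real" where
  "pairsum q p N l z \<omega> =
    (\<Sum>x\<in>words b N. \<Sum>y\<in>words b N. meet_weight q p l x y * (occ (z @ x) \<omega> * occ (z @ y) \<omega>))"

context
  fixes q :: "nat \<Rightarrow> real" and p :: real
  assumes q: "\<And>l. 0 \<le> q l" and p: "0 \<le> p" "p \<le> 1"
begin

lemma pairsum_nonneg: "0 \<le> pairsum q p N l z \<omega>"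
  unfolding pairsum_def using q p by (intro sum_nonneg mult_nonneg_nonneg meet_weight_nonneg occ_bounds)

lemma pairsum_measurable: "z \<in> vertices b \<Longrightarrow> pairsum q p N l z \<in> borel_measurable M"
  unfolding pairsum_def[abs_def]
  by (intro borel_measurable_sum borel_measurable_times occ_measurable) (auto dest: words_vertices)

text \<open>
Both vertices equal \<open>z\<close>, or exactly one does, or they lie below distinct children, or below the same
child.
\<close>

lemma pairsum_Suc_le:
  "pairsum q p (Suc N) l z \<omega> \<le> q l * occ z \<omega> + 2 * q l * p * (\<Sum>i<b. weighted_count p N (z @ [i]) \<omega>)
    + q l * p\<^sup>2 * (\<Sum>i<b. \<Sum>j\<in>{..<b}-{i}. weighted_count p N (z @ [i]) \<omega> * weighted_count p N (z @ [j]) \<omega>)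
    + (\<Sum>i<b. pairsum q p N (Suc l) (z @ [i]) \<omega>)"
proof -
  let ?W = "words b N"
  define o' where "o' x = occ (z @ x) \<omega>" for x
  have o: "0 \<le> o' x" "o' x \<le> 1" for x by (auto simp: o'_def occ_bounds)
  define g where "g i = (\<Sum>x\<in>?W. p ^ length x * o' (i # x))" for i
  have g: "weighted_count p N (z @ [i]) \<omega> = g i" for i by (simp add: weighted_count_def g_def o'_def)
  have ps: "pairsum q p N (Suc l) (z @ [i]) \<omega> = (\<Sum>x\<in>?W. \<Sum>y\<in>?W. meet_weight q p (Suc l) x y * (o' (i # x) * o' (i # y)))" for i
    by (simp add: pairsum_def o'_def)
  have le1: "o' x * o' y \<le> o' y" "o' y * o' x \<le> o' y" for x y using o by (auto simp: mult_left_le_one_le mult_right_le_one_le)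
  have cross: "(\<Sum>i<b. \<Sum>x\<in>?W. q l * p ^ Suc (length x) * o' (i # x)) = q l * p * (\<Sum>i<b. g i)"
    unfolding g_def sum_distrib_left by (intro sum.cong refl) simp
  have A: "(\<Sum>y\<in>words b (Suc N). meet_weight q p l [] y * (o' [] * o' y)) \<le> q l * o' [] + q l * p * (\<Sum>i<b. g i)"
  proof -
    have "(\<Sum>y\<in>words b (Suc N). meet_weight q p l [] y * (o' [] * o' y)) =
      q l * (o' [] * o' []) + (\<Sum>i<b. \<Sum>y\<in>?W. q l * p ^ Suc (length y) * (o' [] * o' (i # y)))"
      by (simp add: sum_words_Suc)
    also have "\<dots> \<le> q l * o' [] + (\<Sum>i<b. \<Sum>y\<in>?W. q l * p ^ Suc (length y) * o' (i # y))"
      using q p by (intro add_mono sum_mono mult_left_mono le1) auto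
    finally show ?thesis unfolding cross .
  qed
  have B: "(\<Sum>i<b. \<Sum>x\<in>?W. \<Sum>y\<in>words b (Suc N). meet_weight q p l (i # x) y * (o' (i # x) * o' y)) \<le>
    q l * p * (\<Sum>i<b. g i) + ((\<Sum>i<b. pairsum q p N (Suc l) (z @ [i]) \<omega>) +
      q l * p\<^sup>2 * (\<Sum>i<b. \<Sum>j\<in>{..<b}-{i}. g i * g j))"
  proof -
    have "(\<Sum>i<b. \<Sum>x\<in>?W. \<Sum>y\<in>words b (Suc N). meet_weight q p l (i # x) y * (o' (i # x) * o' y)) =
      (\<Sum>i<b. \<Sum>x\<in>?W. q l * p ^ Suc (length x) * (o' (i # x) * o' [])) +
      (\<Sum>i<b. \<Sum>x\<in>?W. \<Sum>j<b. \<Sum>y\<in>?W. meet_weight q p l (i # x) (j # y) * (o' (i # x) * o' (j # y)))"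
      by (simp add: sum_words_Suc sum.distrib)
    also have "(\<Sum>i<b. \<Sum>x\<in>?W. q l * p ^ Suc (length x) * (o' (i # x) * o' [])) \<le>
      (\<Sum>i<b. \<Sum>x\<in>?W. q l * p ^ Suc (length x) * o' (i # x))"
      using q p by (intro sum_mono mult_left_mono le1) auto
    also have "\<dots> = q l * p * (\<Sum>i<b. g i)" by (rule cross)
    also have "(\<Sum>i<b. \<Sum>x\<in>?W. \<Sum>j<b. \<Sum>y\<in>?W. meet_weight q p l (i # x) (j # y) * (o' (i # x) * o' (j # y))) =
      (\<Sum>i<b. pairsum q p N (Suc l) (z @ [i]) \<omega>) +
      q l * p\<^sup>2 * (\<Sum>i<b. \<Sum>j\<in>{..<b}-{i}. g i * g j)"
      unfolding sum_distrib_left sum.distrib[symmetric]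
    proof (rule sum.cong[OF refl])
      fix i assume i: "i \<in> {..<b}"
      have "(\<Sum>x\<in>?W. \<Sum>j<b. \<Sum>y\<in>?W. meet_weight q p l (i # x) (j # y) * (o' (i # x) * o' (j # y))) =
        (\<Sum>j<b. \<Sum>x\<in>?W. \<Sum>y\<in>?W. meet_weight q p l (i # x) (j # y) * (o' (i # x) * o' (j # y)))"
        by (rule sum.swap)
      also have "\<dots> = pairsum q p N (Suc l) (z @ [i]) \<omega> +
        (\<Sum>j\<in>{..<b}-{i}. \<Sum>x\<in>?W. \<Sum>y\<in>?W. meet_weight q p l (i # x) (j # y) * (o' (i # x) * o' (j # y)))"
        using i by (subst sum.remove[of _ i]) (auto simp: ps)
      also have "(\<Sum>j\<in>{..<b}-{i}. \<Sum>x\<in>?W. \<Sum>y\<in>?W. meet_weight q p l (i # x) (j # y) * (o' (i # x) * o' (j # y))) =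
        (\<Sum>j\<in>{..<b}-{i}. q l * p\<^sup>2 * (g i * g j))"
      proof (rule sum.cong[OF refl])
        fix j assume j: "j \<in> {..<b} - {i}"
        show "(\<Sum>x\<in>?W. \<Sum>y\<in>?W. meet_weight q p l (i # x) (j # y) * (o' (i # x) * o' (j # y))) = q l * p\<^sup>2 * (g i * g j)"
        proof -
          have gg: "g i * g j = (\<Sum>x\<in>?W. \<Sum>y\<in>?W. p ^ length x * o' (i # x) * (p ^ length y * o' (j # y)))"
            unfolding g_def by (rule sum_product)
          show ?thesis
            unfolding gg sum_distrib_left using j
            by (intro sum.cong refl) (auto simp: power_add power2_eq_square)
        qed
      qed
      finally show "(\<Sum>x\<in>?W. \<Sum>j<b. \<Sum>y\<in>?W. meet_weight q p l (i # x) (j # y) * (o' (i # x) * o' (j # y))) =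
        pairsum q p N (Suc l) (z @ [i]) \<omega> + (\<Sum>j\<in>{..<b}-{i}. q l * p\<^sup>2 * (g i * g j))" .
    qed
    finally show ?thesis by simp
  qed
  have "pairsum q p (Suc N) l z \<omega> = (\<Sum>y\<in>words b (Suc N). meet_weight q p l [] y * (o' [] * o' y)) +
    (\<Sum>i<b. \<Sum>x\<in>?W. \<Sum>y\<in>words b (Suc N). meet_weight q p l (i # x) y * (o' (i # x) * o' y))"
    unfolding pairsum_def o'_def[symmetric] by (rule sum_words_Suc)
  then show ?thesis using A B unfolding g by (simp add: o'_def)
qed

definition weighted_potential :: "nat \<Rightarrow> nat \<Rightarrow> nat \<Rightarrow> real" where
  "weighted_potential N l m = (\<Sum>k<N. q (l + k) * (P ^^ k) (tau p) m)"

lemma weighted_potential_nonneg: "0 \<le> weighted_potential N l m"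
  unfolding weighted_potential_def using q p by (intro sum_nonneg mult_nonneg_nonneg Pk_nonneg tau_nonneg)

lemma weighted_potential_Suc: "weighted_potential (Suc N) l m = q l * tau p m + P (weighted_potential N (Suc l)) m"
proof -
  have "P (weighted_potential N (Suc l)) m = (\<Sum>k<N. q (Suc l + k) * (P ^^ Suc k) (tau p) m)"
    unfolding weighted_potential_def[abs_def] by (induction N) (simp_all add: P_add P_cmult)
  then show ?thesis unfolding weighted_potential_def by (subst sum.lessThan_Suc_shift) simp
qed

text \<open>
In the last case of \<open>pairsum_Suc_le\<close> the induction hypothesis applies at the child; in the other cases
the meeting point is \<open>z\<close>, and together they contribute \<open>q l * tau p\<close>.
\<close>

lemma pairsum_le:
  "z \<in> vertices b \<Longrightarrow> (\<integral>\<^sup>+\<omega>. ennreal (pairsum q p N l z \<omega>) \<partial>M) \<le> (\<integral>\<^sup>+\<omega>. ennreal (weighted_potential N l (balls z \<omega>)) \<partial>M)"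
proof (induction N arbitrary: l z)
  case 0
  then show ?case by (simp add: pairsum_def words_0)
next
  case (Suc N)
  note z = Suc.prems
  have zi: "z @ [i] \<in> vertices b" if "i < b" for i using z that by auto
  have mr: "(\<lambda>\<omega>. ennreal (f \<omega>)) \<in> borel_measurable M" if "f \<in> borel_measurable M" for f :: "'w \<Rightarrow> real"
    using that by measurable
  have dsum: "(\<integral>\<^sup>+\<omega>. (\<Sum>i<b. \<Sum>j\<in>{..<b}-{i}. ennreal (F i j \<omega>)) \<partial>M) =
      (\<Sum>i<b. \<Sum>j\<in>{..<b}-{i}. \<integral>\<^sup>+\<omega>. ennreal (F i j \<omega>) \<partial>M)"
    if F: "\<And>i j. i < b \<Longrightarrow> j < b \<Longrightarrow> F i j \<in> borel_measurable M" for F :: "nat \<Rightarrow> nat \<Rightarrow> 'w \<Rightarrow> real"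
  proof -
    have "(\<integral>\<^sup>+\<omega>. (\<Sum>i<b. \<Sum>j\<in>{..<b}-{i}. ennreal (F i j \<omega>)) \<partial>M) =
      (\<Sum>i<b. \<integral>\<^sup>+\<omega>. (\<Sum>j\<in>{..<b}-{i}. ennreal (F i j \<omega>)) \<partial>M)"
      by (intro nn_integral_sum borel_measurable_sum mr F) auto
    also have "\<dots> = (\<Sum>i<b. \<Sum>j\<in>{..<b}-{i}. \<integral>\<^sup>+\<omega>. ennreal (F i j \<omega>) \<partial>M)"
      by (rule sum.cong[OF refl], rule nn_integral_sum) (intro mr F; simp)
    finally show ?thesis .
  qed
  have gs0: "0 \<le> visits_upto p N m" for m using p by (intro visits_upto_nonneg)
  let ?O = "\<lambda>\<omega>. ennreal (occ z \<omega>)" and ?G = "\<lambda>\<omega>. \<Sum>i<b. ennreal (weighted_count p N (z @ [i]) \<omega>)"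
    and ?GG = "\<lambda>\<omega>. \<Sum>i<b. \<Sum>j\<in>{..<b}-{i}. ennreal (weighted_count p N (z @ [i]) \<omega> * weighted_count p N (z @ [j]) \<omega>)"
    and ?R = "\<lambda>\<omega>. \<Sum>i<b. ennreal (pairsum q p N (Suc l) (z @ [i]) \<omega>)"
  have mO: "?O \<in> borel_measurable M" using z by (intro mr occ_measurable)
  have mG: "?G \<in> borel_measurable M" using zi by (intro borel_measurable_sum mr weighted_count_measurable) auto
  have mGG: "?GG \<in> borel_measurable M" using zi by (intro borel_measurable_sum mr borel_measurable_times weighted_count_measurable) auto
  have mR: "?R \<in> borel_measurable M" using zi by (intro borel_measurable_sum mr pairsum_measurable) auto
  have "(\<integral>\<^sup>+\<omega>. ennreal (pairsum q p (Suc N) l z \<omega>) \<partial>M) \<le>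
    (\<integral>\<^sup>+\<omega>. ennreal (q l) * ?O \<omega> + ennreal (2 * q l * p) * ?G \<omega> + ennreal (q l * p\<^sup>2) * ?GG \<omega> + ?R \<omega> \<partial>M)"
  proof (rule nn_integral_mono)
    fix \<omega>
    have G: "?G \<omega> = ennreal (\<Sum>i<b. weighted_count p N (z @ [i]) \<omega>)" using p by (intro sum_ennreal weighted_count_nonneg)
    have GG: "?GG \<omega> = ennreal (\<Sum>i<b. \<Sum>j\<in>{..<b}-{i}. weighted_count p N (z @ [i]) \<omega> * weighted_count p N (z @ [j]) \<omega>)"
    proof -
      have "?GG \<omega> = (\<Sum>i<b. ennreal (\<Sum>j\<in>{..<b}-{i}. weighted_count p N (z @ [i]) \<omega> * weighted_count p N (z @ [j]) \<omega>))"
        by (intro sum.cong refl sum_ennreal mult_nonneg_nonneg weighted_count_nonneg p)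
      also have "\<dots> = ennreal (\<Sum>i<b. \<Sum>j\<in>{..<b}-{i}. weighted_count p N (z @ [i]) \<omega> * weighted_count p N (z @ [j]) \<omega>)"
        by (intro sum_ennreal sum_nonneg mult_nonneg_nonneg weighted_count_nonneg p)
      finally show ?thesis .
    qed
    have R: "?R \<omega> = ennreal (\<Sum>i<b. pairsum q p N (Suc l) (z @ [i]) \<omega>)" by (intro sum_ennreal pairsum_nonneg)
    have nn: "0 \<le> (\<Sum>i<b. weighted_count p N (z @ [i]) \<omega>)" "0 \<le> (\<Sum>i<b. \<Sum>j\<in>{..<b}-{i}. weighted_count p N (z @ [i]) \<omega> * weighted_count p N (z @ [j]) \<omega>)"
      "0 \<le> (\<Sum>i<b. pairsum q p N (Suc l) (z @ [i]) \<omega>)"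
      using weighted_count_nonneg[OF p(1)] pairsum_nonneg by (auto intro!: sum_nonneg)
    have "ennreal (q l) * ?O \<omega> + ennreal (2 * q l * p) * ?G \<omega> + ennreal (q l * p\<^sup>2) * ?GG \<omega> + ?R \<omega> =
      ennreal (q l * occ z \<omega> + 2 * q l * p * (\<Sum>i<b. weighted_count p N (z @ [i]) \<omega>)
       + q l * p\<^sup>2 * (\<Sum>i<b. \<Sum>j\<in>{..<b}-{i}. weighted_count p N (z @ [i]) \<omega> * weighted_count p N (z @ [j]) \<omega>)
       + (\<Sum>i<b. pairsum q p N (Suc l) (z @ [i]) \<omega>))"
      unfolding G GG R using nn q[of l] p occ_bounds(1)[of z \<omega>]
      by (simp add: ennreal_mult'[symmetric] ennreal_plus[symmetric] del: ennreal_plus)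
    then show "ennreal (pairsum q p (Suc N) l z \<omega>) \<le> ennreal (q l) * ?O \<omega> + ennreal (2 * q l * p) * ?G \<omega> + ennreal (q l * p\<^sup>2) * ?GG \<omega> + ?R \<omega>"
      using pairsum_Suc_le[of N l z \<omega>] by (simp add: ennreal_leI)
  qed
  also have "\<dots> = ennreal (q l) * (\<integral>\<^sup>+\<omega>. ?O \<omega> \<partial>M) + ennreal (2 * q l * p) * (\<integral>\<^sup>+\<omega>. ?G \<omega> \<partial>M)
      + ennreal (q l * p\<^sup>2) * (\<integral>\<^sup>+\<omega>. ?GG \<omega> \<partial>M) + (\<integral>\<^sup>+\<omega>. ?R \<omega> \<partial>M)"
    using mO mG mGG mR by (simp add: nn_integral_add nn_integral_cmult)
  also have "(\<integral>\<^sup>+\<omega>. ?G \<omega> \<partial>M) = (\<integral>\<^sup>+\<omega>. ennreal (P (visits_upto p N) (balls z \<omega>)) \<partial>M)"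
  proof -
    have "(\<integral>\<^sup>+\<omega>. ?G \<omega> \<partial>M) = (\<Sum>i<b. \<integral>\<^sup>+\<omega>. ennreal (weighted_count p N (z @ [i]) \<omega>) \<partial>M)"
      using zi by (intro nn_integral_sum mr weighted_count_measurable) auto
    also have "\<dots> = (\<Sum>i<b. \<integral>\<^sup>+\<omega>. ennreal (visits_upto p N (balls (z @ [i]) \<omega>)) \<partial>M)"
    proof (rule sum.cong[OF refl])
      fix i assume "i \<in> {..<b}"
      then show "(\<integral>\<^sup>+\<omega>. ennreal (weighted_count p N (z @ [i]) \<omega>) \<partial>M) = (\<integral>\<^sup>+\<omega>. ennreal (visits_upto p N (balls (z @ [i]) \<omega>)) \<partial>M)"
        using weighted_count_step[OF zi zi, of i i p "\<lambda>_. 1" N] p by simp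
    qed
    also have "\<dots> = (\<integral>\<^sup>+\<omega>. ennreal (P (visits_upto p N) (balls z \<omega>)) \<partial>M)"
      by (rule children_sum_step[OF z gs0])
    finally show ?thesis .
  qed
  also have "(\<integral>\<^sup>+\<omega>. ?GG \<omega> \<partial>M) = (\<integral>\<^sup>+\<omega>. ennreal (P2 (visits_upto p N) (balls z \<omega>)) \<partial>M)"
  proof -
    have "(\<integral>\<^sup>+\<omega>. ?GG \<omega> \<partial>M) = (\<Sum>i<b. \<Sum>j\<in>{..<b}-{i}. \<integral>\<^sup>+\<omega>. ennreal (weighted_count p N (z @ [i]) \<omega> * weighted_count p N (z @ [j]) \<omega>) \<partial>M)"
      using zi by (intro dsum borel_measurable_times weighted_count_measurable)
    also have "\<dots> = (\<Sum>i<b. \<Sum>j\<in>{..<b}-{i}. \<integral>\<^sup>+\<omega>. ennreal (visits_upto p N (balls (z @ [i]) \<omega>) * visits_upto p N (balls (z @ [j]) \<omega>)) \<partial>M)"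
      using p by (intro sum.cong refl weighted_count_pair_step[OF z]) auto
    also have "\<dots> = (\<integral>\<^sup>+\<omega>. (\<Sum>i<b. \<Sum>j\<in>{..<b}-{i}. ennreal (visits_upto p N (balls (z @ [i]) \<omega>) * visits_upto p N (balls (z @ [j]) \<omega>))) \<partial>M)"
      using zi by (intro dsum[symmetric] borel_measurable_times fun_balls_real)
    also have "\<dots> = (\<integral>\<^sup>+\<omega>. 1 * ennreal (pairs (visits_upto p N) (\<lambda>i\<in>{..<b}. balls (z @ [i]) \<omega>)) \<partial>M)"
    proof (rule nn_integral_cong)
      fix \<omega>
      have "(\<Sum>i<b. \<Sum>j\<in>{..<b}-{i}. ennreal (visits_upto p N (balls (z @ [i]) \<omega>) * visits_upto p N (balls (z @ [j]) \<omega>))) =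
        ennreal (\<Sum>i<b. \<Sum>j\<in>{..<b}-{i}. visits_upto p N (balls (z @ [i]) \<omega>) * visits_upto p N (balls (z @ [j]) \<omega>))"
      proof -
        have "(\<Sum>i<b. \<Sum>j\<in>{..<b}-{i}. ennreal (visits_upto p N (balls (z @ [i]) \<omega>) * visits_upto p N (balls (z @ [j]) \<omega>))) =
          (\<Sum>i<b. ennreal (\<Sum>j\<in>{..<b}-{i}. visits_upto p N (balls (z @ [i]) \<omega>) * visits_upto p N (balls (z @ [j]) \<omega>)))"
          by (intro sum.cong refl sum_ennreal mult_nonneg_nonneg gs0)
        also have "\<dots> = ennreal (\<Sum>i<b. \<Sum>j\<in>{..<b}-{i}. visits_upto p N (balls (z @ [i]) \<omega>) * visits_upto p N (balls (z @ [j]) \<omega>))"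
          by (intro sum_ennreal sum_nonneg mult_nonneg_nonneg gs0)
        finally show ?thesis .
      qed
      then show "(\<Sum>i<b. \<Sum>j\<in>{..<b}-{i}. ennreal (visits_upto p N (balls (z @ [i]) \<omega>) * visits_upto p N (balls (z @ [j]) \<omega>))) =
        1 * ennreal (pairs (visits_upto p N) (\<lambda>i\<in>{..<b}. balls (z @ [i]) \<omega>))" by (simp add: pairs_def)
    qed
    also have "\<dots> = (\<integral>\<^sup>+\<omega>. 1 * ennreal (K (pairs (visits_upto p N)) (balls z \<omega>)) \<partial>M)"
      using gs0 by (intro children_step[OF z z, where \<Psi> = "\<lambda>_ _. 1"]) (auto simp: pairs_def intro!: sum_nonneg)
    finally show ?thesis by (simp add: P2_def)
  qed
  also have "(\<integral>\<^sup>+\<omega>. ?R \<omega> \<partial>M) \<le> (\<integral>\<^sup>+\<omega>. ennreal (P (weighted_potential N (Suc l)) (balls z \<omega>)) \<partial>M)"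
  proof -
    have "(\<integral>\<^sup>+\<omega>. ?R \<omega> \<partial>M) = (\<Sum>i<b. \<integral>\<^sup>+\<omega>. ennreal (pairsum q p N (Suc l) (z @ [i]) \<omega>) \<partial>M)"
      using zi by (intro nn_integral_sum mr pairsum_measurable) auto
    also have "\<dots> \<le> (\<Sum>i<b. \<integral>\<^sup>+\<omega>. ennreal (weighted_potential N (Suc l) (balls (z @ [i]) \<omega>)) \<partial>M)"
      using zi by (intro sum_mono Suc.IH) auto
    also have "\<dots> = (\<integral>\<^sup>+\<omega>. ennreal (P (weighted_potential N (Suc l)) (balls z \<omega>)) \<partial>M)"
      by (rule children_sum_step[OF z weighted_potential_nonneg])
    finally show ?thesis .
  qed
  also have "ennreal (q l) * (\<integral>\<^sup>+\<omega>. ?O \<omega> \<partial>M) + ennreal (2 * q l * p) * (\<integral>\<^sup>+\<omega>. ennreal (P (visits_upto p N) (balls z \<omega>)) \<partial>M)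
      + ennreal (q l * p\<^sup>2) * (\<integral>\<^sup>+\<omega>. ennreal (P2 (visits_upto p N) (balls z \<omega>)) \<partial>M) + (\<integral>\<^sup>+\<omega>. ennreal (P (weighted_potential N (Suc l)) (balls z \<omega>)) \<partial>M)
    = (\<integral>\<^sup>+\<omega>. ennreal (q l) * ?O \<omega> + ennreal (2 * q l * p) * ennreal (P (visits_upto p N) (balls z \<omega>))
      + ennreal (q l * p\<^sup>2) * ennreal (P2 (visits_upto p N) (balls z \<omega>)) + ennreal (P (weighted_potential N (Suc l)) (balls z \<omega>)) \<partial>M)"
    using mO fun_balls_ennreal[OF z] by (simp add: nn_integral_add nn_integral_cmult)
  also have "\<dots> \<le> (\<integral>\<^sup>+\<omega>. ennreal (weighted_potential (Suc N) l (balls z \<omega>)) \<partial>M)"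
  proof (rule nn_integral_mono)
    fix \<omega>
    let ?m = "balls z \<omega>"
    have g0: "0 \<le> P (visits_upto p N) ?m" "0 \<le> P2 (visits_upto p N) ?m" "0 \<le> P (weighted_potential N (Suc l)) ?m"
      using gs0 weighted_potential_nonneg by (auto intro!: P_nonneg P2_nonneg)
    have gl: "visits_upto p N j \<le> visits p j" for j using p by (intro visits_upto_le)
    have g1: "P (visits_upto p N) ?m \<le> P (visits p) ?m" by (intro P_mono gl)
    have v0: "0 \<le> visits p j" for j using visits_bounds(1)[OF p] .
    have g2: "P2 (visits_upto p N) ?m \<le> P2 (visits p) ?m"
      unfolding P2_def by (intro K_mono) (auto simp: pairs_def intro!: sum_mono mult_mono gl gs0 v0)
    have "ennreal (q l) * ?O \<omega> + ennreal (2 * q l * p) * ennreal (P (visits_upto p N) ?m)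
      + ennreal (q l * p\<^sup>2) * ennreal (P2 (visits_upto p N) ?m) + ennreal (P (weighted_potential N (Suc l)) ?m) =
      ennreal (q l * pos ?m + 2 * q l * p * P (visits_upto p N) ?m + q l * p\<^sup>2 * P2 (visits_upto p N) ?m + P (weighted_potential N (Suc l)) ?m)"
      using g0 q[of l] p pos_le(1)[of ?m] by (simp add: occ_def ennreal_mult'[symmetric] ennreal_plus[symmetric] del: ennreal_plus)
    also have "\<dots> \<le> ennreal (weighted_potential (Suc N) l ?m)"
    proof (rule ennreal_leI)
      have "q l * (2 * p * P (visits_upto p N) ?m) \<le> q l * (2 * p * P (visits p) ?m)"
        using g1 q[of l] p by (intro mult_left_mono) auto
      moreover have "q l * (p\<^sup>2 * P2 (visits_upto p N) ?m) \<le> q l * (p\<^sup>2 * P2 (visits p) ?m)"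
        using g2 q[of l] p by (intro mult_left_mono) auto
      ultimately show "q l * pos ?m + 2 * q l * p * P (visits_upto p N) ?m + q l * p\<^sup>2 * P2 (visits_upto p N) ?m + P (weighted_potential N (Suc l)) ?m
        \<le> weighted_potential (Suc N) l ?m"
        unfolding weighted_potential_Suc tau_def by (simp add: algebra_simps)
    qed
    finally show "ennreal (q l) * ?O \<omega> + ennreal (2 * q l * p) * ennreal (P (visits_upto p N) ?m)
      + ennreal (q l * p\<^sup>2) * ennreal (P2 (visits_upto p N) ?m) + ennreal (P (weighted_potential N (Suc l)) ?m) \<le> ennreal (weighted_potential (Suc N) l ?m)" .
  qed
  finally show ?case by (simp add: add_left_mono)
qed

lemma pairsum_root_le:
  "(\<integral>\<^sup>+\<omega>. ennreal (pairsum q p N 0 [] \<omega>) \<partial>M) \<le> ennreal (\<Sum>k<N. q k * (P ^^ k) (tau p) n)"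
proof -
  have "(\<integral>\<^sup>+\<omega>. ennreal (pairsum q p N 0 [] \<omega>) \<partial>M) \<le> (\<integral>\<^sup>+\<omega>. ennreal (weighted_potential N 0 (balls [] \<omega>)) \<partial>M)"
    by (rule pairsum_le) simp
  also have "\<dots> = (\<integral>\<^sup>+\<omega>. ennreal (weighted_potential N 0 n) \<partial>M)"
    by (rule nn_integral_cong_AE) (use balls_root in eventually_elim, simp)
  finally show ?thesis by (simp add: emeasure_space_1 weighted_potential_def)
qed

end

lemma AE_children_zero:
  "AE \<omega> in M. \<forall>u\<in>vertices b. \<forall>i<b. balls u \<omega> = 0 \<longrightarrow> balls (u @ [i]) \<omega> = 0"
proof -
  have ae: "AE \<omega> in M. balls u \<omega> = 0 \<longrightarrow> balls (u @ [i]) \<omega> = 0" if u: "u \<in> vertices b" and i: "i < b" for u i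
  proof -
    let ?\<Psi> = "\<lambda>x y::nat. (if x = 0 then 1 else 0) :: ennreal"
    let ?\<Phi> = "\<lambda>a. \<Sum>i<b. real (a i)"
    have ui: "u @ [i] \<in> vertices b" using u i by auto
    have "(\<integral>\<^sup>+\<omega>. ?\<Psi> (balls u \<omega>) (balls u \<omega>) * ennreal (real (balls (u @ [i]) \<omega>)) \<partial>M)
      \<le> (\<integral>\<^sup>+\<omega>. ?\<Psi> (balls u \<omega>) (balls u \<omega>) * ennreal (?\<Phi> (\<lambda>i\<in>{..<b}. balls (u @ [i]) \<omega>)) \<partial>M)"
    proof (intro nn_integral_mono mult_left_mono ennreal_leI)
      fix \<omega>
      have "real (balls (u @ [i]) \<omega>) \<le> (\<Sum>i<b. real (balls (u @ [i]) \<omega>))"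
        using i by (intro member_le_sum) auto
      then show "real (balls (u @ [i]) \<omega>) \<le> ?\<Phi> (\<lambda>i\<in>{..<b}. balls (u @ [i]) \<omega>)" by simp
    qed simp
    also have "\<dots> = (\<integral>\<^sup>+\<omega>. ?\<Psi> (balls u \<omega>) (balls u \<omega>) * ennreal (K ?\<Phi> (balls u \<omega>)) \<partial>M)"
      by (rule children_step[OF u u, where \<Psi> = ?\<Psi>]) (auto intro: sum_nonneg)
    also have "\<dots> = (\<integral>\<^sup>+\<omega>. 0 \<partial>M)"
      by (rule nn_integral_cong) (auto simp: K_leaf)
    finally have "(\<integral>\<^sup>+\<omega>. ?\<Psi> (balls u \<omega>) (balls u \<omega>) * ennreal (real (balls (u @ [i]) \<omega>)) \<partial>M) = 0" by simp
    then have "AE \<omega> in M. ?\<Psi> (balls u \<omega>) (balls u \<omega>) * ennreal (real (balls (u @ [i]) \<omega>)) = 0"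
      using u ui by (subst (asm) nn_integral_0_iff_AE) (auto intro!: borel_measurable_times_ennreal fun_balls_ennreal)
    then show ?thesis by eventually_elim (auto split: if_splits)
  qed
  have "AE \<omega> in M. \<forall>u\<in>vertices b. \<forall>i\<in>{..<b}. balls u \<omega> = 0 \<longrightarrow> balls (u @ [i]) \<omega> = 0"
    using ae by (intro AE_ball_countable' ) auto
  then show ?thesis by eventually_elim auto
qed

text \<open>
The expected number of vertices is at most \<open>mean_vertices n\<close>, a finite quantity.
\<close>

lemma AE_finite_tree: "AE \<omega> in M. finite (split_tree b balls \<omega>)"
proof -
  have mono: "weighted_count 1 N [] \<omega> \<le> weighted_count 1 (Suc N) [] \<omega>" for N \<omega>
    unfolding weighted_count_def by (intro sum_mono2 finite_words) (auto simp: words_def occ_bounds)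
  have meas: "(\<lambda>\<omega>. ennreal (weighted_count 1 N [] \<omega>)) \<in> borel_measurable M" for N
    using weighted_count_measurable[of "[]" 1 N] by simp
  have "(\<integral>\<^sup>+\<omega>. (SUP N. ennreal (weighted_count 1 N [] \<omega>)) \<partial>M) = (SUP N. \<integral>\<^sup>+\<omega>. ennreal (weighted_count 1 N [] \<omega>) \<partial>M)"
    using mono meas by (intro nn_integral_monotone_convergence_SUP) (auto simp: incseq_Suc_iff le_fun_def ennreal_leI)
  also have "\<dots> \<le> ennreal (mean_vertices n)"
    using visits_upto_le[of 1 _ n] by (intro SUP_least) (auto simp: weighted_count_mean visits_def mean_vertices_def ennreal_leI)
  also have "\<dots> < \<infinity>" by simp
  finally have "(\<integral>\<^sup>+\<omega>. (SUP N. ennreal (weighted_count 1 N [] \<omega>)) \<partial>M) \<noteq> \<infinity>" by simp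
  then have "AE \<omega> in M. (SUP N. ennreal (weighted_count 1 N [] \<omega>)) \<noteq> \<infinity>"
    using meas by (intro nn_integral_PInf_AE) auto
  then show ?thesis
  proof eventually_elim
    case (elim \<omega>)
    show ?case
    proof (rule ccontr)
      let ?T = "split_tree b balls \<omega>"
      assume inf: "infinite ?T"
      have le: "ennreal (real k) \<le> (SUP N. ennreal (weighted_count 1 N [] \<omega>))" for k
      proof -
        obtain F where F: "F \<subseteq> ?T" "finite F" "card F = k"
          using infinite_arbitrarily_large[OF inf] by blast
        define N where "N = Suc (Max (insert 0 (length ` F)))"
        have FN: "F \<subseteq> words b N"
        proof
          fix x assume x: "x \<in> F"
          then have "length x \<le> Max (insert 0 (length ` F))" using F(2) by (intro Max_ge) auto
          then show "x \<in> words b N" using x F(1) by (auto simp: words_def N_def split_tree_def)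
        qed
        have "real k = (\<Sum>x\<in>F. 1)" using F by simp
        also have "\<dots> = (\<Sum>x\<in>F. 1 ^ length x * occ ([] @ x) \<omega>)"
          using F(1) by (intro sum.cong refl) (auto simp: occ_def pos_def split_tree_def)
        also have "\<dots> \<le> weighted_count 1 N [] \<omega>"
          unfolding weighted_count_def using FN by (intro sum_mono2) (auto simp: occ_bounds)
        finally show ?thesis by (intro SUP_upper2[of N]) (auto intro: ennreal_leI)
      qed
      have "(SUP N. ennreal (weighted_count 1 N [] \<omega>)) < top"
        using elim unfolding infinity_ennreal_def by (simp only: top.not_eq_extremum)
      then obtain k where "(SUP N. ennreal (weighted_count 1 N [] \<omega>)) < of_nat k" using ennreal_Ex_less_of_nat by blast
      then show False using le[of k] by (simp add: ennreal_of_nat_eq_real_of_nat not_less flip: not_le)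
    qed
  qed
qed

end

section \<open>Clusters of a finite tree and percolation moments\<close>

lemma sorted_desc_second:
  fixes L :: "nat list"
  assumes "sorted_wrt (\<ge>) L"
  shows "(2 \<le> length L \<and> j \<le> L ! 1) \<longleftrightarrow> 2 \<le> length (filter (\<lambda>x. j \<le> x) L)"
proof (cases L)
  case (Cons a L')
  show ?thesis
  proof (cases L')
    case (Cons a' L'')
    show ?thesis
    proof (cases "j \<le> a'")
      case True
      then show ?thesis using assms \<open>L = a # L'\<close> Cons by simp
    next
      case False
      then have "filter (\<lambda>x. j \<le> x) L' = []"
        using assms \<open>L = a # L'\<close> Cons by (auto simp: filter_empty_conv)
      then show ?thesis using \<open>L = a # L'\<close> Cons False by simp
    qed
  qed (use Cons in simp)
qed simp

lemma second_cluster_size_iff: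
  assumes j: "1 \<le> j"
  shows "j \<le> second_cluster_size T k \<longleftrightarrow> finite (clusters T k) \<and>
    (\<exists>C\<in>clusters T k. \<exists>C'\<in>clusters T k. C \<noteq> C' \<and> j \<le> card C \<and> j \<le> card C')"
proof (cases "finite (clusters T k)")
  case True
  let ?m = "image_mset card (mset_set (clusters T k))"
  let ?L = "cluster_sizes T k"
  let ?B = "{C \<in> clusters T k. j \<le> card C}"
  have L: "mset ?L = ?m" by (simp add: cluster_sizes_def)
  have sorted: "sorted_wrt (\<ge>) ?L"
    unfolding cluster_sizes_def sorted_wrt_rev by simp
  have "j \<le> second_cluster_size T k \<longleftrightarrow> 2 \<le> length ?L \<and> j \<le> ?L ! 1"
    using j by (auto simp: second_cluster_size_def)
  also have "\<dots> \<longleftrightarrow> 2 \<le> length (filter (\<lambda>x. j \<le> x) ?L)" by (rule sorted_desc_second[OF sorted])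
  also have "length (filter (\<lambda>x. j \<le> x) ?L) = size (filter_mset (\<lambda>x. j \<le> x) ?m)"
    by (simp flip: L mset_filter)
  also have "\<dots> = card ?B"
    using True by (simp add: filter_mset_image_mset filter_mset_mset_set)
  also have "2 \<le> card ?B \<longleftrightarrow> (\<exists>C\<in>?B. \<exists>C'\<in>?B. C \<noteq> C')"
  proof -
    have fin: "finite ?B" using True by simp
    have "card ?B \<le> Suc 0 \<longleftrightarrow> (\<forall>C\<in>?B. \<forall>C'\<in>?B. C = C')" by (rule card_le_Suc0_iff_eq[OF fin])
    moreover have "2 \<le> card ?B \<longleftrightarrow> \<not> card ?B \<le> Suc 0" by linarith
    ultimately show ?thesis by blast
  qed
  finally show ?thesis using True by blast
next
  case False
  then show ?thesis using j by (simp add: second_cluster_size_def cluster_sizes_def)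
qed

lemma same_cluster_equiv: "equiv T (same_cluster T k)"
proof (rule equivI)
  have "sym ((open_edges T k \<union> (open_edges T k)\<inverse>)\<^sup>*)"
    by (intro sym_rtrancl) (auto simp: sym_def)
  then show "sym (same_cluster T k)" unfolding same_cluster_def sym_def by blast
  show "trans (same_cluster T k)"
    unfolding same_cluster_def trans_def by (auto intro: rtrancl_trans)
qed (auto simp: same_cluster_def refl_on_def)

lemma same_cluster_sym: "(u, w) \<in> same_cluster T k \<Longrightarrow> (w, u) \<in> same_cluster T k"
  using same_cluster_equiv[of T k] unfolding equiv_def sym_def by blast

lemma same_cluster_trans:
  "(u, w) \<in> same_cluster T k \<Longrightarrow> (w, v) \<in> same_cluster T k \<Longrightarrow> (u, v) \<in> same_cluster T k"
  using same_cluster_equiv[of T k] unfolding equiv_def trans_def by blast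

text \<open>
The highest vertex that can be reached from \<open>u\<close> by moving towards the root along open edges.  It labels
the cluster of \<open>u\<close> and reduces connectivity to statements about prefixes.
\<close>

function top_of :: "(nat list \<Rightarrow> bool) \<Rightarrow> nat list \<Rightarrow> nat list" where
  "top_of k u = (if u = [] \<or> \<not> k u then u else top_of k (butlast u))"
  by auto
termination by (relation "inv_image less_than (\<lambda>(k, u). length u)") auto

declare top_of.simps [simp del]

lemma top_of_Nil [simp]: "top_of k [] = []"
  by (subst top_of.simps) simp

lemma top_of_stop: "\<not> k u \<Longrightarrow> top_of k u = u"
  by (subst top_of.simps) simp

lemma top_of_snoc: "k (u @ [i]) \<Longrightarrow> top_of k (u @ [i]) = top_of k u"
  by (subst top_of.simps) simp

lemma top_of_prefix: "prefix (top_of k u) u"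
proof (induction u rule: rev_induct)
  case Nil
  then show ?case by simp
next
  case (snoc i u)
  then show ?case by (cases "k (u @ [i])") (auto simp: top_of_snoc top_of_stop)
qed

lemma top_of_closed: "top_of k u \<noteq> [] \<Longrightarrow> \<not> k (top_of k u)"
proof (induction u rule: rev_induct)
  case Nil
  then show ?case by simp
next
  case (snoc i u)
  then show ?case by (cases "k (u @ [i])") (auto simp: top_of_snoc top_of_stop)
qed

lemma top_of_same_cluster: "(u, w) \<in> same_cluster T k \<Longrightarrow> top_of k u = top_of k w"
proof -
  assume "(u, w) \<in> same_cluster T k"
  then have "(u, w) \<in> (open_edges T k \<union> (open_edges T k)\<inverse>)\<^sup>*" by (simp add: same_cluster_def)
  then show ?thesis
    by (induction rule: rtrancl_induct) (auto simp: open_edges_def top_of_snoc)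
qed

definition prefix_closed :: "nat list set \<Rightarrow> bool" where
  "prefix_closed T \<longleftrightarrow> (\<forall>u i. u @ [i] \<in> T \<longrightarrow> u \<in> T)"

lemma root_connected:
  assumes "prefix_closed T" "u \<in> T" "top_of k u = []"
  shows "([], u) \<in> same_cluster T k"
  using assms(2,3)
proof (induction u rule: rev_induct)
  case Nil
  then show ?case by (simp add: same_cluster_def)
next
  case (snoc i u)
  have k: "k (u @ [i])" using snoc.prems(2) top_of_stop[of k "u @ [i]"] by auto
  have u: "u \<in> T" using assms(1) snoc.prems(1) by (auto simp: prefix_closed_def)
  have "([], u) \<in> same_cluster T k" using snoc.IH u snoc.prems(2) top_of_snoc[of k u i, OF k] by simp
  moreover have "(u, u @ [i]) \<in> same_cluster T k"
    using u snoc.prems(1) k by (auto simp: same_cluster_def open_edges_def intro!: r_into_rtrancl)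
  ultimately show ?case by (rule same_cluster_trans)
qed

lemma root_cluster_eq:
  assumes "prefix_closed T" "[] \<in> T"
  shows "same_cluster T k `` {[]} = {u \<in> T. top_of k u = []}"
proof (intro set_eqI iffI)
  fix u assume "u \<in> same_cluster T k `` {[]}"
  then have "([], u) \<in> same_cluster T k" by simp
  then show "u \<in> {u \<in> T. top_of k u = []}"
    using top_of_same_cluster[of "[]" u T k] by (auto simp: same_cluster_def)
qed (use root_connected[OF assms(1)] in auto)

text \<open>
One of the two largest clusters misses the root.  All its vertices have the same top, which is a
common prefix whose edge is closed, so each pair of them contributes at least \<open>1\<close> to the right-hand side.
\<close>

lemma second_cluster_le_pairs:
  assumes T: "prefix_closed T" "[] \<in> T" "finite T"
  shows "(real (second_cluster_size T k))\<^sup>2 \<le>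
    (\<Sum>x\<in>T. \<Sum>y\<in>T. \<Sum>t\<in>{t. prefix t x \<and> prefix t y \<and> t \<noteq> []}. of_bool (\<not> k t))"
proof (cases "second_cluster_size T k = 0")
  case True
  then show ?thesis by (simp add: sum_nonneg)
next
  case False
  let ?r = "same_cluster T k"
  let ?j = "second_cluster_size T k"
  let ?S = "\<lambda>x y. (\<Sum>t\<in>{t. prefix t x \<and> prefix t y \<and> t \<noteq> []}. of_bool (\<not> k t)) :: real"
  have S0: "0 \<le> ?S x y" for x y by (intro sum_nonneg) auto
  obtain C C' where C: "C \<in> clusters T k" "C' \<in> clusters T k" "C \<noteq> C'" "?j \<le> card C" "?j \<le> card C'"
    using second_cluster_size_iff[of ?j T k] False by auto
  have "C \<inter> C' = {}"
    using quotient_disj[OF same_cluster_equiv[of T k], of C C'] C(1-3) unfolding clusters_def by simp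
  then have "\<exists>B\<in>clusters T k. [] \<notin> B \<and> ?j \<le> card B" using C by blast
  then obtain B where B: "B \<in> clusters T k" "[] \<notin> B" "?j \<le> card B" by blast
  have BT: "B \<subseteq> T" using B(1) unfolding clusters_def
    by (rule in_quotient_imp_subset[OF same_cluster_equiv])
  have one: "1 \<le> ?S x y" if xy: "x \<in> B" "y \<in> B" for x y
  proof -
    have "(x, y) \<in> ?r"
      by (rule in_quotient_imp_in_rel[OF same_cluster_equiv B(1)[unfolded clusters_def]]) (use xy in simp)
    then have top: "top_of k x = top_of k y" by (rule top_of_same_cluster)
    have ne: "top_of k x \<noteq> []"
    proof
      assume "top_of k x = []"
      then have "([], x) \<in> ?r" using root_connected[OF T(1)] xy BT by auto
      then have "(x, []) \<in> ?r" by (rule same_cluster_sym)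
      then have "[] \<in> B"
        by (rule in_quotient_imp_closed[OF same_cluster_equiv B(1)[unfolded clusters_def] xy(1)])
      then show False using B(2) by simp
    qed
    let ?P = "{t. prefix t x \<and> prefix t y \<and> t \<noteq> []}"
    have fin: "finite ?P" by (rule finite_subset[of _ "set (prefixes x)"]) auto
    have "top_of k x \<in> ?P" using top_of_prefix[of k x] top_of_prefix[of k y] top ne by auto
    then have "(of_bool (\<not> k (top_of k x)) :: real) \<le> ?S x y"
      using fin by (intro member_le_sum) auto
    then show ?thesis using top_of_closed[OF ne] by simp
  qed
  have "(real ?j)\<^sup>2 \<le> (real (card B))\<^sup>2" using B(3) by (intro power_mono) auto
  also have "\<dots> = (\<Sum>x\<in>B. \<Sum>y\<in>B. 1)" by (simp add: power2_eq_square)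
  also have "\<dots> \<le> (\<Sum>x\<in>B. \<Sum>y\<in>B. ?S x y)" by (intro sum_mono one)
  also have "\<dots> \<le> (\<Sum>x\<in>B. \<Sum>y\<in>T. ?S x y)" using T(3) BT S0 by (intro sum_mono sum_mono2) auto
  also have "\<dots> \<le> (\<Sum>x\<in>T. \<Sum>y\<in>T. ?S x y)" using T(3) BT S0 by (intro sum_mono2 sum_nonneg) auto
  finally show ?thesis .
qed

text \<open>
A form with countably many candidates for \<open>F\<close>, as needed for measurability.
\<close>

lemma finite_clusters_iff:
  "finite (clusters T k) \<longleftrightarrow> (\<exists>F. finite F \<and> F \<subseteq> T \<and> (\<forall>u\<in>T. \<exists>w\<in>F. (w, u) \<in> same_cluster T k))"
proof
  let ?r = "same_cluster T k"
  assume fin: "finite (clusters T k)"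
  define F where "F = (\<lambda>C. SOME u. u \<in> C) ` clusters T k"
  have sel: "(SOME u. u \<in> C) \<in> C" if "C \<in> clusters T k" for C
  proof -
    have "C \<noteq> {}" using that unfolding clusters_def by (rule in_quotient_imp_non_empty[OF same_cluster_equiv])
    then show ?thesis by (simp add: some_in_eq)
  qed
  have FT: "F \<subseteq> T" 
  proof
    fix u assume "u \<in> F"
    then obtain C where C: "C \<in> clusters T k" "u = (SOME u. u \<in> C)" by (auto simp: F_def)
    have "C \<subseteq> T" using C(1) unfolding clusters_def by (rule in_quotient_imp_subset[OF same_cluster_equiv])
    then show "u \<in> T" using sel[OF C(1)] C(2) by blast
  qed
  have cover: "\<exists>w\<in>F. (w, u) \<in> ?r" if u: "u \<in> T" for u
  proof -
    let ?C = "?r `` {u}"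
    have C: "?C \<in> clusters T k" using u by (auto simp: clusters_def intro: quotientI)
    then have vF: "(SOME v. v \<in> ?C) \<in> F" unfolding F_def by (rule imageI)
    have "(SOME v. v \<in> ?C) \<in> ?C" by (rule sel[OF C])
    then have "(u, SOME v. v \<in> ?C) \<in> ?r" by (rule ImageE) (simp only: singleton_iff)
    then show ?thesis by (rule bexI[OF same_cluster_sym vF])
  qed
  have finF: "finite F" using fin by (simp add: F_def)
  show "\<exists>F. finite F \<and> F \<subseteq> T \<and> (\<forall>u\<in>T. \<exists>w\<in>F. (w, u) \<in> ?r)"
    using finF FT cover by (intro exI[of _ F] conjI ballI)
next
  let ?r = "same_cluster T k"
  assume "\<exists>F. finite F \<and> F \<subseteq> T \<and> (\<forall>u\<in>T. \<exists>w\<in>F. (w, u) \<in> ?r)"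
  then obtain F where F: "finite F" "F \<subseteq> T" "\<forall>u\<in>T. \<exists>w\<in>F. (w, u) \<in> ?r" by blast
  have "clusters T k \<subseteq> (\<lambda>w. ?r `` {w}) ` F"
  proof
    fix C assume "C \<in> clusters T k"
    then obtain u where u: "u \<in> T" "C = ?r `` {u}" by (auto simp: clusters_def elim: quotientE)
    then obtain w where "w \<in> F" and wu: "(w, u) \<in> ?r" using F(3) by blast
    have "C = ?r `` {w}"
      unfolding u(2) by (rule equiv_class_eq[OF same_cluster_equiv same_cluster_sym[OF wu]])
    then show "C \<in> (\<lambda>w. ?r `` {w}) ` F" using \<open>w \<in> F\<close> by (rule image_eqI)
  qed
  then show "finite (clusters T k)" using F(1) by (rule finite_surj[rotated])
qed

lemma top_of_Nil_iff: "top_of k u = [] \<longleftrightarrow> (\<forall>t. prefix t u \<and> t \<noteq> [] \<longrightarrow> k t)"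
proof (induction u rule: rev_induct)
  case Nil
  then show ?case by simp
next
  case (snoc i u)
  show ?case
  proof (cases "k (u @ [i])")
    case True
    then show ?thesis using snoc by (auto simp: top_of_snoc)
  next
    case False
    then have "top_of k (u @ [i]) = u @ [i]" by (rule top_of_stop)
    then show ?thesis using False by auto
  qed
qed

lemma second_cluster_ge_iff:
  assumes "1 \<le> j"
  shows "j \<le> second_cluster_size T k \<longleftrightarrow>
    (\<exists>F. finite F \<and> F \<subseteq> T \<and> (\<forall>u\<in>T. \<exists>w\<in>F. (w, u) \<in> same_cluster T k)) \<and>
    (\<exists>u\<in>T. \<exists>w\<in>T. (u, w) \<notin> same_cluster T k \<and>
      j \<le> card (same_cluster T k `` {u}) \<and> j \<le> card (same_cluster T k `` {w}))"
proof -
  let ?r = "same_cluster T k"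
  have cl: "clusters T k = (\<lambda>u. ?r `` {u}) ` T" unfolding clusters_def quotient_def by blast
  have bex: "(\<exists>C\<in>(\<lambda>u. ?r `` {u}) ` T. Q C) \<longleftrightarrow> (\<exists>u\<in>T. Q (?r `` {u}))" for Q
    by blast
  have e: "(\<exists>C\<in>clusters T k. \<exists>C'\<in>clusters T k. C \<noteq> C' \<and> j \<le> card C \<and> j \<le> card C') \<longleftrightarrow>
    (\<exists>u\<in>T. \<exists>w\<in>T. (u, w) \<notin> ?r \<and> j \<le> card (?r `` {u}) \<and> j \<le> card (?r `` {w}))"
    unfolding cl bex by (intro bex_cong refl) (simp add: eq_equiv_class_iff[OF same_cluster_equiv])
  show ?thesis unfolding second_cluster_size_iff[OF assms] finite_clusters_iff e by (rule refl)
qed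


locale percolated_model =
  split_tree_model M b s s0 s1 D n V balls + percolated_split_tree M b s s0 s1 D n V balls p keep
  for M :: "'w measure" and b s s0 s1 D n V balls p keep
begin

abbreviation tr :: "'w \<Rightarrow> nat list set" where "tr \<equiv> split_tree b balls"

abbreviation mark :: "'w \<Rightarrow> nat list \<Rightarrow> bool" where "mark \<omega> \<equiv> (\<lambda>e. keep e \<omega>)"

lemma keep_sets: "e \<in> tree_edges b \<Longrightarrow> {\<omega> \<in> space M. keep e \<omega>} \<in> sets M"
proof -
  assume e: "e \<in> tree_edges b"
  have "keep e \<in> measurable M (count_space UNIV)"
    using keep_indep e unfolding indep_vars_def by blast
  then have "keep e -` {True} \<inter> space M \<in> sets M" by (rule measurable_sets) simp
  moreover have "keep e -` {True} \<inter> space M = {\<omega> \<in> space M. keep e \<omega>}" by auto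
  ultimately show ?thesis by simp
qed

lemma tree_sets: "{\<omega> \<in> space M. u \<in> tr \<omega>} \<in> sets M"
proof (cases "u \<in> vertices b")
  case True
  have "balls u -` {0<..} \<inter> space M \<in> sets M"
    by (rule measurable_sets[OF balls_measurable'[OF True]]) simp
  moreover have "balls u -` {0<..} \<inter> space M = {\<omega> \<in> space M. u \<in> tr \<omega>}"
    using True by (auto simp: split_tree_def)
  ultimately show ?thesis by simp
next
  case False
  then have e: "{\<omega> \<in> space M. u \<in> tr \<omega>} = {}" by (auto simp: split_tree_def)
  show ?thesis unfolding e by (rule sets.empty_sets)
qed

lemma p_range: "0 \<le> p" "p \<le> 1"
proof -
  have "[0] \<in> tree_edges b" using b_pos by simp
  then have "prob {\<omega> \<in> space M. keep [0] \<omega>} = p" by (rule keep_prob)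
  then show "0 \<le> p" "p \<le> 1" by auto
qed

lemma sub_tree_sets: "finite A \<Longrightarrow> {\<omega> \<in> space M. A \<subseteq> tr \<omega>} \<in> sets M"
proof -
  assume A: "finite A"
  have "{\<omega> \<in> space M. \<forall>u\<in>A. u \<in> tr \<omega>} \<in> sets M"
    by (intro sets.sets_Collect_finite_All tree_sets A)
  then show ?thesis by (simp add: subset_eq)
qed

lemma all_kept_sets: "finite F \<Longrightarrow> F \<subseteq> tree_edges b \<Longrightarrow> {\<omega> \<in> space M. \<forall>e\<in>F. keep e \<omega>} \<in> sets M"
  by (intro sets.sets_Collect_finite_All keep_sets) auto

lemma prob_all_kept:
  assumes F: "finite F" "F \<subseteq> tree_edges b"
  shows "prob {\<omega> \<in> space M. \<forall>e\<in>F. keep e \<omega>} = p ^ card F"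
proof (cases "F = {}")
  case True
  then show ?thesis by (simp add: prob_space)
next
  case False
  have "prob (\<Inter>e\<in>F. keep e -` {True} \<inter> space M) = (\<Prod>e\<in>F. prob (keep e -` {True} \<inter> space M))"
    by (rule indep_varsD[OF keep_indep False F(1) F(2)]) simp
  also have "(\<Inter>e\<in>F. keep e -` {True} \<inter> space M) = {\<omega> \<in> space M. \<forall>e\<in>F. keep e \<omega>}"
    using False by auto
  also have "(\<Prod>e\<in>F. prob (keep e -` {True} \<inter> space M)) = (\<Prod>e\<in>F. p)"
  proof (rule prod.cong[OF refl])
    fix e assume "e \<in> F"
    then have e: "e \<in> tree_edges b" using F(2) by blast
    have "keep e -` {True} \<inter> space M = {\<omega> \<in> space M. keep e \<omega>}" by auto
    then show "prob (keep e -` {True} \<inter> space M) = p" using keep_prob[OF e] by simp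
  qed
  finally show ?thesis by simp
qed

lemma sets_coordinates:
  assumes "finite A" "A \<subseteq> I"
  shows "{f \<in> space (Pi\<^sub>M I (\<lambda>_. count_space (UNIV :: bool set))). \<forall>u\<in>A. f u} \<in> sets (Pi\<^sub>M I (\<lambda>_. count_space UNIV))"
proof (rule sets.sets_Collect_finite_All[OF _ assms(1)])
  fix u assume "u \<in> A"
  then have "(\<lambda>f. f u) \<in> measurable (Pi\<^sub>M I (\<lambda>_. count_space (UNIV :: bool set))) (count_space UNIV)"
    using assms(2) by (intro measurable_component_singleton) auto
  then show "{f \<in> space (Pi\<^sub>M I (\<lambda>_. count_space (UNIV :: bool set))). f u} \<in> sets (Pi\<^sub>M I (\<lambda>_. count_space UNIV))"
    unfolding pred_def[symmetric] .
qed

lemma prob_tree_kept: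
  assumes A: "finite A" "A \<subseteq> vertices b" and F: "finite F" "F \<subseteq> tree_edges b"
  shows "prob {\<omega> \<in> space M. A \<subseteq> tr \<omega> \<and> (\<forall>e\<in>F. keep e \<omega>)} = prob {\<omega> \<in> space M. A \<subseteq> tr \<omega>} * p ^ card F"
proof -
  let ?X = "\<lambda>\<omega>. \<lambda>u\<in>vertices b. u \<in> tr \<omega>" and ?Y = "\<lambda>\<omega>. \<lambda>e\<in>tree_edges b. keep e \<omega>"
  let ?A = "{f \<in> space (Pi\<^sub>M (vertices b) (\<lambda>_. count_space (UNIV :: bool set))). \<forall>u\<in>A. f u}"
  let ?F = "{f \<in> space (Pi\<^sub>M (tree_edges b) (\<lambda>_. count_space (UNIV :: bool set))). \<forall>e\<in>F. f e}"
  have "prob ((\<lambda>\<omega>. (?X \<omega>, ?Y \<omega>)) -` (?A \<times> ?F) \<inter> space M) = prob (?X -` ?A \<inter> space M) * prob (?Y -` ?F \<inter> space M)"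
    by (rule indep_varD[OF keep_tree_indep sets_coordinates[OF A] sets_coordinates[OF F]])
  moreover have "?X -` ?A \<inter> space M = {\<omega> \<in> space M. A \<subseteq> tr \<omega>}"
    using A(2) by (auto simp: space_PiM subset_iff)
  moreover have "?Y -` ?F \<inter> space M = {\<omega> \<in> space M. \<forall>e\<in>F. keep e \<omega>}"
    using F(2) by (auto simp: space_PiM subset_iff)
  moreover have "(\<lambda>\<omega>. (?X \<omega>, ?Y \<omega>)) -` (?A \<times> ?F) \<inter> space M =
    (?X -` ?A \<inter> space M) \<inter> (?Y -` ?F \<inter> space M)" by blast
  ultimately have "prob ({\<omega> \<in> space M. A \<subseteq> tr \<omega>} \<inter> {\<omega> \<in> space M. \<forall>e\<in>F. keep e \<omega>}) =
    prob {\<omega> \<in> space M. A \<subseteq> tr \<omega>} * prob {\<omega> \<in> space M. \<forall>e\<in>F. keep e \<omega>}"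
    by (simp only:)
  moreover have "{\<omega> \<in> space M. A \<subseteq> tr \<omega>} \<inter> {\<omega> \<in> space M. \<forall>e\<in>F. keep e \<omega>} =
    {\<omega> \<in> space M. A \<subseteq> tr \<omega> \<and> (\<forall>e\<in>F. keep e \<omega>)}" by blast
  ultimately show ?thesis by (simp only: prob_all_kept[OF F])
qed

lemma prob_tree_closed:
  assumes A: "finite A" "A \<subseteq> vertices b" and e: "e \<in> tree_edges b"
  shows "prob {\<omega> \<in> space M. A \<subseteq> tr \<omega> \<and> \<not> keep e \<omega>} = prob {\<omega> \<in> space M. A \<subseteq> tr \<omega>} * (1 - p)"
    and "{\<omega> \<in> space M. A \<subseteq> tr \<omega> \<and> \<not> keep e \<omega>} \<in> sets M"
proof -
  let ?A = "{\<omega> \<in> space M. A \<subseteq> tr \<omega>}" and ?B = "{\<omega> \<in> space M. A \<subseteq> tr \<omega> \<and> (\<forall>e\<in>{e}. keep e \<omega>)}"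
  have eq: "{\<omega> \<in> space M. A \<subseteq> tr \<omega> \<and> \<not> keep e \<omega>} = ?A - ?B" by blast
  have B: "?B \<in> sets M"
    by (intro sets.sets_Collect_conj sub_tree_sets all_kept_sets A) (use e in auto)
  show "{\<omega> \<in> space M. A \<subseteq> tr \<omega> \<and> \<not> keep e \<omega>} \<in> sets M"
    unfolding eq by (intro sets.Diff sub_tree_sets A B)
  have "prob (?A - ?B) = prob ?A - prob ?B"
    by (intro finite_measure_Diff sub_tree_sets A B) blast
  also have "prob ?B = prob ?A * p ^ card {e}" using e by (intro prob_tree_kept A) auto
  finally show "prob {\<omega> \<in> space M. A \<subseteq> tr \<omega> \<and> \<not> keep e \<omega>} = prob ?A * (1 - p)"
    unfolding eq by (simp add: algebra_simps)
qed

lemma nn_sum_events: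
  assumes I: "finite I" and c: "\<And>i. i \<in> I \<Longrightarrow> 0 \<le> c i"
    and E: "\<And>i. i \<in> I \<Longrightarrow> {\<omega> \<in> space M. E i \<omega>} \<in> sets M"
  shows "(\<integral>\<^sup>+\<omega>. ennreal (\<Sum>i\<in>I. c i * of_bool (E i \<omega>)) \<partial>M) = ennreal (\<Sum>i\<in>I. c i * prob {\<omega> \<in> space M. E i \<omega>})"
proof -
  have "(\<integral>\<^sup>+\<omega>. ennreal (\<Sum>i\<in>I. c i * of_bool (E i \<omega>)) \<partial>M) =
    (\<integral>\<^sup>+\<omega>. (\<Sum>i\<in>I. ennreal (c i) * indicator {\<omega> \<in> space M. E i \<omega>} \<omega>) \<partial>M)"
  proof (rule nn_integral_cong)
    fix \<omega> assume \<omega>: "\<omega> \<in> space M"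
    have "ennreal (\<Sum>i\<in>I. c i * of_bool (E i \<omega>)) = (\<Sum>i\<in>I. ennreal (c i * of_bool (E i \<omega>)))"
      using c by (intro sum_ennreal[symmetric]) simp
    also have "\<dots> = (\<Sum>i\<in>I. ennreal (c i) * indicator {\<omega> \<in> space M. E i \<omega>} \<omega>)"
      using \<omega> by (intro sum.cong refl) (simp add: indicator_def)
    finally show "ennreal (\<Sum>i\<in>I. c i * of_bool (E i \<omega>)) = (\<Sum>i\<in>I. ennreal (c i) * indicator {\<omega> \<in> space M. E i \<omega>} \<omega>)" .
  qed
  also have "\<dots> = (\<Sum>i\<in>I. \<integral>\<^sup>+\<omega>. ennreal (c i) * indicator {\<omega> \<in> space M. E i \<omega>} \<omega> \<partial>M)"
    using E by (intro nn_integral_sum borel_measurable_times_ennreal borel_measurable_indicator) auto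
  also have "\<dots> = (\<Sum>i\<in>I. ennreal (c i * prob {\<omega> \<in> space M. E i \<omega>}))"
  proof (rule sum.cong[OF refl])
    fix i assume i: "i \<in> I"
    show "(\<integral>\<^sup>+\<omega>. ennreal (c i) * indicator {\<omega> \<in> space M. E i \<omega>} \<omega> \<partial>M) = ennreal (c i * prob {\<omega> \<in> space M. E i \<omega>})"
      using c[OF i] E[OF i] by (simp add: nn_integral_cmult_indicator emeasure_eq_measure ennreal_mult)
  qed
  also have "\<dots> = ennreal (\<Sum>i\<in>I. c i * prob {\<omega> \<in> space M. E i \<omega>})"
    using c by (intro sum_ennreal) simp
  finally show ?thesis .
qed

definition reach :: "nat list \<Rightarrow> 'w \<Rightarrow> bool" where
  "reach u \<omega> \<longleftrightarrow> u \<in> tr \<omega> \<and> (\<forall>e\<in>proper u. keep e \<omega>)"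

definition root_count :: "nat \<Rightarrow> 'w \<Rightarrow> real" where
  "root_count N \<omega> = (\<Sum>u\<in>words b N. of_bool (reach u \<omega>))"

text \<open>
Pairs of vertices of the tree, counted once for each closed edge above both of them.
\<close>

definition severed_pairs :: "nat \<Rightarrow> 'w \<Rightarrow> real" where
  "severed_pairs N \<omega> = (\<Sum>x\<in>words b N. \<Sum>y\<in>words b N. \<Sum>t\<in>proper x \<inter> proper y.
     of_bool (x \<in> tr \<omega> \<and> y \<in> tr \<omega> \<and> \<not> keep t \<omega>))"

lemma proper_edges: "u \<in> vertices b \<Longrightarrow> proper u \<subseteq> tree_edges b"
  using set_mono_prefix unfolding proper_def by (fastforce simp: in_lists_conv_set)

lemma reach_sets: "u \<in> vertices b \<Longrightarrow> {\<omega> \<in> space M. reach u \<omega>} \<in> sets M"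
  unfolding reach_def using proper_edges
  by (intro sets.sets_Collect_conj tree_sets all_kept_sets finite_proper)

lemma occ_eq: "u \<in> vertices b \<Longrightarrow> occ u \<omega> = of_bool (u \<in> tr \<omega>)"
  by (simp add: occ_def pos_def split_tree_def)

lemma root_count_mean: "(\<integral>\<^sup>+\<omega>. ennreal (root_count N \<omega>) \<partial>M) = ennreal (visits_upto p N n)"
proof -
  have "(\<integral>\<^sup>+\<omega>. ennreal (root_count N \<omega>) \<partial>M) = (\<integral>\<^sup>+\<omega>. ennreal (\<Sum>u\<in>words b N. 1 * of_bool (reach u \<omega>)) \<partial>M)"
    by (simp add: root_count_def)
  also have "\<dots> = ennreal (\<Sum>u\<in>words b N. 1 * prob {\<omega> \<in> space M. reach u \<omega>})"
    by (intro nn_sum_events reach_sets) (auto dest: words_vertices)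
  also have "(\<Sum>u\<in>words b N. 1 * prob {\<omega> \<in> space M. reach u \<omega>}) =
    (\<Sum>u\<in>words b N. p ^ length u * prob {\<omega> \<in> space M. u \<in> tr \<omega>})"
  proof (rule sum.cong[OF refl])
    fix u assume "u \<in> words b N"
    then have u: "u \<in> vertices b" by (rule words_vertices)
    have "prob {\<omega> \<in> space M. {u} \<subseteq> tr \<omega> \<and> (\<forall>e\<in>proper u. keep e \<omega>)} = prob {\<omega> \<in> space M. {u} \<subseteq> tr \<omega>} * p ^ card (proper u)"
      using u by (intro prob_tree_kept proper_edges) auto
    then show "1 * prob {\<omega> \<in> space M. reach u \<omega>} = p ^ length u * prob {\<omega> \<in> space M. u \<in> tr \<omega>}"
      by (simp add: reach_def)
  qed
  also have "ennreal (\<Sum>u\<in>words b N. p ^ length u * prob {\<omega> \<in> space M. u \<in> tr \<omega>}) =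
    (\<integral>\<^sup>+\<omega>. ennreal (\<Sum>u\<in>words b N. p ^ length u * of_bool (u \<in> tr \<omega>)) \<partial>M)"
    using p_range by (intro nn_sum_events[symmetric] tree_sets) auto
  also have "\<dots> = (\<integral>\<^sup>+\<omega>. ennreal (weighted_count p N [] \<omega>) \<partial>M)"
    unfolding weighted_count_def by (simp add: occ_eq words_vertices cong: sum.cong)
  also have "\<dots> = ennreal (visits_upto p N n)" by (rule weighted_count_mean[OF p_range(1)])
  finally show ?thesis .
qed

lemma pairsum_as_events:
  assumes "\<And>l. 0 \<le> q l" "0 \<le> r"
  shows "(\<integral>\<^sup>+\<omega>. ennreal (pairsum q r N 0 [] \<omega>) \<partial>M) =
    ennreal (\<Sum>(x, y)\<in>words b N \<times> words b N. meet_weight q r 0 x y * prob {\<omega> \<in> space M. {x, y} \<subseteq> tr \<omega>})"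
proof -
  have "pairsum q r N 0 [] \<omega> = (\<Sum>i\<in>words b N \<times> words b N. meet_weight q r 0 (fst i) (snd i) * of_bool ({fst i, snd i} \<subseteq> tr \<omega>))" for \<omega>
    unfolding pairsum_def sum.cartesian_product
    by (intro sum.cong refl) (auto simp: occ_eq words_vertices)
  then have "(\<integral>\<^sup>+\<omega>. ennreal (pairsum q r N 0 [] \<omega>) \<partial>M) =
    ennreal (\<Sum>i\<in>words b N \<times> words b N. meet_weight q r 0 (fst i) (snd i) * prob {\<omega> \<in> space M. {fst i, snd i} \<subseteq> tr \<omega>})"
    using assms by (simp only:) (intro nn_sum_events sub_tree_sets meet_weight_nonneg; simp)
  then show ?thesis by (simp add: case_prod_unfold)
qed

lemma root_count_square: "(\<integral>\<^sup>+\<omega>. ennreal ((root_count N \<omega>)\<^sup>2) \<partial>M) \<le> ennreal (\<Sum>l<N. p ^ l * (P ^^ l) (tau p) n)"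
proof -
  have "(root_count N \<omega>)\<^sup>2 = (\<Sum>i\<in>words b N \<times> words b N. 1 * of_bool ({fst i, snd i} \<subseteq> tr \<omega> \<and> (\<forall>e\<in>proper (fst i) \<union> proper (snd i). keep e \<omega>)))" for \<omega>
    unfolding root_count_def power2_eq_square sum_product sum.cartesian_product
    by (intro sum.cong refl) (auto simp: reach_def)
  then have "(\<integral>\<^sup>+\<omega>. ennreal ((root_count N \<omega>)\<^sup>2) \<partial>M) =
    ennreal (\<Sum>i\<in>words b N \<times> words b N. 1 * prob {\<omega> \<in> space M. {fst i, snd i} \<subseteq> tr \<omega> \<and> (\<forall>e\<in>proper (fst i) \<union> proper (snd i). keep e \<omega>)})"
  proof (simp only:, intro nn_sum_events)
    fix i assume "i \<in> words b N \<times> words b N"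
    then have "fst i \<in> vertices b" "snd i \<in> vertices b" by (auto dest: words_vertices)
    then have "proper (fst i) \<union> proper (snd i) \<subseteq> tree_edges b" using proper_edges by simp
    then show "{\<omega> \<in> space M. {fst i, snd i} \<subseteq> tr \<omega> \<and> (\<forall>e\<in>proper (fst i) \<union> proper (snd i). keep e \<omega>)} \<in> sets M"
      by (intro sets.sets_Collect_conj sub_tree_sets all_kept_sets) auto
  qed auto
  also have "(\<Sum>i\<in>words b N \<times> words b N. 1 * prob {\<omega> \<in> space M. {fst i, snd i} \<subseteq> tr \<omega> \<and> (\<forall>e\<in>proper (fst i) \<union> proper (snd i). keep e \<omega>)})
    = (\<Sum>(x, y)\<in>words b N \<times> words b N. meet_weight (\<lambda>l. p ^ l) p 0 x y * prob {\<omega> \<in> space M. {x, y} \<subseteq> tr \<omega>})"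
  proof (rule sum.cong[OF refl])
    fix i assume "i \<in> words b N \<times> words b N"
    then have v: "fst i \<in> vertices b" "snd i \<in> vertices b" by (auto dest: words_vertices)
    then have "prob {\<omega> \<in> space M. {fst i, snd i} \<subseteq> tr \<omega> \<and> (\<forall>e\<in>proper (fst i) \<union> proper (snd i). keep e \<omega>)} =
      prob {\<omega> \<in> space M. {fst i, snd i} \<subseteq> tr \<omega>} * p ^ card (proper (fst i) \<union> proper (snd i))"
      using proper_edges[OF v(1)] proper_edges[OF v(2)] by (intro prob_tree_kept) auto
    then show "1 * prob {\<omega> \<in> space M. {fst i, snd i} \<subseteq> tr \<omega> \<and> (\<forall>e\<in>proper (fst i) \<union> proper (snd i). keep e \<omega>)} =
      (case i of (x, y) \<Rightarrow> meet_weight (\<lambda>l. p ^ l) p 0 x y * prob {\<omega> \<in> space M. {x, y} \<subseteq> tr \<omega>})"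
      by (simp add: case_prod_unfold meet_weight_union)
  qed
  also have "ennreal \<dots> = (\<integral>\<^sup>+\<omega>. ennreal (pairsum (\<lambda>l. p ^ l) p N 0 [] \<omega>) \<partial>M)"
    using p_range by (intro pairsum_as_events[symmetric]) auto
  also have "\<dots> \<le> ennreal (\<Sum>l<N. p ^ l * (P ^^ l) (tau p) n)"
    using p_range by (intro pairsum_root_le) auto
  finally show ?thesis .
qed

lemma severed_pairs_mean: "(\<integral>\<^sup>+\<omega>. ennreal (severed_pairs N \<omega>) \<partial>M) \<le> ennreal ((1 - p) * (\<Sum>l<N. real l * (P ^^ l) (tau 1) n))"
proof -
  let ?W = "words b N \<times> words b N"
  let ?I = "Sigma ?W (\<lambda>i. proper (fst i) \<inter> proper (snd i))"
  let ?E = "\<lambda>i \<omega>. {fst (fst i), snd (fst i)} \<subseteq> tr \<omega> \<and> \<not> keep (snd i) \<omega>"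
  have fin: "finite ?I" by (intro finite_SigmaI) auto
  have severed_pairs: "severed_pairs N \<omega> = (\<Sum>i\<in>?I. 1 * of_bool (?E i \<omega>))" for \<omega>
  proof -
    have "severed_pairs N \<omega> = (\<Sum>i\<in>?W. \<Sum>t\<in>proper (fst i) \<inter> proper (snd i). 1 * of_bool (?E (i, t) \<omega>))"
      unfolding severed_pairs_def sum.cartesian_product by (intro sum.cong refl) (auto simp: case_prod_unfold)
    also have "\<dots> = (\<Sum>(i, t)\<in>?I. 1 * of_bool (?E (i, t) \<omega>))"
      by (rule sum.Sigma) auto
    also have "\<dots> = (\<Sum>i\<in>?I. 1 * of_bool (?E i \<omega>))"
      by (intro sum.cong refl) (simp only: case_prod_unfold prod.collapse)
    finally show ?thesis .
  qed
  have v: "fst (fst i) \<in> vertices b" "snd (fst i) \<in> vertices b" "snd i \<in> tree_edges b" if "i \<in> ?I" for i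
  proof -
    have w: "fst (fst i) \<in> words b N" "snd (fst i) \<in> words b N" and t: "snd i \<in> proper (fst (fst i))"
      using that by auto
    show f: "fst (fst i) \<in> vertices b" by (rule words_vertices[OF w(1)])
    show "snd (fst i) \<in> vertices b" by (rule words_vertices[OF w(2)])
    show "snd i \<in> tree_edges b" using proper_edges[OF f] t by blast
  qed
  have "(\<integral>\<^sup>+\<omega>. ennreal (severed_pairs N \<omega>) \<partial>M) = ennreal (\<Sum>i\<in>?I. 1 * prob {\<omega> \<in> space M. ?E i \<omega>})"
    unfolding severed_pairs using v by (intro nn_sum_events fin prob_tree_closed(2)) auto
  also have "(\<Sum>i\<in>?I. 1 * prob {\<omega> \<in> space M. ?E i \<omega>}) =
    (\<Sum>i\<in>?I. prob {\<omega> \<in> space M. {fst (fst i), snd (fst i)} \<subseteq> tr \<omega>} * (1 - p))"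
  proof (rule sum.cong[OF refl])
    fix i assume i: "i \<in> ?I"
    show "1 * prob {\<omega> \<in> space M. ?E i \<omega>} = prob {\<omega> \<in> space M. {fst (fst i), snd (fst i)} \<subseteq> tr \<omega>} * (1 - p)"
      using prob_tree_closed(1)[of "{fst (fst i), snd (fst i)}" "snd i"] v[OF i] by simp
  qed
  also have "\<dots> = (\<Sum>i\<in>?W. \<Sum>t\<in>proper (fst i) \<inter> proper (snd i). prob {\<omega> \<in> space M. {fst i, snd i} \<subseteq> tr \<omega>} * (1 - p))"
    by (subst sum.Sigma) (auto intro!: sum.cong)
  also have "\<dots> = (1 - p) * (\<Sum>(x, y)\<in>?W. meet_weight real 1 0 x y * prob {\<omega> \<in> space M. {x, y} \<subseteq> tr \<omega>})"
    unfolding sum_distrib_left by (intro sum.cong refl) (simp add: case_prod_unfold meet_weight_inter)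
  also have "ennreal \<dots> = ennreal (1 - p) * (\<integral>\<^sup>+\<omega>. ennreal (pairsum real 1 N 0 [] \<omega>) \<partial>M)"
  proof -
    have e: "(\<integral>\<^sup>+\<omega>. ennreal (pairsum real 1 N 0 [] \<omega>) \<partial>M) =
      ennreal (\<Sum>(x, y)\<in>?W. meet_weight real 1 0 x y * prob {\<omega> \<in> space M. {x, y} \<subseteq> tr \<omega>})"
      by (rule pairsum_as_events) simp_all
    show ?thesis unfolding e by (rule ennreal_mult') (use p_range in simp)
  qed
  also have "\<dots> \<le> ennreal (1 - p) * ennreal (\<Sum>l<N. real l * (P ^^ l) (tau 1) n)"
    by (intro mult_left_mono pairsum_root_le) auto
  also have "\<dots> = ennreal ((1 - p) * (\<Sum>l<N. real l * (P ^^ l) (tau 1) n))"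
    using p_range by (intro ennreal_mult'[symmetric]) simp
  finally show ?thesis .
qed

end

section \<open>Measurability and deviation bounds\<close>

text \<open>
A random subset of a countable type has countably many possible finite values.
\<close>

lemma card_random_set_measurable:
  fixes S :: "'a \<Rightarrow> 'b::countable set"
  assumes S: "\<And>u. {\<omega> \<in> space M. u \<in> S \<omega>} \<in> sets M"
  shows "(\<lambda>\<omega>. card (S \<omega>)) \<in> measurable M (count_space UNIV)"
proof -
  have eq: "{\<omega> \<in> space M. S \<omega> = F} \<in> sets M" for F
  proof -
    have "{\<omega> \<in> space M. (u \<in> S \<omega>) = (u \<in> F)} \<in> sets M" for u
      using S[of u] sets.sets_Collect_neg[OF S[of u]] by (cases "u \<in> F") simp_all
    then have "{\<omega> \<in> space M. \<forall>u. (u \<in> S \<omega>) = (u \<in> F)} \<in> sets M"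
      by (rule sets.sets_Collect_countable_All)
    then show ?thesis by (simp add: set_eq_iff)
  qed
  have fin: "{\<omega> \<in> space M. \<exists>xs. S \<omega> = set xs \<and> card (set xs) = j} \<in> sets M" for j
    by (intro sets.sets_Collect_countable_Ex sets.sets_Collect_conj eq sets.sets_Collect_const)
  have finite_card: "(\<exists>xs. X = set xs \<and> card (set xs) = j) \<longleftrightarrow> finite X \<and> card X = j" for X :: "'b set" and j
    using finite_list[of X] by auto
  have "{\<omega> \<in> space M. \<not> (\<exists>j. finite (S \<omega>) \<and> card (S \<omega>) = Suc j)} \<in> sets M"
    by (intro sets.sets_Collect_neg sets.sets_Collect_countable_Ex) (use fin finite_card in simp)
  moreover have "(card (S \<omega>) = 0) \<longleftrightarrow> \<not> (\<exists>j. finite (S \<omega>) \<and> card (S \<omega>) = Suc j)" for \<omega>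
    by (cases "finite (S \<omega>)"; cases "card (S \<omega>)") auto
  ultimately have zero: "{\<omega> \<in> space M. card (S \<omega>) = 0} \<in> sets M" by simp
  have pos: "{\<omega> \<in> space M. card (S \<omega>) = Suc j} \<in> sets M" for j
  proof -
    have "card X = Suc j \<longleftrightarrow> finite X \<and> card X = Suc j" for X :: "'b set"
      using card_ge_0_finite[of X] by auto
    then have "{\<omega> \<in> space M. card (S \<omega>) = Suc j} = {\<omega> \<in> space M. finite (S \<omega>) \<and> card (S \<omega>) = Suc j}" by blast
    then show ?thesis using fin[of "Suc j"] unfolding finite_card by simp
  qed
  show ?thesis
    unfolding measurable_count_space_eq_countable[OF countableI_type]
  proof (intro conjI ballI)
    fix j :: nat
    have "(\<lambda>\<omega>. card (S \<omega>)) -` {j} \<inter> space M = {\<omega> \<in> space M. card (S \<omega>) = j}" by auto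
    then show "(\<lambda>\<omega>. card (S \<omega>)) -` {j} \<inter> space M \<in> sets M"
      using zero pos by (cases j) simp_all
  qed simp
qed

lemma measurable_nat_of_ge:
  fixes X :: "'a \<Rightarrow> nat"
  assumes "\<And>j. {\<omega> \<in> space M. Suc j \<le> X \<omega>} \<in> sets M"
  shows "X \<in> measurable M (count_space UNIV)"
  unfolding measurable_count_space_eq_countable[OF countableI_type]
proof (intro conjI ballI)
  fix j :: nat
  have ge: "{\<omega> \<in> space M. i \<le> X \<omega>} \<in> sets M" for i using assms by (cases i) simp_all
  have "X -` {j} \<inter> space M = {\<omega> \<in> space M. j \<le> X \<omega>} - {\<omega> \<in> space M. Suc j \<le> X \<omega>}" by auto
  then show "X -` {j} \<inter> space M \<in> sets M" using ge by simp
qed simp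

context percolated_model
begin

abbreviation conn :: "'w \<Rightarrow> (nat list \<times> nat list) set" where
  "conn \<omega> \<equiv> open_edges (tr \<omega>) (mark \<omega>) \<union> (open_edges (tr \<omega>) (mark \<omega>))\<inverse>"

lemma open_edge_sets: "{\<omega> \<in> space M. (u, v) \<in> open_edges (tr \<omega>) (mark \<omega>)} \<in> sets M"
proof (cases "(\<exists>i. v = u @ [i]) \<and> v \<in> vertices b")
  case True
  then have v: "v \<in> tree_edges b" by auto
  have "{\<omega> \<in> space M. (u, v) \<in> open_edges (tr \<omega>) (mark \<omega>)} =
    {\<omega> \<in> space M. u \<in> tr \<omega> \<and> v \<in> tr \<omega> \<and> keep v \<omega>}"
    using True by (auto simp: open_edges_def)
  then show ?thesis by (simp only:) (intro sets.sets_Collect_conj tree_sets keep_sets v)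
next
  case False
  then have e: "{\<omega> \<in> space M. (u, v) \<in> open_edges (tr \<omega>) (mark \<omega>)} = {}"
    by (auto simp: open_edges_def split_tree_def)
  show ?thesis unfolding e by (rule sets.empty_sets)
qed

lemma conn_sets: "{\<omega> \<in> space M. (u, v) \<in> conn \<omega>} \<in> sets M"
  using sets.sets_Collect_disj[OF open_edge_sets[of v u] open_edge_sets[of u v]] by simp

lemma conn_power_sets: "{\<omega> \<in> space M. (u, v) \<in> conn \<omega> ^^ m} \<in> sets M"
proof (induction m arbitrary: v)
  case (Suc m)
  have "{\<omega> \<in> space M. \<exists>w. (u, w) \<in> conn \<omega> ^^ m \<and> (w, v) \<in> conn \<omega>} \<in> sets M"
    by (intro sets.sets_Collect_countable_Ex sets.sets_Collect_conj Suc.IH conn_sets)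
  then show ?case by (simp add: relcomp_unfold)
qed (simp add: sets.sets_Collect_const)

lemma same_cluster_sets: "{\<omega> \<in> space M. (u, v) \<in> same_cluster (tr \<omega>) (mark \<omega>)} \<in> sets M"
proof -
  have "{\<omega> \<in> space M. (\<exists>m. (u, v) \<in> conn \<omega> ^^ m) \<and> u \<in> tr \<omega> \<and> v \<in> tr \<omega>} \<in> sets M"
    by (intro sets.sets_Collect_countable_Ex sets.sets_Collect_conj conn_power_sets tree_sets)
  then show ?thesis by (simp add: same_cluster_def rtrancl_power)
qed

lemma cluster_card_measurable: "(\<lambda>\<omega>. card (same_cluster (tr \<omega>) (mark \<omega>) `` {u})) \<in> measurable M (count_space UNIV)"
  by (rule card_random_set_measurable) (simp add: same_cluster_sets)

lemma root_size_measurable: "(\<lambda>\<omega>. real (root_cluster_size (tr \<omega>) (mark \<omega>))) \<in> borel_measurable M"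
  unfolding root_cluster_size_def by (rule measurable_compose[OF cluster_card_measurable]) simp

lemma second_size_measurable: "(\<lambda>\<omega>. real (second_cluster_size (tr \<omega>) (mark \<omega>))) \<in> borel_measurable M"
proof -
  have card: "{\<omega> \<in> space M. j \<le> card (same_cluster (tr \<omega>) (mark \<omega>) `` {u})} \<in> sets M" for j u
  proof -
    have "(\<lambda>\<omega>. card (same_cluster (tr \<omega>) (mark \<omega>) `` {u})) -` {j..} \<inter> space M \<in> sets M"
      by (rule measurable_sets[OF cluster_card_measurable]) simp
    moreover have "(\<lambda>\<omega>. card (same_cluster (tr \<omega>) (mark \<omega>) `` {u})) -` {j..} \<inter> space M =
      {\<omega> \<in> space M. j \<le> card (same_cluster (tr \<omega>) (mark \<omega>) `` {u})}" by auto
    ultimately show ?thesis by simp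
  qed
  have fin: "{\<omega> \<in> space M. \<exists>xs. (\<forall>w\<in>set xs. w \<in> tr \<omega>) \<and>
      (\<forall>u. u \<in> tr \<omega> \<longrightarrow> (\<exists>w\<in>set xs. (w, u) \<in> same_cluster (tr \<omega>) (mark \<omega>)))} \<in> sets M"
    by (intro sets.sets_Collect_countable_Ex sets.sets_Collect_conj sets.sets_Collect_countable_All
        sets.sets_Collect_imp sets.sets_Collect_finite_All sets.sets_Collect_finite_Ex
        tree_sets same_cluster_sets finite_set)
  have two: "{\<omega> \<in> space M. \<exists>u. \<exists>w. u \<in> tr \<omega> \<and> w \<in> tr \<omega> \<and> (\<not> (u, w) \<in> same_cluster (tr \<omega>) (mark \<omega>)) \<and>
      j \<le> card (same_cluster (tr \<omega>) (mark \<omega>) `` {u}) \<and> j \<le> card (same_cluster (tr \<omega>) (mark \<omega>) `` {w})} \<in> sets M" for j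
    by (intro sets.sets_Collect_countable_Ex sets.sets_Collect_conj sets.sets_Collect_neg
        tree_sets same_cluster_sets card)
  have finset: "(\<exists>F. finite F \<and> F \<subseteq> A \<and> Q F) \<longleftrightarrow> (\<exists>xs. (\<forall>w\<in>set xs. w \<in> A) \<and> Q (set xs))"
    for A :: "nat list set" and Q
    by (metis finite_list finite_set subset_iff)
  have "{\<omega> \<in> space M. Suc j \<le> second_cluster_size (tr \<omega>) (mark \<omega>)} \<in> sets M" for j
  proof -
    have "Suc j \<le> second_cluster_size (tr \<omega>) (mark \<omega>) \<longleftrightarrow>
      (\<exists>xs. (\<forall>w\<in>set xs. w \<in> tr \<omega>) \<and>
        (\<forall>u. u \<in> tr \<omega> \<longrightarrow> (\<exists>w\<in>set xs. (w, u) \<in> same_cluster (tr \<omega>) (mark \<omega>)))) \<and>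
      (\<exists>u. \<exists>w. u \<in> tr \<omega> \<and> w \<in> tr \<omega> \<and> (\<not> (u, w) \<in> same_cluster (tr \<omega>) (mark \<omega>)) \<and>
        Suc j \<le> card (same_cluster (tr \<omega>) (mark \<omega>) `` {u}) \<and> Suc j \<le> card (same_cluster (tr \<omega>) (mark \<omega>) `` {w}))" for \<omega>
    proof -
      have one: "1 \<le> Suc j" by simp
      show ?thesis unfolding second_cluster_ge_iff[OF one] finset Ball_def[of "tr \<omega>"] Bex_def[of "tr \<omega>"] by blast
    qed
    then show ?thesis using sets.sets_Collect_conj[OF two[of "Suc j"] fin] by simp
  qed
  then have "(\<lambda>\<omega>. second_cluster_size (tr \<omega>) (mark \<omega>)) \<in> measurable M (count_space UNIV)"
    by (rule measurable_nat_of_ge)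
  then show ?thesis by (rule measurable_compose) simp
qed

text \<open>
The properties of the tree that hold almost surely and make the finite combinatorics of clusters
applicable.
\<close>

definition good :: "'w \<Rightarrow> bool" where
  "good \<omega> \<longleftrightarrow> finite (tr \<omega>) \<and> prefix_closed (tr \<omega>) \<and> [] \<in> tr \<omega>"

lemma AE_good: "0 < n \<Longrightarrow> AE \<omega> in M. good \<omega>"
proof -
  assume n: "0 < n"
  show ?thesis using AE_finite_tree AE_children_zero balls_root
  proof eventually_elim
    case (elim \<omega>)
    have "prefix_closed (tr \<omega>)"
      unfolding prefix_closed_def
    proof (intro allI impI)
      fix u i assume ui: "u @ [i] \<in> tr \<omega>"
      then have v: "u \<in> vertices b" "i < b" "0 < balls (u @ [i]) \<omega>" by (auto simp: split_tree_def)
      then have "balls u \<omega> \<noteq> 0" using elim(2) by force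
      then show "u \<in> tr \<omega>" using v by (simp add: split_tree_def)
    qed
    then show ?case using elim n by (simp add: good_def split_tree_def)
  qed
qed

lemma tree_in_words: "good \<omega> \<Longrightarrow> \<forall>\<^sub>F N in sequentially. tr \<omega> \<subseteq> words b N"
proof -
  assume g: "good \<omega>"
  define N0 where "N0 = Suc (Max (length ` tr \<omega>))"
  have "tr \<omega> \<subseteq> words b N" if "N0 \<le> N" for N
  proof
    fix x assume x: "x \<in> tr \<omega>"
    then have "length x \<le> Max (length ` tr \<omega>)" using g by (intro Max_ge) (auto simp: good_def)
    then show "x \<in> words b N" using x that by (auto simp: words_def N0_def split_tree_def)
  qed
  then show ?thesis unfolding eventually_sequentially by blast
qed

lemma root_size_eq:
  assumes "good \<omega>"
  shows "root_cluster_size (tr \<omega>) (mark \<omega>) = card {u. reach u \<omega>}"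
proof -
  have "same_cluster (tr \<omega>) (mark \<omega>) `` {[]} = {u \<in> tr \<omega>. top_of (mark \<omega>) u = []}"
    using assms by (intro root_cluster_eq) (auto simp: good_def)
  also have "\<dots> = {u. reach u \<omega>}" unfolding top_of_Nil_iff reach_def proper_def by blast
  finally show ?thesis by (simp add: root_cluster_size_def)
qed

lemma root_count_card: "root_count N \<omega> = real (card {u \<in> words b N. reach u \<omega>})"
  unfolding root_count_def by (simp add: Int_def)

lemma root_count_le: assumes "good \<omega>" shows "root_count N \<omega> \<le> real (root_cluster_size (tr \<omega>) (mark \<omega>))"
proof -
  have "{u. reach u \<omega>} \<subseteq> tr \<omega>" by (auto simp: reach_def)
  then have "finite {u. reach u \<omega>}" using assms by (auto simp: good_def intro: finite_subset)
  then show ?thesis unfolding root_count_card root_size_eq[OF assms] by (auto intro!: card_mono)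
qed

lemma root_count_eventually:
  assumes g: "good \<omega>"
  shows "\<forall>\<^sub>F N in sequentially. (real (root_cluster_size (tr \<omega>) (mark \<omega>)))\<^sup>2 \<le> (root_count N \<omega>)\<^sup>2"
  using tree_in_words[OF g]
proof eventually_elim
  case (elim N)
  have "{u \<in> words b N. reach u \<omega>} = {u. reach u \<omega>}" using elim by (auto simp: reach_def)
  then show ?case unfolding root_count_card root_size_eq[OF g] by simp
qed

lemma severed_pairs_eventually:
  assumes g: "good \<omega>"
  shows "\<forall>\<^sub>F N in sequentially. (real (second_cluster_size (tr \<omega>) (mark \<omega>)))\<^sup>2 \<le> severed_pairs N \<omega>"
  using tree_in_words[OF g]
proof eventually_elim
  case (elim N)
  let ?S = "\<lambda>x y. (\<Sum>t\<in>proper x \<inter> proper y. of_bool (x \<in> tr \<omega> \<and> y \<in> tr \<omega> \<and> \<not> keep t \<omega>)) :: real"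
  have S0: "0 \<le> ?S x y" for x y by (intro sum_nonneg) simp
  have "(real (second_cluster_size (tr \<omega>) (mark \<omega>)))\<^sup>2 \<le>
    (\<Sum>x\<in>tr \<omega>. \<Sum>y\<in>tr \<omega>. \<Sum>t\<in>{t. prefix t x \<and> prefix t y \<and> t \<noteq> []}. of_bool (\<not> keep t \<omega>))"
    using g by (intro second_cluster_le_pairs) (auto simp: good_def)
  also have "\<dots> = (\<Sum>x\<in>tr \<omega>. \<Sum>y\<in>tr \<omega>. ?S x y)"
  proof (intro sum.cong refl)
    show "{t. prefix t x \<and> prefix t y \<and> t \<noteq> []} = proper x \<inter> proper y" for x y
      by (auto simp: proper_def)
  qed auto
  also have "\<dots> \<le> (\<Sum>x\<in>tr \<omega>. \<Sum>y\<in>words b N. ?S x y)"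
    using elim S0 by (intro sum_mono sum_mono2) auto
  also have "\<dots> \<le> (\<Sum>x\<in>words b N. \<Sum>y\<in>words b N. ?S x y)"
    using elim S0 by (intro sum_mono2 sum_nonneg) auto
  finally show ?case unfolding severed_pairs_def .
qed

lemma of_bool_measurable:
  assumes "{\<omega> \<in> space M. E \<omega>} \<in> sets M"
  shows "(\<lambda>\<omega>. of_bool (E \<omega>) :: real) \<in> borel_measurable M"
proof -
  have "(indicator {\<omega> \<in> space M. E \<omega>} :: 'w \<Rightarrow> real) \<in> borel_measurable M"
    using assms by (rule borel_measurable_indicator)
  then show ?thesis by (rule measurable_cong[THEN iffD1, rotated]) (simp add: indicator_def)
qed

lemma root_count_measurable: "root_count N \<in> borel_measurable M"
  unfolding root_count_def[abs_def]
  by (intro borel_measurable_sum of_bool_measurable reach_sets words_vertices)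

lemma severed_pairs_measurable: "severed_pairs N \<in> borel_measurable M"
  unfolding severed_pairs_def[abs_def]
proof (intro borel_measurable_sum of_bool_measurable)
  fix x y t assume x: "x \<in> words b N" and y: "y \<in> words b N" and t: "t \<in> proper x \<inter> proper y"
  have "t \<in> tree_edges b" using proper_edges[OF words_vertices[OF x]] t by blast
  then show "{\<omega> \<in> space M. x \<in> tr \<omega> \<and> y \<in> tr \<omega> \<and> \<not> keep t \<omega>} \<in> sets M"
    by (intro sets.sets_Collect_conj sets.sets_Collect_neg tree_sets keep_sets)
qed

text \<open>
Fatou's lemma for truncations in depth: almost surely the tree is finite, so a truncated count
eventually dominates the full one.
\<close>

lemma fatou_bound:
  assumes X: "\<And>N. X N \<in> borel_measurable M" and B: "\<And>N. (\<integral>\<^sup>+\<omega>. ennreal (X N \<omega>) \<partial>M) \<le> B"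
    and le: "AE \<omega> in M. \<forall>\<^sub>F N in sequentially. Y \<omega> \<le> X N \<omega>"
  shows "(\<integral>\<^sup>+\<omega>. ennreal (Y \<omega>) \<partial>M) \<le> B"
proof -
  have "(\<integral>\<^sup>+\<omega>. ennreal (Y \<omega>) \<partial>M) \<le> (\<integral>\<^sup>+\<omega>. liminf (\<lambda>N. ennreal (X N \<omega>)) \<partial>M)"
  proof (rule nn_integral_mono_AE)
    show "AE \<omega> in M. ennreal (Y \<omega>) \<le> liminf (\<lambda>N. ennreal (X N \<omega>))"
      using le
    proof eventually_elim
      case (elim \<omega>)
      then have "\<forall>\<^sub>F N in sequentially. ennreal (Y \<omega>) \<le> ennreal (X N \<omega>)"
        by eventually_elim (rule ennreal_leI)
      then show ?case by (rule Liminf_bounded)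
    qed
  qed
  also have "\<dots> \<le> liminf (\<lambda>N. \<integral>\<^sup>+\<omega>. ennreal (X N \<omega>) \<partial>M)"
    using X by (intro nn_integral_liminf) simp
  also have "\<dots> \<le> liminf (\<lambda>N. B)" by (intro Liminf_mono always_eventually allI B)
  also have "\<dots> = B" by (simp add: Liminf_const)
  finally show ?thesis .
qed

lemma visits_upto_tendsto:
  assumes "0 \<le> r" "r \<le> 1" shows "(\<lambda>N. visits_upto r N m) \<longlonglongrightarrow> visits r m"
  unfolding visits_upto_def visits_def potential_def
  by (intro summable_LIMSEQ potential_summable assms) simp

lemma mean_tree_size: 
  assumes n: "0 < n"
  shows "(\<integral>\<omega>. real (card (tr \<omega>)) \<partial>M) = mean_vertices n"
proof -
  have weighted_count: "weighted_count 1 N [] \<omega> = real (card {u \<in> words b N. u \<in> tr \<omega>})" for N \<omega>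
    unfolding weighted_count_def by (simp add: occ_eq words_vertices Int_def cong: sum.cong)
  have "(\<integral>\<^sup>+\<omega>. ennreal (real (card (tr \<omega>))) \<partial>M) \<le> ennreal (mean_vertices n)"
  proof (rule fatou_bound[of "\<lambda>N. weighted_count 1 N []"])
    show "weighted_count 1 N [] \<in> borel_measurable M" for N by (rule weighted_count_measurable) simp
    show "(\<integral>\<^sup>+\<omega>. ennreal (weighted_count 1 N [] \<omega>) \<partial>M) \<le> ennreal (mean_vertices n)" for N
      using visits_upto_le[of 1 N n] by (simp add: weighted_count_mean visits_def mean_vertices_def ennreal_leI)
    show "AE \<omega> in M. \<forall>\<^sub>F N in sequentially. real (card (tr \<omega>)) \<le> weighted_count 1 N [] \<omega>"
      using AE_good[OF n]
    proof eventually_elim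
      case (elim \<omega>)
      show ?case using tree_in_words[OF elim]
      proof eventually_elim
        case (elim N)
        then have "{u \<in> words b N. u \<in> tr \<omega>} = tr \<omega>" by blast
        then show ?case by (simp add: weighted_count)
      qed
    qed
  qed
  moreover have "ennreal (mean_vertices n) \<le> (\<integral>\<^sup>+\<omega>. ennreal (real (card (tr \<omega>))) \<partial>M)"
  proof (rule LIMSEQ_le_const2)
    show "(\<lambda>N. ennreal (visits_upto 1 N n)) \<longlonglongrightarrow> ennreal (mean_vertices n)"
      using visits_upto_tendsto[of 1 n] by (intro tendsto_ennrealI) (simp add: visits_def mean_vertices_def)
    have "ennreal (visits_upto 1 N n) \<le> (\<integral>\<^sup>+\<omega>. ennreal (real (card (tr \<omega>))) \<partial>M)" for N
    proof -
      have "ennreal (visits_upto 1 N n) = (\<integral>\<^sup>+\<omega>. ennreal (weighted_count 1 N [] \<omega>) \<partial>M)" by (simp add: weighted_count_mean)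
      also have "\<dots> \<le> (\<integral>\<^sup>+\<omega>. ennreal (real (card (tr \<omega>))) \<partial>M)"
      proof (rule nn_integral_mono_AE)
        show "AE \<omega> in M. ennreal (weighted_count 1 N [] \<omega>) \<le> ennreal (real (card (tr \<omega>)))"
          using AE_good[OF n]
        proof eventually_elim
          case (elim \<omega>)
          then have "card {u \<in> words b N. u \<in> tr \<omega>} \<le> card (tr \<omega>)"
            by (intro card_mono) (auto simp: good_def)
          then show ?case by (simp add: weighted_count)
        qed
      qed
      finally show ?thesis .
    qed
    then show "\<exists>N0. \<forall>N\<ge>N0. ennreal (visits_upto 1 N n) \<le> (\<integral>\<^sup>+\<omega>. ennreal (real (card (tr \<omega>))) \<partial>M)" by blast
  qed
  ultimately have "(\<integral>\<^sup>+\<omega>. ennreal (real (card (tr \<omega>))) \<partial>M) = ennreal (mean_vertices n)" by (rule antisym)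
  moreover have "(\<lambda>\<omega>. real (card (tr \<omega>))) \<in> borel_measurable M"
    by (rule measurable_compose[OF card_random_set_measurable[OF tree_sets]]) simp
  ultimately show ?thesis by (subst integral_eq_nn_integral) (simp_all add: mean_vertices_nonneg)
qed

text \<open>
Chebyshev's inequality around an arbitrary centre \<open>a\<close>.  Only a lower bound of the mean enters, because
the mean has a negative coefficient in \<open>E (G - a)\<^sup>2\<close>.
\<close>

lemma root_deviation:
  assumes n: "0 < n" and a: "0 \<le> a" and t: "0 < t" and H: "\<And>L. (\<Sum>l<L. p ^ l * (P ^^ l) (tau p) n) \<le> H"
  shows "prob {\<omega> \<in> space M. t < \<bar>real (root_cluster_size (tr \<omega>) (mark \<omega>)) - a\<bar>}
    \<le> (H - 2 * a * visits p n + a\<^sup>2) / t\<^sup>2"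
proof -
  define G where "G \<omega> = real (root_cluster_size (tr \<omega>) (mark \<omega>))" for \<omega>
  have G: "G \<in> borel_measurable M" unfolding G_def[abs_def] by (rule root_size_measurable)
  have G0: "0 \<le> G \<omega>" for \<omega> by (simp add: G_def)
  have H0: "0 \<le> H" using H[of 0] by simp
  have sq: "(\<integral>\<^sup>+\<omega>. ennreal ((G \<omega>)\<^sup>2) \<partial>M) \<le> ennreal H"
  proof (rule fatou_bound[of "\<lambda>N \<omega>. (root_count N \<omega>)\<^sup>2"])
    show "(\<lambda>\<omega>. (root_count N \<omega>)\<^sup>2) \<in> borel_measurable M" for N
      using root_count_measurable by (rule borel_measurable_power)
    show "(\<integral>\<^sup>+\<omega>. ennreal ((root_count N \<omega>)\<^sup>2) \<partial>M) \<le> ennreal H" for N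
      using root_count_square[of N] ennreal_leI[OF H[of N]] by (rule order_trans)
    show "AE \<omega> in M. \<forall>\<^sub>F N in sequentially. (G \<omega>)\<^sup>2 \<le> (root_count N \<omega>)\<^sup>2"
      unfolding G_def using AE_good[OF n] by eventually_elim (rule root_count_eventually)
  qed
  have G2: "(\<lambda>\<omega>. (G \<omega>)\<^sup>2) \<in> borel_measurable M" using G by (rule borel_measurable_power)
  have int2: "integrable M (\<lambda>\<omega>. (G \<omega>)\<^sup>2)"
    by (rule integrableI_nonneg[OF G2]) (use sq in \<open>auto intro: le_less_trans\<close>)
  have int1: "integrable M G" by (rule square_integrable_imp_integrable[OF G int2])
  have EG2: "expectation (\<lambda>\<omega>. (G \<omega>)\<^sup>2) \<le> H"
    using sq H0 by (subst (asm) nn_integral_eq_integral[OF int2]) (simp_all add: ennreal_le_iff)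
  have "visits_upto p N n \<le> expectation G" for N
  proof -
    have "ennreal (visits_upto p N n) = (\<integral>\<^sup>+\<omega>. ennreal (root_count N \<omega>) \<partial>M)" by (rule root_count_mean[symmetric])
    also have "\<dots> \<le> (\<integral>\<^sup>+\<omega>. ennreal (G \<omega>) \<partial>M)"
    proof (rule nn_integral_mono_AE)
      show "AE \<omega> in M. ennreal (root_count N \<omega>) \<le> ennreal (G \<omega>)"
        unfolding G_def using AE_good[OF n] by eventually_elim (intro ennreal_leI root_count_le)
    qed
    also have "\<dots> = ennreal (expectation G)" using G0 by (intro nn_integral_eq_integral int1) simp
    finally show ?thesis using G0 by (simp add: ennreal_le_iff)
  qed
  then have EG: "visits p n \<le> expectation G"
    by (intro LIMSEQ_le_const2[OF visits_upto_tendsto[OF p_range]]) blast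
  have exp: "(\<lambda>\<omega>. (G \<omega> - a)\<^sup>2) = (\<lambda>\<omega>. ((G \<omega>)\<^sup>2 - (2 * a) * G \<omega>) + a\<^sup>2)"
    by (rule ext) (simp add: power2_diff)
  have int3: "integrable M (\<lambda>\<omega>. (G \<omega> - a)\<^sup>2)"
    unfolding exp by (intro Bochner_Integration.integrable_add Bochner_Integration.integrable_diff int2 integrable_mult_right int1) simp
  have "expectation (\<lambda>\<omega>. (G \<omega> - a)\<^sup>2) = expectation (\<lambda>\<omega>. (G \<omega>)\<^sup>2) - 2 * a * expectation G + a\<^sup>2"
    unfolding exp using int1 int2 by (simp add: prob_space)
  also have "\<dots> \<le> H - 2 * a * visits p n + a\<^sup>2"
    using EG2 mult_left_mono[OF EG, of "2 * a"] a by linarith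
  finally have E: "expectation (\<lambda>\<omega>. (G \<omega> - a)\<^sup>2) \<le> H - 2 * a * visits p n + a\<^sup>2" .
  have G3: "(\<lambda>\<omega>. (G \<omega> - a)\<^sup>2) \<in> borel_measurable M" using int3 by (rule borel_measurable_integrable)
  have "prob {\<omega> \<in> space M. t < \<bar>G \<omega> - a\<bar>} \<le> prob {\<omega> \<in> space M. t\<^sup>2 \<le> (G \<omega> - a)\<^sup>2}"
  proof (rule finite_measure_mono)
    show "{\<omega> \<in> space M. t < \<bar>G \<omega> - a\<bar>} \<subseteq> {\<omega> \<in> space M. t\<^sup>2 \<le> (G \<omega> - a)\<^sup>2}"
      using t by (auto intro: abs_le_square_iff[THEN iffD1])
    show "{\<omega> \<in> space M. t\<^sup>2 \<le> (G \<omega> - a)\<^sup>2} \<in> sets M" using G3 by measurable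
  qed
  also have "\<dots> \<le> expectation (\<lambda>\<omega>. (G \<omega> - a)\<^sup>2) / t\<^sup>2"
    using t by (intro integral_Markov_inequality_measure[OF int3 sets.top]) auto
  also have "\<dots> \<le> (H - 2 * a * visits p n + a\<^sup>2) / t\<^sup>2" using E by (intro divide_right_mono) auto
  finally show ?thesis by (simp add: G_def)
qed

lemma second_deviation:
  assumes n: "0 < n" and t: "0 < t" and C: "\<And>L. (\<Sum>l<L. real l * (P ^^ l) (tau 1) n) \<le> C"
  shows "prob {\<omega> \<in> space M. t < real (second_cluster_size (tr \<omega>) (mark \<omega>))} \<le> (1 - p) * C / t\<^sup>2"
proof -
  define Y where "Y \<omega> = real (second_cluster_size (tr \<omega>) (mark \<omega>))" for \<omega>
  have Y: "Y \<in> borel_measurable M" unfolding Y_def[abs_def] by (rule second_size_measurable)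
  have C0: "0 \<le> (1 - p) * C" using C[of 0] p_range by simp
  have sq: "(\<integral>\<^sup>+\<omega>. ennreal ((Y \<omega>)\<^sup>2) \<partial>M) \<le> ennreal ((1 - p) * C)"
  proof (rule fatou_bound[of severed_pairs, OF severed_pairs_measurable])
    show "(\<integral>\<^sup>+\<omega>. ennreal (severed_pairs N \<omega>) \<partial>M) \<le> ennreal ((1 - p) * C)" for N
    proof (rule order_trans[OF severed_pairs_mean ennreal_leI])
      show "(1 - p) * (\<Sum>l<N. real l * (P ^^ l) (tau 1) n) \<le> (1 - p) * C"
        using p_range by (intro mult_left_mono C) simp
    qed
    show "AE \<omega> in M. \<forall>\<^sub>F N in sequentially. (Y \<omega>)\<^sup>2 \<le> severed_pairs N \<omega>"
      unfolding Y_def using AE_good[OF n] by eventually_elim (rule severed_pairs_eventually)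
  qed
  have Y2: "(\<lambda>\<omega>. (Y \<omega>)\<^sup>2) \<in> borel_measurable M" using Y by (rule borel_measurable_power)
  have int2: "integrable M (\<lambda>\<omega>. (Y \<omega>)\<^sup>2)"
    by (rule integrableI_nonneg[OF Y2]) (use sq in \<open>auto intro: le_less_trans\<close>)
  have E: "expectation (\<lambda>\<omega>. (Y \<omega>)\<^sup>2) \<le> (1 - p) * C"
    using sq C0 by (subst (asm) nn_integral_eq_integral[OF int2]) (simp_all add: ennreal_le_iff)
  have "prob {\<omega> \<in> space M. t < Y \<omega>} \<le> prob {\<omega> \<in> space M. t\<^sup>2 \<le> (Y \<omega>)\<^sup>2}"
  proof (rule finite_measure_mono)
    show "{\<omega> \<in> space M. t < Y \<omega>} \<subseteq> {\<omega> \<in> space M. t\<^sup>2 \<le> (Y \<omega>)\<^sup>2}"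
      using t by (auto intro: power_mono)
    show "{\<omega> \<in> space M. t\<^sup>2 \<le> (Y \<omega>)\<^sup>2} \<in> sets M" using Y2 by measurable
  qed
  also have "\<dots> \<le> expectation (\<lambda>\<omega>. (Y \<omega>)\<^sup>2) / t\<^sup>2"
    using t by (intro integral_Markov_inequality_measure[OF int2 sets.top]) auto
  also have "\<dots> \<le> (1 - p) * C / t\<^sup>2" using E by (intro divide_right_mono) auto
  finally show ?thesis by (simp add: Y_def)
qed

end

section \<open>The limit theorem\<close>

context linear_split_kernel
begin

lemma percolated_modelI:
  "percolated_split_tree M b s s0 s1 D n V balls p keep \<Longrightarrow> percolated_model M b s s0 s1 D n V balls p keep"
  by (intro percolated_model.intro split_tree_model.intro split_kernel_axioms)
     (auto dest: percolated_split_tree.axioms)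

lemma root_cluster_law:
  fixes M :: "nat \<Rightarrow> 'w measure"
  assumes model: "\<forall>\<^sub>F n in sequentially. percolated_split_tree (M n) b s s0 s1 D n (V n) (balls n) (pn n) (keep n)"
  shows "tendsto_in_prob M
    (\<lambda>n \<omega>. real (root_cluster_size (split_tree b (balls n) \<omega>) (\<lambda>e. keep n e \<omega>)) / real n) (\<alpha> * limit)"
proof -
  let ?G = "\<lambda>n \<omega>. real (root_cluster_size (split_tree b (balls n) \<omega>) (\<lambda>e. keep n e \<omega>))"
  have al: "0 \<le> \<alpha> * limit" using alpha_pos limit_pos by simp
  show ?thesis unfolding tendsto_in_prob_def
  proof (intro conjI allI impI)
    show "\<forall>\<^sub>F n in sequentially. (\<lambda>\<omega>. ?G n \<omega> / real n) \<in> borel_measurable (M n)"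
      using model
    proof eventually_elim
      case (elim n)
      have "?G n \<in> borel_measurable (M n)"
        by (rule percolated_model.root_size_measurable[OF percolated_modelI[OF elim]])
      then show ?case by simp
    qed
    fix \<delta> :: real assume \<delta>: "0 < \<delta>"
    show "(\<lambda>n. measure (M n) {\<omega> \<in> space (M n). \<delta> < \<bar>?G n \<omega> / real n - \<alpha> * limit\<bar>}) \<longlonglongrightarrow> 0"
    proof (rule tendstoI)
      fix e :: real assume e: "0 < e"
      \<comment> \<open>With errors \<open>\<epsilon> n\<close> and \<open>\<epsilon> n\<^sup>2\<close> in the two moments, the variance around the limit is at most \<open>\<epsilon> w n\<^sup>2\<close>.\<close>
      define w where "w = 1 + 2 * (\<alpha> * limit)"
      have w: "0 < w" using al by (simp add: w_def)
      define \<epsilon> where "\<epsilon> = e * \<delta>\<^sup>2 / (2 * w)"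
      have \<epsilon>: "0 < \<epsilon>" "\<epsilon> * w = e * \<delta>\<^sup>2 / 2"
        using e \<delta> w by (simp_all add: \<epsilon>_def)
      show "\<forall>\<^sub>F n in sequentially. dist (measure (M n) {\<omega> \<in> space (M n). \<delta> < \<bar>?G n \<omega> / real n - \<alpha> * limit\<bar>}) 0 < e"
        using model visits_lower[OF \<epsilon>(1)] second_moment_upper[OF \<epsilon>(1)] eventually_gt_at_top[of 0]
      proof eventually_elim
        case (elim n)
        interpret mod: percolated_model "M n" b s s0 s1 D n "V n" "balls n" "pn n" "keep n"
          by (rule percolated_modelI[OF elim(1)])
        let ?a = "\<alpha> * limit * real n"
        have n: "0 < real n" using elim(4) by simp
        have set: "{\<omega> \<in> space (M n). \<delta> < \<bar>?G n \<omega> / real n - \<alpha> * limit\<bar>} =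
          {\<omega> \<in> space (M n). \<delta> * real n < \<bar>?G n \<omega> - ?a\<bar>}"
        proof -
          have "\<delta> < \<bar>g / real n - \<alpha> * limit\<bar> \<longleftrightarrow> \<delta> * real n < \<bar>g - ?a\<bar>" for g
          proof -
            have "\<bar>g - ?a\<bar> = \<bar>g / real n - \<alpha> * limit\<bar> * real n"
              using n by (simp add: abs_mult_pos' algebra_simps flip: abs_mult_pos)
            then show ?thesis using n by simp
          qed
          then show ?thesis by simp
        qed
        have "measure (M n) {\<omega> \<in> space (M n). \<delta> * real n < \<bar>?G n \<omega> - ?a\<bar>} \<le>
          (((\<alpha> * limit)\<^sup>2 + \<epsilon>) * sq n - 2 * ?a * visits (pn n) n + ?a\<^sup>2) / (\<delta> * real n)\<^sup>2"
          using elim n \<delta> al by (intro mod.root_deviation) auto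
        also have "\<dots> \<le> (e * \<delta>\<^sup>2 / 2 * sq n) / (\<delta> * real n)\<^sup>2"
        proof (rule divide_right_mono)
          have "2 * ?a * ((\<alpha> * limit - \<epsilon>) * real n) \<le> 2 * ?a * visits (pn n) n"
            using elim(2) al by (intro mult_left_mono) auto
          moreover have "((\<alpha> * limit)\<^sup>2 + \<epsilon>) * sq n - 2 * ?a * ((\<alpha> * limit - \<epsilon>) * real n) + ?a\<^sup>2 =
            \<epsilon> * w * sq n" by (simp add: w_def power2_eq_square algebra_simps)
          ultimately show "((\<alpha> * limit)\<^sup>2 + \<epsilon>) * sq n - 2 * ?a * visits (pn n) n + ?a\<^sup>2 \<le> e * \<delta>\<^sup>2 / 2 * sq n"
            unfolding \<epsilon>(2) by linarith
        qed simp
        also have "\<dots> = e / 2" using n \<delta> by (simp add: power_mult_distrib)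
        also have "\<dots> < e" using e by simp
        finally show ?case unfolding set by simp
      qed
    qed
  qed
qed

lemma second_cluster_law:
  fixes M :: "nat \<Rightarrow> 'w measure"
  assumes model: "\<forall>\<^sub>F n in sequentially. percolated_split_tree (M n) b s s0 s1 D n (V n) (balls n) (pn n) (keep n)"
  shows "tendsto_in_prob M
    (\<lambda>n \<omega>. real (second_cluster_size (split_tree b (balls n) \<omega>) (\<lambda>e. keep n e \<omega>)) / real n) 0"
proof -
  let ?Y = "\<lambda>n \<omega>. real (second_cluster_size (split_tree b (balls n) \<omega>) (\<lambda>e. keep n e \<omega>))"
  obtain C where C: "\<And>n L. (\<Sum>l<L. real l * (P ^^ l) (tau 1) n) \<le> C * sq n"
    using weighted_tau_sum by blast
  show ?thesis unfolding tendsto_in_prob_def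
  proof (intro conjI allI impI)
    show "\<forall>\<^sub>F n in sequentially. (\<lambda>\<omega>. ?Y n \<omega> / real n) \<in> borel_measurable (M n)"
      using model
    proof eventually_elim
      case (elim n)
      have "?Y n \<in> borel_measurable (M n)"
        by (rule percolated_model.second_size_measurable[OF percolated_modelI[OF elim]])
      then show ?case by simp
    qed
    fix \<delta> :: real assume \<delta>: "0 < \<delta>"
    show "(\<lambda>n. measure (M n) {\<omega> \<in> space (M n). \<delta> < \<bar>?Y n \<omega> / real n - 0\<bar>}) \<longlonglongrightarrow> 0"
    proof (rule tendsto_sandwich[OF _ _ tendsto_const])
      show "(\<lambda>n. c / ln (real n) * (C / \<delta>\<^sup>2)) \<longlonglongrightarrow> 0" by real_asymp
      show "\<forall>\<^sub>F n in sequentially. measure (M n) {\<omega> \<in> space (M n). \<delta> < \<bar>?Y n \<omega> / real n - 0\<bar>}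
        \<le> c / ln (real n) * (C / \<delta>\<^sup>2)"
        using model eventually_gt_at_top[of 0]
      proof eventually_elim
        case (elim n)
        interpret mod: percolated_model "M n" b s s0 s1 D n "V n" "balls n" "pn n" "keep n"
          by (rule percolated_modelI[OF elim(1)])
        have n: "0 < real n" using elim(2) by simp
        have set: "{\<omega> \<in> space (M n). \<delta> < \<bar>?Y n \<omega> / real n - 0\<bar>} = {\<omega> \<in> space (M n). \<delta> * real n < ?Y n \<omega>}"
          using n by (simp add: less_divide_eq)
        have "measure (M n) {\<omega> \<in> space (M n). \<delta> * real n < ?Y n \<omega>} \<le> (1 - pn n) * (C * sq n) / (\<delta> * real n)\<^sup>2"
          using elim(2) n \<delta> by (intro mod.second_deviation C) auto
        also have "\<dots> = c / ln (real n) * (C / \<delta>\<^sup>2)"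
          using n \<delta> by (simp add: pn_def power_mult_distrib)
        finally show ?case unfolding set .
      qed
    qed simp
  qed
qed

end

theorem lemma3:
  fixes b s s0 s1 :: nat
    and D :: "(nat \<Rightarrow> real) measure"
    and M :: "nat \<Rightarrow> 'w measure"
    and V :: "nat \<Rightarrow> nat list \<Rightarrow> 'w \<Rightarrow> nat \<Rightarrow> real"
    and balls :: "nat \<Rightarrow> nat list \<Rightarrow> 'w \<Rightarrow> nat"
    and keep :: "nat \<Rightarrow> nat list \<Rightarrow> 'w \<Rightarrow> bool"
    and \<alpha> \<epsilon> c :: real
  assumes "2 \<le> b" and "0 < s" and "s0 \<le> s" and "b * s1 \<le> s + 1 - s0"
    and "split_vector_law b D"
    and "measure D {v \<in> space D. v 0 = 1} = 0"
    and "measure D {v \<in> space D. v 0 = 0} = 0"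
    and "log_non_lattice D"
    and "0 < \<alpha>" and "0 < \<epsilon>" and "0 < c"
    and "\<forall>\<^sub>F n in sequentially.
           percolated_split_tree (M n) b s s0 s1 D n (V n) (balls n) (1 - c / ln (real n)) (keep n)"
    and "(\<lambda>n. (\<integral>\<omega>. real (card (split_tree b (balls n) \<omega>)) \<partial>M n) - \<alpha> * real n)
           \<in> O(\<lambda>n. real n * ln (real n) powr (- 1 - \<epsilon>))"
  shows "tendsto_in_prob M
           (\<lambda>n \<omega>. real (root_cluster_size (split_tree b (balls n) \<omega>) (\<lambda>e. keep n e \<omega>)) / real n)
           (\<alpha> * exp (- c / split_mu b D))
       \<and> tendsto_in_prob M
           (\<lambda>n \<omega>. real (second_cluster_size (split_tree b (balls n) \<omega>) (\<lambda>e. keep n e \<omega>)) / real n)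
           0"
proof -
  interpret split_kernel b s s0 s1 D
    by (rule split_kernel.intro) (use assms in auto)
  let ?E = "\<lambda>n. \<integral>\<omega>. real (card (split_tree b (balls n) \<omega>)) \<partial>M n"
  have mean: "\<forall>\<^sub>F n in sequentially. ?E n = mean_vertices n"
    using assms(12) eventually_gt_at_top[of 0]
  proof eventually_elim
    case (elim n)
    interpret mod: percolated_model "M n" b s s0 s1 D n "V n" "balls n" "1 - c / ln (real n)" "keep n"
      by (intro percolated_model.intro split_tree_model.intro split_kernel_axioms)
         (use elim(1) in \<open>auto dest: percolated_split_tree.axioms\<close>)
    show ?case using elim(2) by (rule mod.mean_tree_size)
  qed
  have lim: "((\<lambda>n. (?E n - \<alpha> * real n) / real n) \<longlongrightarrow> 0) sequentially"
  proof (rule smalloD_tendsto)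
    have "(\<lambda>n. real n * ln (real n) powr (- 1 - \<epsilon>)) \<in> o(\<lambda>n. real n)"
      using assms(10) by real_asymp
    then show "(\<lambda>n. ?E n - \<alpha> * real n) \<in> o(\<lambda>n. real n)"
      by (rule landau_o.big_small_trans[OF assms(13)])
  qed
  have "((\<lambda>n. mean_vertices n / real n - \<alpha>) \<longlongrightarrow> 0) sequentially"
  proof (rule Lim_transform_eventually[OF lim])
    show "\<forall>\<^sub>F n in sequentially. (?E n - \<alpha> * real n) / real n = mean_vertices n / real n - \<alpha>"
      using mean eventually_gt_at_top[of 0] by eventually_elim (simp add: diff_divide_distrib)
  qed
  then have "(\<lambda>n. mean_vertices n / real n) \<longlonglongrightarrow> \<alpha>" by (simp add: LIM_zero_iff)
  then interpret linear_split_kernel b s s0 s1 D \<alpha> c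
    by (unfold_locales) (use assms(9,11) in auto)
  have model: "\<forall>\<^sub>F n in sequentially. percolated_split_tree (M n) b s s0 s1 D n (V n) (balls n) (pn n) (keep n)"
    using assms(12) by (simp only: pn_def)
  show ?thesis
    using root_cluster_law[OF model] second_cluster_law[OF model] by (simp add: limit_def \<mu>_def)
qed

end
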